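(* Let $\mathbb{W}=m_1P_1+\cdots+m_sP_s$ be a fat point scheme in $\mathbb{P}^n$, and let $m_{\max}=\max\{m_1,\dots,m_s\}$. The following conditions are equivalent. (a) The scheme $\mathbb{W}$ is not reduced, i.e., $m_{\max}>1$. (b) There exists $m\in\{2,\dots,n+1\}$ such that $\mathrm{HP}_{\Omega^m_{R_{\mathbb{W}}/K}}(z)>0$. (c) $\mathrm{HP}_{\Omega^{n+1}_{R_{\mathbb{W}}/K}}(z)>0$.
   Context: $K$ is a field of characteristic zero, $S=K[X_0,\dots,X_n]$ ($n\ge1$) with the standard grading is the homogeneous coordinate ring of $\mathbb{P}^n$ over $K$. Given distinct $K$-rational points $P_1,\dots,P_s\in\mathbb{P}^n$ ($s\ge1$, coordinates chosen so that none lies on $X_0=0$) with homogeneous vanishing ideals $\wp_1,\dots,\wp_s\subseteq S$ and positive integers $m_1,\dots,m_s$, the fat point scheme $\mathbb{W}=m_1P_1+\cdots+m_sP_s$ is the $0$-dimensional subscheme of $\mathbb{P}^n$ with homogeneous vanishing ideal $I_{\mathbb{W}}=\wp_1^{m_1}\cap\cdots\cap\wp_s^{m_s}$; $R_{\mathbb{W}}=S/I_{\mathbb{W}}$. $\Omega^1_{R_{\mathbb{W}}/K}$ is the module of Kähler differentials of $R_{\mathbb{W}}/K$, graded with $\deg(dx_i)=1$ where $x_i$ is the image of $X_i$, and $\Omega^m_{R_{\mathbb{W}}/K}=\bigwedge^m_{R_{\mathbb{W}}}\Omega^1_{R_{\mathbb{W}}/K}$. $\mathrm{HP}_M$ denotes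 the Hilbert polynomial of a finitely generated graded module $M$; for the modules $\Omega^m_{R_{\mathbb{W}}/K}$ with $m\ge 1$ it is a constant polynomial. *)

theory Defs
  imports
    "HOL-Library.Poly_Mapping"
    "HOL-Computational_Algebra.Polynomial"
    "HOL-Algebra.Ideal_Product"
    "HOL-Algebra.QuotRing"
    "Jordan_Normal_Form.VS_Connect"
begin

section \<open>Modules over a commutative ring\<close>

text \<open>Module records extend ring records; the fields \<open>mult\<close> and \<open>one\<close> carry no meaning for
  a module and are left undefined in the constructions below.\<close>

definition free_module :: "('r, 'x) ring_scheme \<Rightarrow> 'b set \<Rightarrow> ('r, 'b \<Rightarrow> 'r) module" where
  "free_module R B =
    \<lparr>carrier = {f. (\<forall>b. f b \<in> carrier R) \<and> finite {b. f b \<noteq> \<zero>\<^bsub>R\<^esub>} \<and> {b. f b \<noteq> \<zero>\<^bsub>R\<^esub>} \<subseteq> B},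
     mult = undefined, one = undefined,
     zero = (\<lambda>_. \<zero>\<^bsub>R\<^esub>),
     add = (\<lambda>f g b. f b \<oplus>\<^bsub>R\<^esub> g b),
     smult = (\<lambda>r f b. r \<otimes>\<^bsub>R\<^esub> f b)\<rparr>"

definition free_gen :: "('r, 'x) ring_scheme \<Rightarrow> 'b \<Rightarrow> 'b \<Rightarrow> 'r" where
  "free_gen R b = (\<lambda>b'. if b' = b then \<one>\<^bsub>R\<^esub> else \<zero>\<^bsub>R\<^esub>)"

definition quot_module :: "('r, 'a, 'x) module_scheme \<Rightarrow> 'a set \<Rightarrow> ('r, 'a set) module" where
  "quot_module M N =
    \<lparr>carrier = a_rcosets\<^bsub>M\<^esub> N,
     mult = undefined, one = undefined,
     zero = N,
     add = set_add M,
     smult = (\<lambda>r C. \<Union>x\<in>C. N +>\<^bsub>M\<^esub> (r \<odot>\<^bsub>M\<^esub> x))\<rparr>"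

text \<open>The subset \<open>C\<close> of \<open>M\<close> with scalars from the domain of the ring homomorphism \<open>\<phi>\<close>.\<close>

definition restrict_scalars ::
  "('k \<Rightarrow> 'r) \<Rightarrow> ('r, 'a, 'x) module_scheme \<Rightarrow> 'a set \<Rightarrow> ('k, 'a) module" where
  "restrict_scalars \<phi> M C =
    \<lparr>carrier = C, mult = mult M, one = one M, zero = zero M, add = add M,
     smult = (\<lambda>c. smult M (\<phi> c))\<rparr>"


section \<open>Kaehler differentials and exterior powers\<close>

text \<open>For an algebra \<open>\<phi> : A \<rightarrow> R\<close>, the module of Kaehler differentials is the \<open>R\<close>-module generated
  by symbols \<open>dx\<close>, one for every \<open>x\<close> in \<open>R\<close>, subject to additivity, the Leibniz rule and
  \<open>d(\<phi> a) = 0\<close>.\<close>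

definition kaehler_rels ::
  "('k, 'y) ring_scheme \<Rightarrow> ('k \<Rightarrow> 'r) \<Rightarrow> ('r, 'x) ring_scheme \<Rightarrow> ('r \<Rightarrow> 'r) set" where
  "kaehler_rels A \<phi> R =
    (let F = free_module R (carrier R); D = free_gen R in
      {D (x \<oplus>\<^bsub>R\<^esub> y) \<ominus>\<^bsub>F\<^esub> (D x \<oplus>\<^bsub>F\<^esub> D y) | x y. x \<in> carrier R \<and> y \<in> carrier R} \<union>
      {D (x \<otimes>\<^bsub>R\<^esub> y) \<ominus>\<^bsub>F\<^esub> (x \<odot>\<^bsub>F\<^esub> D y \<oplus>\<^bsub>F\<^esub> y \<odot>\<^bsub>F\<^esub> D x) | x y. x \<in> carrier R \<and> y \<in> carrier R} \<union>
      {D (\<phi> a) | a. a \<in> carrier A})"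

definition kaehler_submodule ::
  "('k, 'y) ring_scheme \<Rightarrow> ('k \<Rightarrow> 'r) \<Rightarrow> ('r, 'x) ring_scheme \<Rightarrow> ('r \<Rightarrow> 'r) set" where
  "kaehler_submodule A \<phi> R =
    LinearCombinations.module.span R (free_module R (carrier R)) (kaehler_rels A \<phi> R)"

definition kaehler_module ::
  "('k, 'y) ring_scheme \<Rightarrow> ('k \<Rightarrow> 'r) \<Rightarrow> ('r, 'x) ring_scheme \<Rightarrow> ('r, ('r \<Rightarrow> 'r) set) module" where
  "kaehler_module A \<phi> R =
    quot_module (free_module R (carrier R)) (kaehler_submodule A \<phi> R)"

definition kaehler_d ::
  "('k, 'y) ring_scheme \<Rightarrow> ('k \<Rightarrow> 'r) \<Rightarrow> ('r, 'x) ring_scheme \<Rightarrow> 'r \<Rightarrow> ('r \<Rightarrow> 'r) set" where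
  "kaehler_d A \<phi> R x =
    kaehler_submodule A \<phi> R +>\<^bsub>free_module R (carrier R)\<^esub> free_gen R x"

text \<open>The \<open>k\<close>-th exterior power of \<open>M\<close> is the free module on the \<open>k\<close>-tuples of elements of \<open>M\<close>
  (lists of length \<open>k\<close>) modulo multilinearity and the vanishing of tuples with a repeated entry.\<close>

definition tuples :: "('r, 'a, 'x) module_scheme \<Rightarrow> nat \<Rightarrow> 'a list set" where
  "tuples M k = {xs. length xs = k \<and> set xs \<subseteq> carrier M}"

definition ext_rels ::
  "('r, 'y) ring_scheme \<Rightarrow> ('r, 'a, 'x) module_scheme \<Rightarrow> nat \<Rightarrow> ('a list \<Rightarrow> 'r) set" where
  "ext_rels R M k =
    (let F = free_module R (tuples M k); G = free_gen R in
      {G (xs[i := x \<oplus>\<^bsub>M\<^esub> y]) \<ominus>\<^bsub>F\<^esub> (G (xs[i := x]) \<oplus>\<^bsub>F\<^esub> G (xs[i := y])) | xs i x y.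
         xs \<in> tuples M k \<and> i < k \<and> x \<in> carrier M \<and> y \<in> carrier M} \<union>
      {G (xs[i := r \<odot>\<^bsub>M\<^esub> x]) \<ominus>\<^bsub>F\<^esub> (r \<odot>\<^bsub>F\<^esub> G (xs[i := x])) | xs i r x.
         xs \<in> tuples M k \<and> i < k \<and> r \<in> carrier R \<and> x \<in> carrier M} \<union>
      {G xs | xs. xs \<in> tuples M k \<and> (\<exists>i j. i < j \<and> j < k \<and> xs ! i = xs ! j)})"

definition ext_submodule ::
  "('r, 'y) ring_scheme \<Rightarrow> ('r, 'a, 'x) module_scheme \<Rightarrow> nat \<Rightarrow> ('a list \<Rightarrow> 'r) set" where
  "ext_submodule R M k = LinearCombinations.module.span R (free_module R (tuples M k)) (ext_rels R M k)"

definition ext_power ::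
  "('r, 'y) ring_scheme \<Rightarrow> ('r, 'a, 'x) module_scheme \<Rightarrow> nat \<Rightarrow> ('r, ('a list \<Rightarrow> 'r) set) module" where
  "ext_power R M k = quot_module (free_module R (tuples M k)) (ext_submodule R M k)"

definition wedge ::
  "('r, 'y) ring_scheme \<Rightarrow> ('r, 'a, 'x) module_scheme \<Rightarrow> 'a list \<Rightarrow> ('a list \<Rightarrow> 'r) set" where
  "wedge R M xs =
    ext_submodule R M (length xs) +>\<^bsub>free_module R (tuples M (length xs))\<^esub> free_gen R xs"


section \<open>The homogeneous coordinate ring of projective space\<close>

text \<open>A polynomial maps each monomial, i.e. exponent vector, to its coefficient.\<close>

type_synonym 'k mpoly = "(nat \<Rightarrow>\<^sub>0 nat) \<Rightarrow>\<^sub>0 'k"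

definition poly_ring :: "nat \<Rightarrow> 'k::field mpoly ring" where
  "poly_ring n =
    \<lparr>carrier = {f. \<forall>t\<in>Poly_Mapping.keys f. Poly_Mapping.keys t \<subseteq> {..n}},
     mult = (*), one = 1, zero = 0, add = (+)\<rparr>"

definition const :: "'k::field \<Rightarrow> 'k mpoly" where
  "const c = Poly_Mapping.single 0 c"

definition indet :: "nat \<Rightarrow> 'k::field mpoly" where
  "indet i = Poly_Mapping.single (Poly_Mapping.single i 1) 1"

definition mpoly_eval :: "(nat \<Rightarrow> 'k::field) \<Rightarrow> 'k mpoly \<Rightarrow> 'k" where
  "mpoly_eval v f =
    (\<Sum>t\<in>Poly_Mapping.keys f. Poly_Mapping.lookup f t *
       (\<Prod>i\<in>Poly_Mapping.keys t. v i ^ Poly_Mapping.lookup t i))"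

definition homogeneous :: "nat \<Rightarrow> 'k::field mpoly \<Rightarrow> bool" where
  "homogeneous d f \<longleftrightarrow>
    (\<forall>t\<in>Poly_Mapping.keys f. (\<Sum>i\<in>Poly_Mapping.keys t. Poly_Mapping.lookup t i) = d)"

text \<open>A point of \<open>\<P>\<^sup>n(K)\<close> is the set of all its homogeneous coordinate vectors
  \<open>(v 0, \<dots>, v n)\<close>; entries beyond index \<open>n\<close> are set to \<open>0\<close>.\<close>

definition coord_vectors :: "nat \<Rightarrow> (nat \<Rightarrow> 'k::field) set" where
  "coord_vectors n = {v. (\<exists>j\<le>n. v j \<noteq> 0) \<and> (\<forall>j>n. v j = 0)}"

definition proj_rel :: "nat \<Rightarrow> ((nat \<Rightarrow> 'k::field) \<times> (nat \<Rightarrow> 'k)) set" where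
  "proj_rel n = {(v, w). v \<in> coord_vectors n \<and> w \<in> coord_vectors n \<and>
                         (\<exists>c. c \<noteq> 0 \<and> (\<forall>j. w j = c * v j))}"

definition proj_space :: "nat \<Rightarrow> (nat \<Rightarrow> 'k::field) set set" where
  "proj_space n = coord_vectors n // proj_rel n"

definition vanishing_ideal :: "nat \<Rightarrow> (nat \<Rightarrow> 'k::field) set \<Rightarrow> 'k mpoly set" where
  "vanishing_ideal n p =
    Idl\<^bsub>poly_ring n\<^esub> {f \<in> carrier (poly_ring n).
      (\<exists>d. homogeneous d f) \<and> (\<forall>v\<in>p. mpoly_eval v f = 0)}"


section \<open>Fat point schemes\<close>

text \<open>The scheme \<open>m 1 P 1 + \<dots> + m s P s\<close> is represented by its homogeneous vanishing ideal.\<close>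

definition fat_ideal ::
  "nat \<Rightarrow> nat \<Rightarrow> (nat \<Rightarrow> (nat \<Rightarrow> 'k::field) set) \<Rightarrow> (nat \<Rightarrow> nat) \<Rightarrow> 'k mpoly set" where
  "fat_ideal n s P m =
    (\<Inter>i\<in>{1..s}. vanishing_ideal n (P i) [^]\<^bsub>ideals_set (poly_ring n)\<^esub> m i)"

definition coord_ring :: "nat \<Rightarrow> 'k::field mpoly set \<Rightarrow> 'k mpoly set ring" where
  "coord_ring n I = poly_ring n Quot I"

definition coord_ring_comp :: "nat \<Rightarrow> 'k::field mpoly set \<Rightarrow> nat \<Rightarrow> 'k mpoly set set" where
  "coord_ring_comp n I d =
    (\<lambda>f. I +>\<^bsub>poly_ring n\<^esub> f) ` {f \<in> carrier (poly_ring n). homogeneous d f}"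

definition coord_ring_const :: "nat \<Rightarrow> 'k::field mpoly set \<Rightarrow> 'k \<Rightarrow> 'k mpoly set" where
  "coord_ring_const n I c = I +>\<^bsub>poly_ring n\<^esub> const c"

definition Omega1 ::
  "nat \<Rightarrow> 'k::field mpoly set \<Rightarrow> ('k mpoly set, ('k mpoly set \<Rightarrow> 'k mpoly set) set) module" where
  "Omega1 n I = kaehler_module class_ring (coord_ring_const n I) (coord_ring n I)"

definition Omega ::
  "nat \<Rightarrow> 'k::field mpoly set \<Rightarrow> nat \<Rightarrow>
    ('k mpoly set, (('k mpoly set \<Rightarrow> 'k mpoly set) set list \<Rightarrow> 'k mpoly set) set) module" where
  "Omega n I k = ext_power (coord_ring n I) (Omega1 n I) k"

text \<open>Since \<open>deg (dx\<^sub>i) = 1\<close>, the component of degree \<open>d\<close> of \<open>\<Omega>\<^sup>1\<close> consists of the sums of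
  elements \<open>a dx\<^sub>i\<close> with \<open>a\<close> homogeneous of degree \<open>d - 1\<close>.\<close>

definition Omega1_comp ::
  "nat \<Rightarrow> 'k::field mpoly set \<Rightarrow> nat \<Rightarrow> ('k mpoly set \<Rightarrow> 'k mpoly set) set set" where
  "Omega1_comp n I d =
    LinearCombinations.module.span class_ring
      (restrict_scalars (coord_ring_const n I) (Omega1 n I) (carrier (Omega1 n I)))
      {a \<odot>\<^bsub>Omega1 n I\<^esub>
         kaehler_d class_ring (coord_ring_const n I) (coord_ring n I) (I +>\<^bsub>poly_ring n\<^esub> indet i) |
       a i e. i \<le> n \<and> e + 1 = d \<and> a \<in> coord_ring_comp n I e}"

text \<open>Exterior powers carry the grading in which the degree of a wedge product of homogeneous
  elements is the sum of their degrees.\<close>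

definition Omega_comp ::
  "nat \<Rightarrow> 'k::field mpoly set \<Rightarrow> nat \<Rightarrow> nat \<Rightarrow>
    (('k mpoly set \<Rightarrow> 'k mpoly set) set list \<Rightarrow> 'k mpoly set) set set" where
  "Omega_comp n I k d =
    LinearCombinations.module.span class_ring
      (restrict_scalars (coord_ring_const n I) (Omega n I k) (carrier (Omega n I k)))
      {wedge (coord_ring n I) (Omega1 n I) ws | ws es.
         length ws = k \<and> length es = k \<and> sum_list es = d \<and>
         (\<forall>i<k. ws ! i \<in> Omega1_comp n I (es ! i))}"


section \<open>Hilbert polynomials\<close>

definition is_hilbert_polynomial :: "(nat \<Rightarrow> nat) \<Rightarrow> rat poly \<Rightarrow> bool" where
  "is_hilbert_polynomial H p \<longleftrightarrow>
    (\<forall>\<^sub>F d in sequentially. of_nat (H d) = poly p (of_nat d))"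

text \<open>A polynomial with this property is unique, because it is determined by its values at
  infinitely many arguments.\<close>

definition hilbert_polynomial :: "(nat \<Rightarrow> nat) \<Rightarrow> rat poly" where
  "hilbert_polynomial H = (THE p. is_hilbert_polynomial H p)"

definition HF_Omega :: "nat \<Rightarrow> 'k::field mpoly set \<Rightarrow> nat \<Rightarrow> nat \<Rightarrow> nat" where
  "HF_Omega n I k d =
    vectorspace.dim class_ring
      (restrict_scalars (coord_ring_const n I) (Omega n I k) (Omega_comp n I k d))"

definition HP_Omega :: "nat \<Rightarrow> 'k::field mpoly set \<Rightarrow> nat \<Rightarrow> rat poly" where
  "HP_Omega n I k = hilbert_polynomial (HF_Omega n I k)"

end

theory Submission
  imports Defs
begin

text \<open>Normalize coordinates so that \<open>X\<^sub>0 = 1\<close> at every point. Since no point lies on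
  \<open>X\<^sub>0 = 0\<close>, powers of all variables are multiples of \<open>X\<^sub>0\<close> modulo the vanishing ideal, so
  multiplication by \<open>x\<^sub>0\<close> maps each graded piece of \<open>\<Omega>\<^sup>k\<close> of large degree onto the next one. The
  Hilbert function is therefore eventually decreasing, hence eventually constant, and it only
  remains to decide when the large pieces vanish.

  If some multiplicity is at least \<open>2\<close>, then evaluation and gradient at that point are defined on
  the coordinate ring; the determinant of the gradients is a linear form on \<open>\<Omega>\<^sup>n\<^sup>+\<^sup>1\<close> that does
  not vanish on \<open>x\<^sub>0\<^sup>e dx\<^sub>0 \<and> \<dots> \<and> dx\<^sub>n\<close>. If all multiplicities are \<open>1\<close>, let
  \<open>f\<^sub>i\<close> be homogeneous of degree \<open>s - 1\<close>, equal to \<open>1\<close> at the \<open>i\<close>-th point and \<open>0\<close> at the others.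
  Then \<open>f\<^sub>i\<close> kills \<open>x\<^sub>j - c x\<^sub>0\<close> for the \<open>j\<close>-th coordinate \<open>c\<close> of that point, so \<open>f\<^sub>i\<^sup>2 dx\<^sub>j\<close> is a
  multiple of \<open>dx\<^sub>0\<close> and \<open>f\<^sub>i\<^sup>4\<close> kills \<open>\<Omega>\<^sup>k\<close> for \<open>k \<ge> 2\<close>; but the sum of the \<open>f\<^sub>i\<^sup>4\<close> is a power
  of \<open>x\<^sub>0\<close>, which acts surjectively in large degrees.\<close>

section \<open>Free modules and quotient modules\<close>

text \<open>Differentials and exterior powers are quotients of free modules on all ring elements and
  on all tuples. The relations suffice to show that an element is zero; to show that one is nonzero,
  a map out of the quotient that respects every relation is needed. The target of these maps is the
  field itself, with the ring acting through evaluation at the fat point. The gradient there depends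
  only on classes because multiplicity at least 2 puts the ideal into the square of the ideal of the
  point, where the product rule makes value and gradient vanish. Dimension is the least size of a
  finite generating set. Comparing dimensions therefore uses only surjectivity of multiplication by
  \<open>x 0\<close>, together with finite generation of each graded piece by wedges of monomial
  multiples of the \<open>dx_i\<close>. The exponent 4 counts one square for each of two entries of
  a wedge. The degree \<open>s - 1\<close> is the number of other points, the same for every
  separator, so that the sum of the fourth powers is homogeneous of degree
  \<open>4 * (s - 1)\<close> and can be compared with a power of \<open>X_0\<close> at the
  points.\<close>

lemma free_module_sel [simp]:
  "carrier (free_module R B) =
    {f. (\<forall>b. f b \<in> carrier R) \<and> finite {b. f b \<noteq> \<zero>\<^bsub>R\<^esub>} \<and> {b. f b \<noteq> \<zero>\<^bsub>R\<^esub>} \<subseteq> B}"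
  "zero (free_module R B) = (\<lambda>_. \<zero>\<^bsub>R\<^esub>)"
  "add (free_module R B) = (\<lambda>f g b. f b \<oplus>\<^bsub>R\<^esub> g b)"
  "smult (free_module R B) = (\<lambda>r f b. r \<otimes>\<^bsub>R\<^esub> f b)"
  by (simp_all add: free_module_def)

lemma (in cring) free_module_is_module: "Module.module R (free_module R B)"
proof (rule moduleI)
  let ?F = "free_module R B"
  have supp_add: "{b. f b \<oplus> g b \<noteq> \<zero>} \<subseteq> {b. f b \<noteq> \<zero>} \<union> {b. g b \<noteq> \<zero>}" for f g :: "'c \<Rightarrow> 'a"
    by auto
  show "cring R" by (rule is_cring)
  show "abelian_group ?F"
  proof (rule abelian_groupI)
    fix f g assume "f \<in> carrier ?F" "g \<in> carrier ?F"
    then show "f \<oplus>\<^bsub>?F\<^esub> g \<in> carrier ?F"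
      using supp_add[of f g] finite_subset[OF supp_add[of f g]] by auto
  next
    fix f assume f: "f \<in> carrier ?F"
    have "{b. \<ominus> f b \<noteq> \<zero>} = {b. f b \<noteq> \<zero>}" using f by auto
    then have "(\<lambda>b. \<ominus> f b) \<in> carrier ?F" using f by simp
    moreover have "(\<lambda>b. \<ominus> f b) \<oplus>\<^bsub>?F\<^esub> f = \<zero>\<^bsub>?F\<^esub>" using f by (auto simp: l_neg)
    ultimately show "\<exists>y\<in>carrier ?F. y \<oplus>\<^bsub>?F\<^esub> f = \<zero>\<^bsub>?F\<^esub>" by blast
  qed (auto simp: a_ac)
  fix r f assume r: "r \<in> carrier R" and f: "f \<in> carrier ?F"
  have "{b. r \<otimes> f b \<noteq> \<zero>} \<subseteq> {b. f b \<noteq> \<zero>}" using r by auto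
  then show "r \<odot>\<^bsub>?F\<^esub> f \<in> carrier ?F"
    using r f finite_subset[of "{b. r \<otimes> f b \<noteq> \<zero>}" "{b. f b \<noteq> \<zero>}"] by auto
qed (auto simp: l_distr r_distr m_assoc)

lemma (in cring) free_gen_closed: "b \<in> B \<Longrightarrow> free_gen R b \<in> carrier (free_module R B)"
proof -
  assume "b \<in> B"
  moreover have "{b'. free_gen R b b' \<noteq> \<zero>} \<subseteq> {b}" by (auto simp: free_gen_def)
  ultimately show ?thesis using finite_subset[of "{b'. free_gen R b b' \<noteq> \<zero>}" "{b}"]
    by (auto simp: free_gen_def)
qed

section \<open>Quotients of a module by a submodule\<close>

context Module.module
begin

lemma sub_closed: "LinearCombinations.submodule R N M \<Longrightarrow> x \<in> N \<Longrightarrow> x \<in> carrier M"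
  by (auto simp: LinearCombinations.submodule_def)

lemma sub_uminus:
  assumes N: "LinearCombinations.submodule R N M" and x: "x \<in> N"
  shows "\<ominus>\<^bsub>M\<^esub> x \<in> N"
proof -
  have "(\<ominus> \<one>) \<odot>\<^bsub>M\<^esub> x \<in> N"
    using N x by (auto simp: LinearCombinations.submodule_def)
  then show ?thesis using smult_minus_1 sub_closed[OF N x] by simp
qed

lemma sub_abelian_subgroup:
  assumes N: "LinearCombinations.submodule R N M"
  shows "abelian_subgroup N M"
proof (rule abelian_subgroupI3)
  show "additive_subgroup N M"
    using N sub_uminus[OF N]
    by (auto intro!: additive_subgroup.intro subgroup.intro
        simp: LinearCombinations.submodule_def a_inv_def[symmetric])
qed (rule M.abelian_group_axioms)

context
  fixes N assumes N: "LinearCombinations.submodule R N M"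
begin

lemmas sg = sub_abelian_subgroup[OF N]
lemmas sg_a_subset = additive_subgroup.a_subset[OF abelian_subgroup.axioms(1)[OF sg]]
lemmas sg_a_subgroup = additive_subgroup.a_subgroup[OF abelian_subgroup.axioms(1)[OF sg]]

lemma coset_eqI:
  assumes "x \<in> carrier M" "y \<in> carrier M" "x \<ominus>\<^bsub>M\<^esub> y \<in> N"
  shows "N +>\<^bsub>M\<^esub> x = N +>\<^bsub>M\<^esub> y"
proof -
  have "x = (x \<ominus>\<^bsub>M\<^esub> y) \<oplus>\<^bsub>M\<^esub> y"
    using assms(1,2) by (simp add: M.minus_eq M.add.m_assoc M.l_neg)
  then have "x \<in> N +>\<^bsub>M\<^esub> y" using assms(3) by (auto simp: a_r_coset_def')
  then show ?thesis using M.a_repr_independence[OF _ assms(2) sg_a_subgroup] by simp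
qed

lemma coset_eqD:
  assumes "x \<in> carrier M" "y \<in> carrier M" "N +>\<^bsub>M\<^esub> x = N +>\<^bsub>M\<^esub> y"
  shows "x \<ominus>\<^bsub>M\<^esub> y \<in> N"
proof -
  have "x \<in> N +>\<^bsub>M\<^esub> y" using abelian_subgroup.a_rcos_self[OF sg assms(1)] assms(3) by simp
  then obtain h where h: "h \<in> N" "x = h \<oplus>\<^bsub>M\<^esub> y" by (auto simp: a_r_coset_def')
  moreover have "h \<oplus>\<^bsub>M\<^esub> y \<ominus>\<^bsub>M\<^esub> y = h"
    using h(1) sub_closed[OF N h(1)] assms(2) by (simp add: M.minus_eq M.add.m_assoc M.r_neg)
  ultimately show ?thesis by simp
qed

lemma coset_zero: "N +>\<^bsub>M\<^esub> \<zero>\<^bsub>M\<^esub> = N"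
  using sg_a_subset by (simp add: M.a_coset_add_zero)

lemma coset_eq_zero_iff: "x \<in> carrier M \<Longrightarrow> N +>\<^bsub>M\<^esub> x = N \<longleftrightarrow> x \<in> N"
proof -
  assume x: "x \<in> carrier M"
  have "\<ominus>\<^bsub>M\<^esub> \<zero>\<^bsub>M\<^esub> = \<zero>\<^bsub>M\<^esub>"
    using M.r_neg[OF M.zero_closed] by simp
  then have "x \<ominus>\<^bsub>M\<^esub> \<zero>\<^bsub>M\<^esub> = x" using x by (simp add: M.minus_eq)
  then show ?thesis
    using coset_eqI[OF x M.zero_closed] coset_eqD[OF x M.zero_closed] coset_zero by auto
qed

lemma quot_module_sel:
  "carrier (quot_module M N) = (\<lambda>x. N +>\<^bsub>M\<^esub> x) ` carrier M"
  "zero (quot_module M N) = N"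
  by (auto simp: quot_module_def A_RCOSETS_def')

lemma quot_module_add:
  "x \<in> carrier M \<Longrightarrow> y \<in> carrier M \<Longrightarrow>
    (N +>\<^bsub>M\<^esub> x) \<oplus>\<^bsub>quot_module M N\<^esub> (N +>\<^bsub>M\<^esub> y) = N +>\<^bsub>M\<^esub> (x \<oplus>\<^bsub>M\<^esub> y)"
  by (simp add: quot_module_def abelian_subgroup.a_rcos_sum[OF sg])

text \<open>The action is defined as a union of cosets over all representatives. Two representatives
  differ by an element of \<open>N\<close>, which scalars keep in \<open>N\<close>, so all members
  of the union are the same coset.\<close>

lemma quot_module_smult:
  assumes r: "r \<in> carrier R" and x: "x \<in> carrier M"
  shows "r \<odot>\<^bsub>quot_module M N\<^esub> (N +>\<^bsub>M\<^esub> x) = N +>\<^bsub>M\<^esub> (r \<odot>\<^bsub>M\<^esub> x)"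
proof -
  have "N +>\<^bsub>M\<^esub> (r \<odot>\<^bsub>M\<^esub> y) = N +>\<^bsub>M\<^esub> (r \<odot>\<^bsub>M\<^esub> x)" if y: "y \<in> N +>\<^bsub>M\<^esub> x" for y
  proof -
    obtain h where h: "h \<in> N" "y = h \<oplus>\<^bsub>M\<^esub> x" using y by (auto simp: a_r_coset_def')
    have hc: "h \<in> carrier M" using h sub_closed[OF N] by simp
    have "r \<odot>\<^bsub>M\<^esub> y \<ominus>\<^bsub>M\<^esub> r \<odot>\<^bsub>M\<^esub> x = r \<odot>\<^bsub>M\<^esub> h"
      using r x hc h by (simp add: smult_r_distr M.minus_eq M.add.m_assoc M.r_neg)
    moreover have "r \<odot>\<^bsub>M\<^esub> h \<in> N" using N r h by (auto simp: LinearCombinations.submodule_def)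
    ultimately show ?thesis using r x hc h by (intro coset_eqI) auto
  qed
  moreover have "x \<in> N +>\<^bsub>M\<^esub> x" using x by (rule abelian_subgroup.a_rcos_self[OF sg])
  ultimately have "(\<Union>y\<in>N +>\<^bsub>M\<^esub> x. N +>\<^bsub>M\<^esub> (r \<odot>\<^bsub>M\<^esub> y)) = N +>\<^bsub>M\<^esub> (r \<odot>\<^bsub>M\<^esub> x)"
    by blast
  then show ?thesis by (simp add: quot_module_def)
qed

lemma quot_module_is_module: "Module.module R (quot_module M N)"
proof (rule moduleI)
  let ?Q = "quot_module M N"
  show "cring R" by (rule R.is_cring)
  show "abelian_group ?Q"
  proof (rule abelian_groupI)
    show "\<zero>\<^bsub>?Q\<^esub> \<in> carrier ?Q"
      unfolding quot_module_sel using coset_zero M.zero_closed by (metis image_eqI)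
  next
    fix C assume "C \<in> carrier ?Q"
    then obtain x where x: "x \<in> carrier M" "C = N +>\<^bsub>M\<^esub> x" unfolding quot_module_sel by blast
    have "(N +>\<^bsub>M\<^esub> (\<ominus>\<^bsub>M\<^esub> x)) \<oplus>\<^bsub>?Q\<^esub> C = N +>\<^bsub>M\<^esub> (\<ominus>\<^bsub>M\<^esub> x \<oplus>\<^bsub>M\<^esub> x)"
      unfolding x(2) using x(1) by (intro quot_module_add) simp_all
    also have "\<dots> = \<zero>\<^bsub>?Q\<^esub>" using x(1) by (simp only: M.l_neg coset_zero quot_module_sel)
    finally show "\<exists>y\<in>carrier ?Q. y \<oplus>\<^bsub>?Q\<^esub> C = \<zero>\<^bsub>?Q\<^esub>"
      using x(1) M.a_inv_closed unfolding quot_module_sel(1) by blast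
    show "\<zero>\<^bsub>?Q\<^esub> \<oplus>\<^bsub>?Q\<^esub> C = C"
      using quot_module_add[of "\<zero>\<^bsub>M\<^esub>" x] x by (simp only: quot_module_sel coset_zero M.zero_closed M.l_zero)
    fix D assume "D \<in> carrier ?Q"
    then obtain y where y: "y \<in> carrier M" "D = N +>\<^bsub>M\<^esub> y" unfolding quot_module_sel by blast
    show "C \<oplus>\<^bsub>?Q\<^esub> D \<in> carrier ?Q"
      unfolding x(2) y(2) quot_module_add[OF x(1) y(1)] unfolding quot_module_sel 
      using x(1) y(1) by blast
    show "C \<oplus>\<^bsub>?Q\<^esub> D = D \<oplus>\<^bsub>?Q\<^esub> C"
      unfolding x(2) y(2) quot_module_add[OF x(1) y(1)] quot_module_add[OF y(1) x(1)]
      using x(1) y(1) by (simp only: M.a_comm)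
    fix E assume "E \<in> carrier ?Q"
    then obtain z where z: "z \<in> carrier M" "E = N +>\<^bsub>M\<^esub> z" unfolding quot_module_sel by blast
    show "C \<oplus>\<^bsub>?Q\<^esub> D \<oplus>\<^bsub>?Q\<^esub> E = C \<oplus>\<^bsub>?Q\<^esub> (D \<oplus>\<^bsub>?Q\<^esub> E)"
      unfolding x(2) y(2) z(2)
      using x(1) y(1) z(1) by (simp only: quot_module_add M.add.m_closed M.a_assoc)
  qed
  show "\<one> \<odot>\<^bsub>?Q\<^esub> C = C" if CQ: "C \<in> carrier ?Q" for C
  proof -
    obtain x where x: "x \<in> carrier M" "C = N +>\<^bsub>M\<^esub> x"
      using CQ unfolding quot_module_sel by blast
    show ?thesis
      unfolding x(2) quot_module_smult[OF R.one_closed x(1)] smult_one[OF x(1)] ..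
  qed
  fix a C assume a: "a \<in> carrier R" and "C \<in> carrier ?Q"
  then obtain x where x: "x \<in> carrier M" "C = N +>\<^bsub>M\<^esub> x" unfolding quot_module_sel by blast
  show "a \<odot>\<^bsub>?Q\<^esub> C \<in> carrier ?Q"
    unfolding x(2) quot_module_smult[OF a x(1)] unfolding quot_module_sel 
    using a x(1) smult_closed by blast
  { fix D assume "D \<in> carrier ?Q"
    then obtain y where y: "y \<in> carrier M" "D = N +>\<^bsub>M\<^esub> y" unfolding quot_module_sel by blast
    show "a \<odot>\<^bsub>?Q\<^esub> (C \<oplus>\<^bsub>?Q\<^esub> D) = a \<odot>\<^bsub>?Q\<^esub> C \<oplus>\<^bsub>?Q\<^esub> a \<odot>\<^bsub>?Q\<^esub> D"
      unfolding x(2) y(2) using x(1) y(1) a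
      by (simp only: quot_module_add quot_module_smult M.add.m_closed smult_closed smult_r_distr) }
  fix b assume b: "b \<in> carrier R"
  show "(a \<oplus> b) \<odot>\<^bsub>?Q\<^esub> C = a \<odot>\<^bsub>?Q\<^esub> C \<oplus>\<^bsub>?Q\<^esub> b \<odot>\<^bsub>?Q\<^esub> C"
    unfolding x(2) using x(1) a b
    by (simp only: quot_module_add quot_module_smult R.add.m_closed smult_closed smult_l_distr)
  show "(a \<otimes> b) \<odot>\<^bsub>?Q\<^esub> C = a \<odot>\<^bsub>?Q\<^esub> (b \<odot>\<^bsub>?Q\<^esub> C)"
    unfolding x(2) using x(1) a b
    by (simp only: quot_module_add quot_module_smult R.m_closed smult_closed smult_assoc1)
qed

end

end

section \<open>Functionals on modules given by generators and relations\<close>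

definition free_ext ::
  "('r, 'x) ring_scheme \<Rightarrow> ('r \<Rightarrow> 'k) \<Rightarrow> ('b \<Rightarrow> 'k) \<Rightarrow> ('b \<Rightarrow> 'r) \<Rightarrow> 'k::comm_ring_1" where
  "free_ext R \<psi> w f = (\<Sum>b | f b \<noteq> \<zero>\<^bsub>R\<^esub>. \<psi> (f b) * w b)"

text \<open>Through \<open>\<psi>\<close> the field becomes a module over the ring. With respect to
  this structure \<open>free_ext\<close> is the linear map out of the free module with prescribed
  values \<open>w\<close> on the generators.\<close>

locale ring_to_field = R: cring R for R :: "('r, 'x) ring_scheme" (structure) +
  fixes \<psi> :: "'r \<Rightarrow> 'k::field"
  assumes hom_add: "x \<in> carrier R \<Longrightarrow> y \<in> carrier R \<Longrightarrow> \<psi> (x \<oplus> y) = \<psi> x + \<psi> y"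
    and hom_mult: "x \<in> carrier R \<Longrightarrow> y \<in> carrier R \<Longrightarrow> \<psi> (x \<otimes> y) = \<psi> x * \<psi> y"
    and hom_one: "\<psi> \<one> = 1"
begin

lemma hom_zero: "\<psi> \<zero> = 0"
proof -
  have "\<psi> \<zero> = \<psi> \<zero> + \<psi> \<zero>"
    using hom_add[OF R.zero_closed R.zero_closed] by (simp only: R.l_zero R.zero_closed)
  then show ?thesis by (metis add_cancel_right_right)
qed

context
  fixes B :: "'b set" and w :: "'b \<Rightarrow> 'k"
begin

abbreviation "F \<equiv> free_module R B"
abbreviation "ext \<equiv> free_ext R \<psi> w"

text \<open>The supports of two elements and of their sum differ, so comparing the three sums
  requires a common index set.\<close>

lemma free_ext_superset:
  assumes "f \<in> carrier F" "finite A" "{b. f b \<noteq> \<zero>} \<subseteq> A"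
  shows "ext f = (\<Sum>b\<in>A. \<psi> (f b) * w b)"
  unfolding free_ext_def using assms by (intro sum.mono_neutral_left) (auto simp: hom_zero)

lemma free_ext_add:
  assumes f: "f \<in> carrier F" and g: "g \<in> carrier F"
  shows "ext (f \<oplus>\<^bsub>F\<^esub> g) = ext f + ext g"
proof -
  let ?A = "{b. f b \<noteq> \<zero>} \<union> {b. g b \<noteq> \<zero>}"
  interpret F: Module.module R F by (rule R.free_module_is_module)
  have fin: "finite ?A" using f g by simp
  have "ext (f \<oplus>\<^bsub>F\<^esub> g) = (\<Sum>b\<in>?A. \<psi> ((f \<oplus>\<^bsub>F\<^esub> g) b) * w b)"
    using fin F.add.m_closed[OF f g] by (intro free_ext_superset) auto
  also have "\<dots> = (\<Sum>b\<in>?A. \<psi> (f b) * w b) + (\<Sum>b\<in>?A. \<psi> (g b) * w b)"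
    using f g by (simp add: hom_add distrib_right sum.distrib)
  also have "\<dots> = ext f + ext g"
    using free_ext_superset[OF f fin] free_ext_superset[OF g fin] by simp
  finally show ?thesis .
qed

lemma free_ext_smult:
  assumes r: "r \<in> carrier R" and f: "f \<in> carrier F"
  shows "ext (r \<odot>\<^bsub>F\<^esub> f) = \<psi> r * ext f"
proof -
  let ?A = "{b. f b \<noteq> \<zero>}"
  interpret F: Module.module R F by (rule R.free_module_is_module)
  have fin: "finite ?A" using f by simp
  have "ext (r \<odot>\<^bsub>F\<^esub> f) = (\<Sum>b\<in>?A. \<psi> ((r \<odot>\<^bsub>F\<^esub> f) b) * w b)"
    using fin r F.smult_closed[OF r f] by (intro free_ext_superset) auto
  also have "\<dots> = \<psi> r * ext f"
    using f r by (simp add: hom_mult free_ext_def sum_distrib_left mult.assoc)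
  finally show ?thesis .
qed

lemma free_ext_gen: 
  assumes "b \<in> B" shows "ext (free_gen R b) = w b"
proof -
  have "{b'. free_gen R b b' \<noteq> \<zero>} \<subseteq> {b}" by (auto simp: free_gen_def)
  then have "ext (free_gen R b) = (\<Sum>b'\<in>{b}. \<psi> (free_gen R b b') * w b')"
    by (intro free_ext_superset R.free_gen_closed assms) simp_all
  then show ?thesis by (simp add: free_gen_def hom_one)
qed

lemma free_ext_diff:
  assumes f: "f \<in> carrier F" and g: "g \<in> carrier F"
  shows "ext (f \<ominus>\<^bsub>F\<^esub> g) = ext f - ext g"
proof -
  interpret F: Module.module R F by (rule R.free_module_is_module)
  have "f \<ominus>\<^bsub>F\<^esub> g \<oplus>\<^bsub>F\<^esub> g = f" 
    unfolding F.M.minus_eq using f g F.M.a_assoc F.M.l_neg F.M.r_zero F.M.a_inv_closed by metis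
  then show ?thesis using free_ext_add[OF F.M.minus_closed[OF f g] g]
    by (metis add_diff_cancel_right')
qed

text \<open>Universal property of a presentation: the kernel of \<open>ext\<close> is a submodule
  containing the relations \<open>S\<close>, hence contains their span, and \<open>ext\<close> is
  constant on cosets.\<close>

lemma quot_free_functional:
  assumes S: "S \<subseteq> carrier F" and ker: "\<forall>f\<in>S. ext f = 0"
  defines "N \<equiv> LinearCombinations.module.span R F S"
  shows "\<exists>L. (\<forall>x\<in>carrier (quot_module F N). \<forall>y\<in>carrier (quot_module F N).
            L (x \<oplus>\<^bsub>quot_module F N\<^esub> y) = L x + L y) \<and>
          (\<forall>r\<in>carrier R. \<forall>x\<in>carrier (quot_module F N).
            L (r \<odot>\<^bsub>quot_module F N\<^esub> x) = \<psi> r * L x) \<and>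
          (\<forall>b\<in>B. L (N +>\<^bsub>F\<^esub> free_gen R b) = w b)"
proof -
  interpret F: Module.module R F by (rule R.free_module_is_module)
  have N: "LinearCombinations.submodule R N F"
    unfolding N_def using S by (rule F.span_is_submodule)
  have "ext \<zero>\<^bsub>F\<^esub> = 0" by (simp add: free_ext_def)
  then have "LinearCombinations.submodule R {f \<in> carrier F. ext f = 0} F"
    using F.module_axioms free_ext_add free_ext_smult F.M.add.m_closed F.smult_closed F.M.zero_closed
    unfolding LinearCombinations.submodule_def by auto
  then have N0: "N \<subseteq> {f \<in> carrier F. ext f = 0}"
    unfolding N_def using S ker by (intro F.span_is_subset) auto
  \<comment> \<open>The value is taken at an arbitrary representative of the coset;
    \<open>N0\<close> makes the choice irrelevant.\<close>
  define L where "L C = ext (SOME f. f \<in> carrier F \<and> C = N +>\<^bsub>F\<^esub> f)" for C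
  have L: "L (N +>\<^bsub>F\<^esub> f) = ext f" if f: "f \<in> carrier F" for f
  proof -
    define g where "g = (SOME g. g \<in> carrier F \<and> N +>\<^bsub>F\<^esub> f = N +>\<^bsub>F\<^esub> g)"
    have g: "g \<in> carrier F \<and> N +>\<^bsub>F\<^esub> f = N +>\<^bsub>F\<^esub> g"
      unfolding g_def by (rule someI[of _ f]) (use f in blast)
    then have "f \<ominus>\<^bsub>F\<^esub> g \<in> N" using F.coset_eqD[OF N f] by blast
    then have "ext f = ext g" using N0 free_ext_diff[OF f, of g] g by auto
    then show ?thesis unfolding L_def g_def by simp
  qed
  show ?thesis
  proof (intro exI[of _ L] conjI ballI)
    fix x y assume "x \<in> carrier (quot_module F N)" "y \<in> carrier (quot_module F N)"
    then obtain f g where fg: "f \<in> carrier F" "x = N +>\<^bsub>F\<^esub> f" "g \<in> carrier F" "y = N +>\<^bsub>F\<^esub> g"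
      unfolding F.quot_module_sel[OF N] by blast
    then show "L (x \<oplus>\<^bsub>quot_module F N\<^esub> y) = L x + L y"
      using F.quot_module_add[OF N, of f g] L F.M.add.m_closed free_ext_add by metis
  next
    fix r x assume r: "r \<in> carrier R" and "x \<in> carrier (quot_module F N)"
    then obtain f where "f \<in> carrier F" "x = N +>\<^bsub>F\<^esub> f"
      unfolding F.quot_module_sel[OF N] by blast
    then show "L (r \<odot>\<^bsub>quot_module F N\<^esub> x) = \<psi> r * L x"
      using F.quot_module_smult[OF N r, of f] L F.smult_closed free_ext_smult r by metis
  next
    fix b assume "b \<in> B"
    then show "L (N +>\<^bsub>F\<^esub> free_gen R b) = w b"
      using L[OF R.free_gen_closed] free_ext_gen by simp
  qed
qed

end

end

section \<open>Kaehler differentials\<close>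

locale kaehler = R: cring R for R :: "('r, 'x) ring_scheme" (structure) +
  fixes A :: "('k, 'y) ring_scheme" and \<phi> :: "'k \<Rightarrow> 'r"
  assumes \<phi>_closed: "a \<in> carrier A \<Longrightarrow> \<phi> a \<in> carrier R"
begin

abbreviation "FR \<equiv> free_module R (carrier R)"
abbreviation "D \<equiv> free_gen R"
abbreviation "N \<equiv> kaehler_submodule A \<phi> R"
abbreviation "K \<equiv> kaehler_module A \<phi> R"
abbreviation "d \<equiv> kaehler_d A \<phi> R"

sublocale F: Module.module R FR by (rule R.free_module_is_module)

lemma D_closed: "x \<in> carrier R \<Longrightarrow> D x \<in> carrier FR"
  by (rule R.free_gen_closed)

lemma kaehler_rels_subset: "kaehler_rels A \<phi> R \<subseteq> carrier FR"
  unfolding kaehler_rels_def Let_def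
  using D_closed F.M.minus_closed F.M.add.m_closed F.smult_closed \<phi>_closed R.m_closed R.a_closed
  by (fastforce simp del: free_module_sel)

lemma kaehler_submodule: "LinearCombinations.submodule R N FR"
  unfolding kaehler_submodule_def using kaehler_rels_subset by (rule F.span_is_submodule)

lemma rels_in: "f \<in> kaehler_rels A \<phi> R \<Longrightarrow> f \<in> N"
  unfolding kaehler_submodule_def using F.in_own_span[OF kaehler_rels_subset] by blast

lemma module_K: "Module.module R K"
  unfolding kaehler_module_def by (rule F.quot_module_is_module[OF kaehler_submodule])

lemma d_closed: "x \<in> carrier R \<Longrightarrow> d x \<in> carrier K"
  unfolding kaehler_module_def kaehler_d_def F.quot_module_sel[OF kaehler_submodule]
  using D_closed by blast

lemma d_add:
  assumes x: "x \<in> carrier R" and y: "y \<in> carrier R"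
  shows "d (x \<oplus> y) = d x \<oplus>\<^bsub>K\<^esub> d y"
proof -
  have "D (x \<oplus> y) \<ominus>\<^bsub>FR\<^esub> (D x \<oplus>\<^bsub>FR\<^esub> D y) \<in> N"
    by (rule rels_in) (unfold kaehler_rels_def Let_def, use x y in blast)
  then have "N +>\<^bsub>FR\<^esub> D (x \<oplus> y) = N +>\<^bsub>FR\<^esub> (D x \<oplus>\<^bsub>FR\<^esub> D y)"
    using x y D_closed F.M.add.m_closed R.a_closed by (intro F.coset_eqI[OF kaehler_submodule]) blast+
  then show ?thesis
    unfolding kaehler_module_def kaehler_d_def
    using F.quot_module_add[OF kaehler_submodule D_closed[OF x] D_closed[OF y]] by simp
qed

lemma d_mult:
  assumes x: "x \<in> carrier R" and y: "y \<in> carrier R"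
  shows "d (x \<otimes> y) = x \<odot>\<^bsub>K\<^esub> d y \<oplus>\<^bsub>K\<^esub> y \<odot>\<^bsub>K\<^esub> d x"
proof -
  have "D (x \<otimes> y) \<ominus>\<^bsub>FR\<^esub> (x \<odot>\<^bsub>FR\<^esub> D y \<oplus>\<^bsub>FR\<^esub> y \<odot>\<^bsub>FR\<^esub> D x) \<in> N"
    by (rule rels_in) (unfold kaehler_rels_def Let_def, use x y in blast)
  then have "N +>\<^bsub>FR\<^esub> D (x \<otimes> y) = N +>\<^bsub>FR\<^esub> (x \<odot>\<^bsub>FR\<^esub> D y \<oplus>\<^bsub>FR\<^esub> y \<odot>\<^bsub>FR\<^esub> D x)"
    using x y D_closed F.M.add.m_closed F.smult_closed R.m_closed
    by (intro F.coset_eqI[OF kaehler_submodule]) blast+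
  then show ?thesis
    unfolding kaehler_module_def kaehler_d_def
    using F.quot_module_add[OF kaehler_submodule F.smult_closed[OF x D_closed[OF y]]
          F.smult_closed[OF y D_closed[OF x]]]
      F.quot_module_smult[OF kaehler_submodule x D_closed[OF y]]
      F.quot_module_smult[OF kaehler_submodule y D_closed[OF x]] by simp
qed

lemma d_const:
  assumes "a \<in> carrier A" shows "d (\<phi> a) = \<zero>\<^bsub>K\<^esub>"
proof -
  have "D (\<phi> a) \<in> N"
    by (rule rels_in) (unfold kaehler_rels_def Let_def, use assms in blast)
  then show ?thesis
    unfolding kaehler_module_def kaehler_d_def F.quot_module_sel[OF kaehler_submodule]
    using F.coset_eq_zero_iff[OF kaehler_submodule D_closed[OF \<phi>_closed[OF assms]]] by simp
qed

text \<open>Universal property of the differentials, with the field as target module: a derivation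
  over \<open>\<psi>\<close> that is zero on constants satisfies each of the three kinds of
  relations and so factors through \<open>d\<close>.\<close>

lemma functional:
  fixes \<psi> :: "'r \<Rightarrow> 'l::field"
  assumes "ring_to_field R \<psi>"
    and add: "\<And>x y. x \<in> carrier R \<Longrightarrow> y \<in> carrier R \<Longrightarrow> \<delta> (x \<oplus> y) = \<delta> x + \<delta> y"
    and mult: "\<And>x y. x \<in> carrier R \<Longrightarrow> y \<in> carrier R \<Longrightarrow> \<delta> (x \<otimes> y) = \<psi> x * \<delta> y + \<psi> y * \<delta> x"
    and const: "\<And>a. a \<in> carrier A \<Longrightarrow> \<delta> (\<phi> a) = 0"
  obtains L where
    "\<And>x y. x \<in> carrier K \<Longrightarrow> y \<in> carrier K \<Longrightarrow> L (x \<oplus>\<^bsub>K\<^esub> y) = L x + L y"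
    "\<And>r x. r \<in> carrier R \<Longrightarrow> x \<in> carrier K \<Longrightarrow> L (r \<odot>\<^bsub>K\<^esub> x) = \<psi> r * L x"
    "\<And>x. x \<in> carrier R \<Longrightarrow> L (d x) = \<delta> x"
proof -
  interpret ring_to_field R \<psi> by fact
  let ?e = "free_ext R \<psi> \<delta>"
  have *: "\<forall>f\<in>kaehler_rels A \<phi> R. ?e f = 0"
  proof
    fix f assume f: "f \<in> kaehler_rels A \<phi> R"
    consider x y where "x \<in> carrier R" "y \<in> carrier R" "f = D (x \<oplus> y) \<ominus>\<^bsub>FR\<^esub> (D x \<oplus>\<^bsub>FR\<^esub> D y)"
      | x y where "x \<in> carrier R" "y \<in> carrier R"
          "f = D (x \<otimes> y) \<ominus>\<^bsub>FR\<^esub> (x \<odot>\<^bsub>FR\<^esub> D y \<oplus>\<^bsub>FR\<^esub> y \<odot>\<^bsub>FR\<^esub> D x)"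
      | a where "a \<in> carrier A" "f = D (\<phi> a)"
      using f unfolding kaehler_rels_def Let_def
      by (elim UnE CollectE exE conjE)
        ((rule that(1)[rotated -1] | rule that(2)[rotated -1] | rule that(3)[rotated -1]), assumption+)+
    then show "?e f = 0"
    proof cases
      case 1
      note c = D_closed[OF 1(1)] D_closed[OF 1(2)]
      show ?thesis unfolding 1(3)
        free_ext_diff[OF D_closed[OF R.a_closed[OF 1(1,2)]] F.M.add.m_closed[OF c]]
        free_ext_add[OF c] using 1 by (simp add: free_ext_gen[where B="carrier R"] add)
    next
      case 2
      note c = D_closed[OF 2(1)] D_closed[OF 2(2)]
      note c' = F.smult_closed[OF 2(1) c(2)] F.smult_closed[OF 2(2) c(1)]
      show ?thesis unfolding 2(3)
        free_ext_diff[OF D_closed[OF R.m_closed[OF 2(1,2)]] F.M.add.m_closed[OF c']]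
        free_ext_add[OF c'] free_ext_smult[OF 2(1) c(2)] free_ext_smult[OF 2(2) c(1)]
        using 2 by (simp add: free_ext_gen[where B="carrier R"] mult)
    next
      case 3
      then show ?thesis using free_ext_gen[OF \<phi>_closed] const by simp
    qed
  qed
  from quot_free_functional[OF kaehler_rels_subset *, folded kaehler_submodule_def, folded kaehler_module_def kaehler_d_def]
  obtain L where L:
    "\<forall>x\<in>carrier K. \<forall>y\<in>carrier K. L (x \<oplus>\<^bsub>K\<^esub> y) = L x + L y"
    "\<forall>r\<in>carrier R. \<forall>x\<in>carrier K. L (r \<odot>\<^bsub>K\<^esub> x) = \<psi> r * L x"
    "\<forall>x\<in>carrier R. L (d x) = \<delta> x"
    by (elim exE conjE)
  show ?thesis
  proof (rule that[of L])
    show "L (x \<oplus>\<^bsub>K\<^esub> y) = L x + L y" if "x \<in> carrier K" "y \<in> carrier K" for x y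
      using L(1) that by blast
    show "L (r \<odot>\<^bsub>K\<^esub> x) = \<psi> r * L x" if "r \<in> carrier R" "x \<in> carrier K" for r x
      using L(2) that by blast
    show "L (d x) = \<delta> x" if "x \<in> carrier R" for x
      using L(3) that by blast
  qed
qed

end

section \<open>Exterior powers\<close>

lemma tuples_update: "xs \<in> tuples M k \<Longrightarrow> x \<in> carrier M \<Longrightarrow> xs[i := x] \<in> tuples M k"
  unfolding tuples_def using set_update_subset_insert[of xs i x] by auto

lemma tuples_nth: "xs \<in> tuples M k \<Longrightarrow> i < k \<Longrightarrow> xs ! i \<in> carrier M"
  unfolding tuples_def by auto

locale exterior = M: Module.module R M
  for R :: "('r, 'x) ring_scheme" (structure) and M :: "('r, 'a, 'y) module_scheme" +
  fixes k :: nat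
begin

abbreviation "FT \<equiv> free_module R (tuples M k)"
abbreviation "G \<equiv> free_gen R"
abbreviation "E \<equiv> ext_power R M k"
abbreviation "w \<equiv> wedge R M"

sublocale F: Module.module R FT by (rule M.R.free_module_is_module)

lemma G_closed: "xs \<in> tuples M k \<Longrightarrow> G xs \<in> carrier FT"
  by (rule M.R.free_gen_closed)

lemma ext_rels_subset: "ext_rels R M k \<subseteq> carrier FT"
proof
  fix f assume "f \<in> ext_rels R M k"
  then consider xs i x y where "xs \<in> tuples M k" "i < k" "x \<in> carrier M" "y \<in> carrier M"
      "f = G (xs[i := x \<oplus>\<^bsub>M\<^esub> y]) \<ominus>\<^bsub>FT\<^esub> (G (xs[i := x]) \<oplus>\<^bsub>FT\<^esub> G (xs[i := y]))"
    | xs i r x where "xs \<in> tuples M k" "i < k" "r \<in> carrier R" "x \<in> carrier M"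
      "f = G (xs[i := r \<odot>\<^bsub>M\<^esub> x]) \<ominus>\<^bsub>FT\<^esub> (r \<odot>\<^bsub>FT\<^esub> G (xs[i := x]))"
    | xs where "xs \<in> tuples M k" "f = G xs"
    unfolding ext_rels_def Let_def by blast
  then show "f \<in> carrier FT"
  proof cases
    case 1
    show ?thesis unfolding 1(5)
      by (intro F.M.minus_closed F.M.add.m_closed G_closed tuples_update 1(1,3,4) M.M.add.m_closed)
  next
    case 2
    show ?thesis unfolding 2(5)
      by (intro F.M.minus_closed F.smult_closed G_closed tuples_update 2(1,3,4) M.smult_closed)
  next
    case 3
    then show ?thesis using G_closed by simp
  qed
qed

lemma ext_submodule: "LinearCombinations.submodule R (ext_submodule R M k) FT"
  unfolding ext_submodule_def using ext_rels_subset by (rule F.span_is_submodule)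

lemma rels_in: "f \<in> ext_rels R M k \<Longrightarrow> f \<in> ext_submodule R M k"
  unfolding ext_submodule_def using F.in_own_span[OF ext_rels_subset] by blast

lemma module_E: "Module.module R E"
  unfolding ext_power_def by (rule F.quot_module_is_module[OF ext_submodule])

lemma wedge_eq: "xs \<in> tuples M k \<Longrightarrow> w xs = ext_submodule R M k +>\<^bsub>FT\<^esub> G xs"
  by (simp add: wedge_def tuples_def)

lemma wedge_closed: "xs \<in> tuples M k \<Longrightarrow> w xs \<in> carrier E"
  unfolding ext_power_def wedge_eq F.quot_module_sel[OF ext_submodule]
  using G_closed by blast

lemma wedge_add:
  assumes xs: "xs \<in> tuples M k" and i: "i < k" and x: "x \<in> carrier M" and y: "y \<in> carrier M"
  shows "w (xs[i := x \<oplus>\<^bsub>M\<^esub> y]) = w (xs[i := x]) \<oplus>\<^bsub>E\<^esub> w (xs[i := y])"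
proof -
  note t = tuples_update[OF xs x] tuples_update[OF xs y]
    tuples_update[OF xs M.M.add.m_closed[OF x y]]
  have "G (xs[i := x \<oplus>\<^bsub>M\<^esub> y]) \<ominus>\<^bsub>FT\<^esub> (G (xs[i := x]) \<oplus>\<^bsub>FT\<^esub> G (xs[i := y])) \<in> ext_submodule R M k"
    by (rule rels_in) (unfold ext_rels_def Let_def, use assms in blast)
  from F.coset_eqI[OF ext_submodule G_closed[OF t(3)]
      F.M.add.m_closed[OF G_closed[OF t(1)] G_closed[OF t(2)]] this]
  show ?thesis
    unfolding wedge_eq[OF t(1)] wedge_eq[OF t(2)] wedge_eq[OF t(3)] ext_power_def
    using F.quot_module_add[OF ext_submodule G_closed[OF t(1)] G_closed[OF t(2)]] by simp
qed

lemma wedge_smult: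
  assumes xs: "xs \<in> tuples M k" and i: "i < k" and r: "r \<in> carrier R" and x: "x \<in> carrier M"
  shows "w (xs[i := r \<odot>\<^bsub>M\<^esub> x]) = r \<odot>\<^bsub>E\<^esub> w (xs[i := x])"
proof -
  note t = tuples_update[OF xs x] tuples_update[OF xs M.smult_closed[OF r x]]
  have "G (xs[i := r \<odot>\<^bsub>M\<^esub> x]) \<ominus>\<^bsub>FT\<^esub> (r \<odot>\<^bsub>FT\<^esub> G (xs[i := x])) \<in> ext_submodule R M k"
    by (rule rels_in) (unfold ext_rels_def Let_def, use assms in blast)
  from F.coset_eqI[OF ext_submodule G_closed[OF t(2)]
      F.smult_closed[OF r G_closed[OF t(1)]] this]
  show ?thesis
    unfolding wedge_eq[OF t(1)] wedge_eq[OF t(2)] ext_power_def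
    using F.quot_module_smult[OF ext_submodule r G_closed[OF t(1)]] by simp
qed

lemma wedge_alternating:
  assumes xs: "xs \<in> tuples M k" and ij: "i < j" "j < k" "xs ! i = xs ! j"
  shows "w xs = \<zero>\<^bsub>E\<^esub>"
proof -
  have "G xs \<in> ext_submodule R M k"
    by (rule rels_in) (unfold ext_rels_def Let_def, use assms in blast)
  then show ?thesis
    unfolding wedge_eq[OF xs] ext_power_def F.quot_module_sel[OF ext_submodule]
    using F.coset_eq_zero_iff[OF ext_submodule G_closed[OF xs]] by simp
qed

text \<open>Universal property of the exterior power, with the field as target module: the three
  hypotheses on \<open>\<delta>\<close>, namely additivity and homogeneity in each slot and
  vanishing on repetitions, match the three kinds of relations.\<close>

lemma functional:
  fixes \<psi> :: "'r \<Rightarrow> 'l::field"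
  assumes "ring_to_field R \<psi>"
    and add: "\<And>xs i x y. xs \<in> tuples M k \<Longrightarrow> i < k \<Longrightarrow> x \<in> carrier M \<Longrightarrow> y \<in> carrier M \<Longrightarrow>
      \<delta> (xs[i := x \<oplus>\<^bsub>M\<^esub> y]) = \<delta> (xs[i := x]) + \<delta> (xs[i := y])"
    and smult: "\<And>xs i r x. xs \<in> tuples M k \<Longrightarrow> i < k \<Longrightarrow> r \<in> carrier R \<Longrightarrow> x \<in> carrier M \<Longrightarrow>
      \<delta> (xs[i := r \<odot>\<^bsub>M\<^esub> x]) = \<psi> r * \<delta> (xs[i := x])"
    and alt: "\<And>xs i j. xs \<in> tuples M k \<Longrightarrow> i < j \<Longrightarrow> j < k \<Longrightarrow> xs ! i = xs ! j \<Longrightarrow> \<delta> xs = 0"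
  obtains L where
    "\<And>x y. x \<in> carrier E \<Longrightarrow> y \<in> carrier E \<Longrightarrow> L (x \<oplus>\<^bsub>E\<^esub> y) = L x + L y"
    "\<And>r x. r \<in> carrier R \<Longrightarrow> x \<in> carrier E \<Longrightarrow> L (r \<odot>\<^bsub>E\<^esub> x) = \<psi> r * L x"
    "\<And>xs. xs \<in> tuples M k \<Longrightarrow> L (w xs) = \<delta> xs"
proof -
  interpret ring_to_field R \<psi> by fact
  let ?e = "free_ext R \<psi> \<delta>"
  have *: "\<forall>f\<in>ext_rels R M k. ?e f = 0"
  proof
    fix f assume f: "f \<in> ext_rels R M k"
    consider xs i x y where "xs \<in> tuples M k" "i < k" "x \<in> carrier M" "y \<in> carrier M"
        "f = G (xs[i := x \<oplus>\<^bsub>M\<^esub> y]) \<ominus>\<^bsub>FT\<^esub> (G (xs[i := x]) \<oplus>\<^bsub>FT\<^esub> G (xs[i := y]))"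
      | xs i r x where "xs \<in> tuples M k" "i < k" "r \<in> carrier R" "x \<in> carrier M"
        "f = G (xs[i := r \<odot>\<^bsub>M\<^esub> x]) \<ominus>\<^bsub>FT\<^esub> (r \<odot>\<^bsub>FT\<^esub> G (xs[i := x]))"
      | xs i j where "xs \<in> tuples M k" "i < j" "j < k" "xs ! i = xs ! j" "f = G xs"
      using f unfolding ext_rels_def Let_def
      by (elim UnE CollectE exE conjE)
        ((rule that(1)[rotated -1] | rule that(2)[rotated -1] | rule that(3)[rotated -1]), assumption+)+
    then show "?e f = 0"
    proof cases
      case 1
      note t = tuples_update[OF 1(1,3), of i] tuples_update[OF 1(1,4), of i]
        tuples_update[OF 1(1) M.M.add.m_closed[OF 1(3,4)], of i]
      note c = G_closed[OF t(1)] G_closed[OF t(2)]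
      show ?thesis unfolding 1(5)
        free_ext_diff[OF G_closed[OF t(3)] F.M.add.m_closed[OF c]] free_ext_add[OF c]
        using add[OF 1(1-4)] t by (simp add: free_ext_gen[where B="tuples M k"])
    next
      case 2
      note t = tuples_update[OF 2(1,4), of i]
        tuples_update[OF 2(1) M.smult_closed[OF 2(3,4)], of i]
      note c = G_closed[OF t(1)] G_closed[OF t(2)]
      show ?thesis unfolding 2(5)
        free_ext_diff[OF c(2) F.smult_closed[OF 2(3) c(1)]] free_ext_smult[OF 2(3) c(1)]
        using smult[OF 2(1-4)] t by (simp add: free_ext_gen[where B="tuples M k"])
    next
      case 3
      then show ?thesis using free_ext_gen[OF 3(1), of \<delta>] alt by simp
    qed
  qed
  from quot_free_functional[OF ext_rels_subset *, folded ext_submodule_def, folded ext_power_def]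
  obtain L where L:
    "\<forall>x\<in>carrier E. \<forall>y\<in>carrier E. L (x \<oplus>\<^bsub>E\<^esub> y) = L x + L y"
    "\<forall>r\<in>carrier R. \<forall>x\<in>carrier E. L (r \<odot>\<^bsub>E\<^esub> x) = \<psi> r * L x"
    "\<forall>xs\<in>tuples M k. L (ext_submodule R M k +>\<^bsub>FT\<^esub> G xs) = \<delta> xs"
    by (elim exE conjE)
  show ?thesis
  proof (rule that[of L])
    show "L (x \<oplus>\<^bsub>E\<^esub> y) = L x + L y" if "x \<in> carrier E" "y \<in> carrier E" for x y
      using L(1) that by blast
    show "L (r \<odot>\<^bsub>E\<^esub> x) = \<psi> r * L x" if "r \<in> carrier R" "x \<in> carrier E" for r x
      using L(2) that by blast
    show "L (w xs) = \<delta> xs" if "xs \<in> tuples M k" for xs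
      using L(3) that unfolding wedge_eq[OF that] by blast
  qed
qed

end

section \<open>Evaluation, gradients and homogeneity of polynomials\<close>

lemma poly_mapping_sum_single:
  fixes f :: "'a \<Rightarrow>\<^sub>0 'b::comm_monoid_add"
  shows "f = (\<Sum>t\<in>Poly_Mapping.keys f. Poly_Mapping.single t (Poly_Mapping.lookup f t))"
proof (rule poly_mapping_eqI)
  fix k
  show "Poly_Mapping.lookup f k =
    Poly_Mapping.lookup (\<Sum>t\<in>Poly_Mapping.keys f. Poly_Mapping.single t (Poly_Mapping.lookup f t)) k"
    by (simp add: lookup_sum lookup_single when_def not_in_keys_iff_lookup_eq_zero)
qed

text \<open>The values lie in an arbitrary commutative ring because monomials are evaluated at
  points over the field and also at points whose coordinates are univariate polynomials.\<close>

definition monomial_val :: "(nat \<Rightarrow> 'a::comm_ring_1) \<Rightarrow> (nat \<Rightarrow>\<^sub>0 nat) \<Rightarrow> 'a" where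
  "monomial_val \<sigma> t = (\<Prod>i\<in>Poly_Mapping.keys t. \<sigma> i ^ Poly_Mapping.lookup t i)"

lemma monomial_val_superset:
  "finite A \<Longrightarrow> Poly_Mapping.keys t \<subseteq> A \<Longrightarrow>
    monomial_val \<sigma> t = (\<Prod>i\<in>A. \<sigma> i ^ Poly_Mapping.lookup t i)"
  unfolding monomial_val_def
  by (intro prod.mono_neutral_left) (auto simp: in_keys_iff)

lemma monomial_val_add: "monomial_val \<sigma> (s + t) = monomial_val \<sigma> s * monomial_val \<sigma> t"
proof -
  let ?A = "Poly_Mapping.keys s \<union> Poly_Mapping.keys t"
  have "monomial_val \<sigma> (s + t) = (\<Prod>i\<in>?A. \<sigma> i ^ Poly_Mapping.lookup (s + t) i)"
    using keys_add[of s t] by (intro monomial_val_superset) auto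
  also have "\<dots> = (\<Prod>i\<in>?A. \<sigma> i ^ Poly_Mapping.lookup s i) * (\<Prod>i\<in>?A. \<sigma> i ^ Poly_Mapping.lookup t i)"
    by (simp add: lookup_add power_add prod.distrib)
  also have "\<dots> = monomial_val \<sigma> s * monomial_val \<sigma> t"
    by (simp add: monomial_val_superset[symmetric])
  finally show ?thesis .
qed

text \<open>Substitution of \<open>\<sigma>\<close> for the variables, with coefficients mapped by
  \<open>h\<close>. One proof of additivity and multiplicativity serves both evaluation at a point
  and restriction to a line.\<close>

locale poly_hom =
  fixes h :: "'k::field \<Rightarrow> 'a::comm_ring_1" and \<sigma> :: "nat \<Rightarrow> 'a"
  assumes h_add: "h (a + b) = h a + h b" and h_mult: "h (a * b) = h a * h b"
    and h_0: "h 0 = 0" and h_1: "h 1 = 1"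
begin

definition eval :: "'k mpoly \<Rightarrow> 'a" where
  "eval f = (\<Sum>t\<in>Poly_Mapping.keys f. h (Poly_Mapping.lookup f t) * monomial_val \<sigma> t)"

lemma eval_superset:
  "finite A \<Longrightarrow> Poly_Mapping.keys f \<subseteq> A \<Longrightarrow>
    eval f = (\<Sum>t\<in>A. h (Poly_Mapping.lookup f t) * monomial_val \<sigma> t)"
  unfolding eval_def
  by (intro sum.mono_neutral_left) (auto simp: in_keys_iff h_0)

lemma eval_add: "eval (f + g) = eval f + eval g"
proof -
  let ?A = "Poly_Mapping.keys f \<union> Poly_Mapping.keys g"
  have "eval (f + g) = (\<Sum>t\<in>?A. h (Poly_Mapping.lookup (f + g) t) * monomial_val \<sigma> t)"
    using keys_add[of f g] by (intro eval_superset) auto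
  also have "\<dots> = eval f + eval g"
    by (simp add: lookup_add h_add distrib_right sum.distrib eval_superset[symmetric])
  finally show ?thesis .
qed

lemma eval_single: "eval (Poly_Mapping.single t c) = h c * monomial_val \<sigma> t"
  by (subst eval_superset[of "{t}"]) auto

lemma eval_zero: "eval 0 = 0"
  by (simp add: eval_def)

lemma eval_sum: "eval (sum f A) = (\<Sum>x\<in>A. eval (f x))"
  by (induction A rule: infinite_finite_induct) (auto simp: eval_zero eval_add)

lemma eval_mult: "eval (f * g) = eval f * eval g"
proof -
  let ?m = "\<lambda>f t. Poly_Mapping.single t (Poly_Mapping.lookup f t)"
  have "f * g = (\<Sum>s\<in>Poly_Mapping.keys f. ?m f s) * (\<Sum>t\<in>Poly_Mapping.keys g. ?m g t)"
    using poly_mapping_sum_single[of f] poly_mapping_sum_single[of g] by simp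
  also have "\<dots> = (\<Sum>s\<in>Poly_Mapping.keys f. \<Sum>t\<in>Poly_Mapping.keys g. ?m f s * ?m g t)"
    by (simp add: sum_product)
  finally have "eval (f * g) =
      (\<Sum>s\<in>Poly_Mapping.keys f. \<Sum>t\<in>Poly_Mapping.keys g.
        (h (Poly_Mapping.lookup f s) * monomial_val \<sigma> s) * (h (Poly_Mapping.lookup g t) * monomial_val \<sigma> t))"
    by (simp add: eval_sum mult_single eval_single h_mult monomial_val_add mult_ac)
  then show ?thesis by (simp add: eval_def sum_product)
qed

lemma eval_one: "eval 1 = 1"
  using eval_single[of 0 1] by (simp add: h_1 monomial_val_def)

end

interpretation point: poly_hom "\<lambda>c. c" v for v :: "nat \<Rightarrow> 'k::field"
  by standard auto

lemma point_eval: "point.eval v f = mpoly_eval v f"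
  by (simp add: point.eval_def mpoly_eval_def monomial_val_def)

lemmas mpoly_eval_add = point.eval_add[unfolded point_eval]
  and mpoly_eval_mult = point.eval_mult[unfolded point_eval]
  and mpoly_eval_zero = point.eval_zero[unfolded point_eval]
  and mpoly_eval_one = point.eval_one[unfolded point_eval]
  and mpoly_eval_sum = point.eval_sum[unfolded point_eval]

lemma mpoly_eval_const: "mpoly_eval v (const c) = c"
  using point.eval_single[of v 0 c] by (simp add: point_eval const_def monomial_val_def)

lemma mpoly_eval_indet: "mpoly_eval v (indet i) = v i"
  using point.eval_single[of v "Poly_Mapping.single i 1" 1]
  by (simp add: point_eval indet_def monomial_val_def)

lemma mpoly_eval_uminus: "mpoly_eval v (- f) = - mpoly_eval v f"
  using mpoly_eval_add[of v f "- f"] by (simp add: mpoly_eval_zero eq_neg_iff_add_eq_0 add.commute)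

lemma mpoly_eval_diff: "mpoly_eval v (f - g) = mpoly_eval v f - mpoly_eval v g"
  using mpoly_eval_add[of v f "- g"] by (simp add: mpoly_eval_uminus)

lemma mpoly_eval_power: "mpoly_eval v (f ^ e) = mpoly_eval v f ^ e"
  by (induction e) (auto simp: mpoly_eval_one mpoly_eval_mult)

lemma mpoly_eval_prod: "mpoly_eval v (prod f A) = (\<Prod>x\<in>A. mpoly_eval v (f x))"
  by (induction A rule: infinite_finite_induct) (auto simp: mpoly_eval_one mpoly_eval_mult)

text \<open>The \<open>j\<close>-th partial derivative at \<open>v\<close> is read off the restriction of the polynomial to the
  line through \<open>v\<close> in direction of the \<open>j\<close>-th coordinate.\<close>

interpretation line: poly_hom "\<lambda>c. [:c:]" "\<lambda>i. [:v i, if i = j then 1 else 0:]"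
  for v :: "nat \<Rightarrow> 'k::field" and j
  by standard auto

definition mpoly_grad :: "(nat \<Rightarrow> 'k::field) \<Rightarrow> nat \<Rightarrow> 'k mpoly \<Rightarrow> 'k" where
  "mpoly_grad v j f = poly (pderiv (line.eval v j f)) 0"

lemma poly_line_eval: "poly (line.eval v j f) 0 = mpoly_eval v f"
  by (simp add: line.eval_def mpoly_eval_def poly_sum monomial_val_def poly_prod)

lemma mpoly_grad_add: "mpoly_grad v j (f + g) = mpoly_grad v j f + mpoly_grad v j g"
  by (simp add: mpoly_grad_def line.eval_add pderiv_add)

text \<open>This is the product rule for univariate polynomials along the line, taken at parameter
  0, where the line passes through \<open>v\<close>.\<close>

lemma mpoly_grad_mult:
  "mpoly_grad v j (f * g) = mpoly_eval v f * mpoly_grad v j g + mpoly_eval v g * mpoly_grad v j f"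
  by (simp add: mpoly_grad_def line.eval_mult pderiv_mult poly_line_eval)

lemma mpoly_grad_const: "mpoly_grad v j (const c) = 0"
  by (simp add: mpoly_grad_def const_def line.eval_single monomial_val_def pderiv_pCons)

lemma mpoly_grad_indet: "mpoly_grad v j (indet i) = (if i = j then 1 else 0)"
  by (simp add: mpoly_grad_def indet_def line.eval_single monomial_val_def pderiv_pCons)

section \<open>Degrees and homogeneous polynomials\<close>

definition mdeg :: "(nat \<Rightarrow>\<^sub>0 nat) \<Rightarrow> nat" where
  "mdeg t = (\<Sum>i\<in>Poly_Mapping.keys t. Poly_Mapping.lookup t i)"

lemma mdeg_superset:
  "finite A \<Longrightarrow> Poly_Mapping.keys t \<subseteq> A \<Longrightarrow> mdeg t = (\<Sum>i\<in>A. Poly_Mapping.lookup t i)"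
  unfolding mdeg_def by (intro sum.mono_neutral_left) (auto simp: in_keys_iff)

lemma mdeg_add: "mdeg (s + t) = mdeg s + mdeg t"
proof -
  let ?A = "Poly_Mapping.keys s \<union> Poly_Mapping.keys t"
  have "mdeg (s + t) = (\<Sum>i\<in>?A. Poly_Mapping.lookup (s + t) i)"
    using keys_add[of s t] by (intro mdeg_superset) auto
  also have "\<dots> = mdeg s + mdeg t"
    by (simp add: lookup_add sum.distrib mdeg_superset[symmetric])
  finally show ?thesis .
qed

lemma homogeneous_iff: "homogeneous d f \<longleftrightarrow> (\<forall>t\<in>Poly_Mapping.keys f. mdeg t = d)"
  by (simp add: homogeneous_def mdeg_def)

lemma homogeneous_zero: "homogeneous d 0"
  by (simp add: homogeneous_iff)

lemma homogeneous_single: "mdeg t = d \<Longrightarrow> homogeneous d (Poly_Mapping.single t c)"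
  by (simp add: homogeneous_iff)

lemma homogeneous_const: "homogeneous 0 (const c)"
  unfolding const_def by (rule homogeneous_single) (simp add: mdeg_def)

lemma homogeneous_indet: "homogeneous 1 (indet i)"
  unfolding indet_def by (rule homogeneous_single) (simp add: mdeg_def)

lemma homogeneous_add: "homogeneous d f \<Longrightarrow> homogeneous d g \<Longrightarrow> homogeneous d (f + g)"
  unfolding homogeneous_iff using keys_add[of f g] by blast

lemma keys_uminus: "Poly_Mapping.keys (- f) = Poly_Mapping.keys (f :: 'a \<Rightarrow>\<^sub>0 'b::ab_group_add)"
  by (auto simp: in_keys_iff)

lemma homogeneous_uminus: "homogeneous d f \<Longrightarrow> homogeneous d (- f)"
  unfolding homogeneous_iff keys_uminus .

lemma homogeneous_diff: "homogeneous d f \<Longrightarrow> homogeneous d g \<Longrightarrow> homogeneous d (f - g)"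
  using homogeneous_add[of d f "- g"] homogeneous_uminus[of d g] by simp

lemma homogeneous_mult: "homogeneous d f \<Longrightarrow> homogeneous e g \<Longrightarrow> homogeneous (d + e) (f * g)"
  unfolding homogeneous_iff using keys_mult[of f g] mdeg_add by fastforce

lemma homogeneous_one: "homogeneous 0 1"
  using homogeneous_const[of 1] by (simp add: const_def)

lemma homogeneous_power: "homogeneous d f \<Longrightarrow> homogeneous (e * d) (f ^ e)"
  by (induction e) (auto simp: homogeneous_one intro: homogeneous_mult)

lemma homogeneous_sum: "(\<And>x. x \<in> A \<Longrightarrow> homogeneous d (f x)) \<Longrightarrow> homogeneous d (sum f A)"
  by (induction A rule: infinite_finite_induct) (auto simp: homogeneous_zero homogeneous_add)

lemma homogeneous_prod:
  "finite A \<Longrightarrow> (\<And>x. x \<in> A \<Longrightarrow> homogeneous 1 (f x)) \<Longrightarrow> homogeneous (card A) (prod f A)"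
proof (induction A rule: finite_induct)
  case (insert x F)
  then show ?case using homogeneous_mult[of 1 "f x" "card F" "prod f F"] by simp
qed (simp add: homogeneous_one)

text \<open>Every monomial picks up one factor \<open>c\<close> per unit of degree. Vanishing of a
  homogeneous polynomial on a projective point can therefore be tested on a single coordinate
  vector.\<close>

lemma mpoly_eval_scale:
  assumes "homogeneous d f"
  shows "mpoly_eval (\<lambda>i. c * v i) f = c ^ d * mpoly_eval v f"
proof -
  have "monomial_val (\<lambda>i. c * v i) t = c ^ d * monomial_val v t" if "t \<in> Poly_Mapping.keys f" for t
    using assms that unfolding homogeneous_iff
    by (auto simp: monomial_val_def power_mult_distrib prod.distrib mdeg_def power_sum)
  then show ?thesis
    by (simp add: point_eval[symmetric] point.eval_def sum_distrib_left mult_ac cong: sum.cong)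
qed

section \<open>The polynomial ring\<close>

lemma poly_ring_sel [simp]:
  "mult (poly_ring n) = (*)" "one (poly_ring n) = 1" "zero (poly_ring n) = 0" "add (poly_ring n) = (+)"
  by (simp_all add: poly_ring_def)

abbreviation "S n \<equiv> carrier (poly_ring n)"

lemma S_iff: "f \<in> S n \<longleftrightarrow> (\<forall>t\<in>Poly_Mapping.keys f. Poly_Mapping.keys t \<subseteq> {..n})"
  by (simp add: poly_ring_def)

lemma S_zero: "0 \<in> S n" and S_one: "1 \<in> S n" and S_const: "const c \<in> S n"
  by (auto simp: S_iff const_def)

lemma S_indet: "i \<le> n \<Longrightarrow> indet i \<in> S n"
  by (simp add: S_iff indet_def)

lemma S_single: "Poly_Mapping.keys t \<subseteq> {..n} \<Longrightarrow> Poly_Mapping.single t c \<in> S n"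
  by (simp add: S_iff)

lemma S_add: "f \<in> S n \<Longrightarrow> g \<in> S n \<Longrightarrow> f + g \<in> S n"
  unfolding S_iff using keys_add[of f g] by blast

lemma S_uminus: "f \<in> S n \<Longrightarrow> - f \<in> S n"
  by (simp add: S_iff keys_uminus)

lemma S_diff: "f \<in> S n \<Longrightarrow> g \<in> S n \<Longrightarrow> f - g \<in> S n"
  using S_add[of f n "- g"] S_uminus[of g n] by simp

lemma S_mult:
  assumes "f \<in> S n" "g \<in> S n" shows "f * g \<in> S n"
  unfolding S_iff
proof
  fix t assume "t \<in> Poly_Mapping.keys (f * g)"
  then obtain a b where "a \<in> Poly_Mapping.keys f" "b \<in> Poly_Mapping.keys g" "t = a + b"
    using keys_mult[of f g] by blast
  then show "Poly_Mapping.keys t \<subseteq> {..n}"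
    using assms keys_add[of a b] unfolding S_iff by blast
qed

lemma S_power: "f \<in> S n \<Longrightarrow> f ^ e \<in> S n"
  by (induction e) (auto simp: S_one S_mult)

lemma S_sum: "(\<And>x. x \<in> A \<Longrightarrow> f x \<in> S n) \<Longrightarrow> sum f A \<in> S n"
  by (induction A rule: infinite_finite_induct) (auto simp: S_zero S_add)

lemma S_prod: "(\<And>x. x \<in> A \<Longrightarrow> f x \<in> S n) \<Longrightarrow> prod f A \<in> S n"
  by (induction A rule: infinite_finite_induct) (auto simp: S_one S_mult)

lemma cring_poly_ring: "cring (poly_ring n)"
proof (rule cringI)
  show "abelian_group (poly_ring n)"
  proof (rule abelian_groupI)
    fix f assume "f \<in> S n"
    then show "\<exists>y\<in>S n. y \<oplus>\<^bsub>poly_ring n\<^esub> f = \<zero>\<^bsub>poly_ring n\<^esub>"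
      by (intro bexI[of _ "- f"]) (auto simp: S_uminus)
  qed (auto simp: S_zero S_add)
  show "comm_monoid (poly_ring n)"
    by (rule comm_monoidI) (auto simp: S_one S_mult mult_ac)
qed (auto simp: distrib_right)

lemma a_minus_poly_ring:
  assumes "f \<in> S n" "g \<in> S n" shows "f \<ominus>\<^bsub>poly_ring n\<^esub> g = f - g"
proof -
  interpret cring "poly_ring n" by (rule cring_poly_ring)
  have "\<ominus>\<^bsub>poly_ring n\<^esub> g = - g"
    by (rule minus_equality) (auto simp: assms S_uminus)
  then show ?thesis by (simp add: minus_eq)
qed

section \<open>Vanishing ideals and their powers\<close>

lemma ideal_vanishing_ideal: "ideal (vanishing_ideal n p) (poly_ring n)"
proof -
  interpret cring "poly_ring n" by (rule cring_poly_ring)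
  show ?thesis unfolding vanishing_ideal_def by (rule genideal_ideal) blast
qed

lemma vanishing_idealI:
  assumes "f \<in> S n" "homogeneous d f" "\<And>v. v \<in> p \<Longrightarrow> mpoly_eval v f = 0"
  shows "f \<in> vanishing_ideal n p"
proof -
  interpret cring "poly_ring n" by (rule cring_poly_ring)
  show ?thesis unfolding vanishing_ideal_def using assms by (intro set_mp[OF genideal_self]) auto
qed

text \<open>The kernel of evaluation at \<open>v\<close> is an ideal that contains the homogeneous
  generators, so it also contains the inhomogeneous elements that they generate.\<close>

lemma vanishing_ideal_eval:
  assumes "v \<in> p" "f \<in> vanishing_ideal n p"
  shows "mpoly_eval v f = 0"
proof -
  interpret cring "poly_ring n" by (rule cring_poly_ring)
  have hom: "mpoly_eval v \<in> Ring.ring_hom (poly_ring n) class_ring"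
    by (rule ring_hom_memI) (auto simp: mpoly_eval_add mpoly_eval_mult mpoly_eval_one)
  have "ring_hom_ring (poly_ring n) class_ring (mpoly_eval v)"
    by (rule ring_hom_ringI2[OF ring_axioms class_ring.ring_axioms hom])
  from ring_hom_ring.kernel_is_ideal[OF this]
  have "vanishing_ideal n p \<subseteq> a_kernel (poly_ring n) class_ring (mpoly_eval v)"
    unfolding vanishing_ideal_def
    by (rule genideal_minimal) (use assms(1) in \<open>auto simp: a_kernel_def'\<close>)
  then show ?thesis using assms(2) by (auto simp: a_kernel_def')
qed

lemma ideals_set_pow_0: "I [^]\<^bsub>ideals_set R\<^esub> (0::nat) = carrier R"
  and ideals_set_pow_Suc:
    "I [^]\<^bsub>ideals_set R\<^esub> Suc k = ideal_prod R (I [^]\<^bsub>ideals_set R\<^esub> k) I"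
  by (simp_all add: nat_pow_def ideals_set_def)

lemma (in ring) ideal_ideals_set_pow:
  assumes "ideal I R" shows "ideal (I [^]\<^bsub>ideals_set R\<^esub> (k::nat)) R"
proof (induction k)
  case 0
  then show ?case unfolding ideals_set_pow_0 by (rule oneideal)
next
  case (Suc k)
  then show ?case unfolding ideals_set_pow_Suc by (rule ideal_prod_is_ideal[OF _ assms])
qed

lemma pow_in_ideals_set_pow:
  assumes "f \<in> I" shows "f ^ k \<in> I [^]\<^bsub>ideals_set (poly_ring n)\<^esub> k"
proof (induction k)
  case 0
  then show ?case unfolding ideals_set_pow_0 by (simp add: S_one)
next
  case (Suc k)
  then show ?case
    using ideal_prod.prod[OF Suc assms, of "poly_ring n"]
    unfolding ideals_set_pow_Suc by (simp add: mult.commute)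
qed

text \<open>Elements of the power are sums of products of two elements of \<open>I\<close>. The
  product rule expresses the derivative of such a product through the values of its factors, and
  both values are 0.\<close>

lemma ideals_set_pow_singular:
  assumes I: "ideal I (poly_ring n)" and k: "(k::nat) \<ge> 2" and v: "\<And>f. f \<in> I \<Longrightarrow> mpoly_eval v f = 0"
    and f: "f \<in> I [^]\<^bsub>ideals_set (poly_ring n)\<^esub> k"
  shows "mpoly_eval v f = 0 \<and> mpoly_grad v j f = 0"
proof -
  interpret cring "poly_ring n" by (rule cring_poly_ring)
  \<comment> \<open>Two factors are split off so that the left factor of the last ideal product, the
    power \<open>Suc l\<close>, is still contained in \<open>I\<close>.\<close>
  obtain l where l: "k = Suc (Suc l)" using k by (auto simp: numeral_2_eq_2 dest: Suc_le_D)
  let ?A = "I [^]\<^bsub>ideals_set (poly_ring n)\<^esub> Suc l"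
  have A: "?A \<subseteq> I"
    using ideal_prod_inter[OF ideal_ideals_set_pow[OF I, of l] I] unfolding ideals_set_pow_Suc by blast
  have "f \<in> ideal_prod (poly_ring n) ?A I" using f unfolding l ideals_set_pow_Suc .
  then show ?thesis
  proof (induction f rule: ideal_prod.induct)
    case (prod a b)
    then have "a \<in> I" using A by blast
    then show ?case using prod v by (simp add: mpoly_eval_mult mpoly_grad_mult)
  qed (simp add: mpoly_eval_add mpoly_grad_add)
qed

section \<open>Fat points away from the hyperplane at infinity\<close>

lemma proj_space_normalize:
  assumes p: "p \<in> proj_space n" and p0: "\<And>v. v \<in> p \<Longrightarrow> v 0 \<noteq> (0::'k::field)"
  obtains v where "v \<in> coord_vectors n" "v 0 = 1" "p = proj_rel n `` {v}"
proof -
  obtain x where x: "x \<in> coord_vectors n" "p = proj_rel n `` {x}"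
    using p unfolding proj_space_def by (rule quotientE)
  \<comment> \<open>By reflexivity the representative belongs to its own class, so the hypothesis on
    coordinate 0 applies to it and one may divide by \<open>x 0\<close>.\<close>
  have "(x, x) \<in> proj_rel n" using x(1) by (auto simp: proj_rel_def intro!: exI[of _ 1])
  then have x0: "x 0 \<noteq> 0" using x(2) p0 by blast
  define v where "v = (\<lambda>j. x j / x 0)"
  have v: "v \<in> coord_vectors n" using x(1) x0 by (auto simp: v_def coord_vectors_def)
  have "(x, w) \<in> proj_rel n \<longleftrightarrow> (v, w) \<in> proj_rel n" for w
  proof
    assume "(x, w) \<in> proj_rel n"
    then obtain c where "w \<in> coord_vectors n" "c \<noteq> 0" "\<forall>j. w j = c * x j"
      unfolding proj_rel_def by blast
    then show "(v, w) \<in> proj_rel n" using v x0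
      unfolding proj_rel_def by (auto simp: v_def intro!: exI[of _ "c * x 0"])
  next
    assume "(v, w) \<in> proj_rel n"
    then obtain c where "w \<in> coord_vectors n" "c \<noteq> 0" "\<forall>j. w j = c * v j"
      unfolding proj_rel_def by blast
    then show "(x, w) \<in> proj_rel n" using x(1) x0
      unfolding proj_rel_def by (auto simp: v_def intro!: exI[of _ "c / x 0"])
  qed
  then have "p = proj_rel n `` {v}" using x(2) by auto
  then show thesis using that v x0 by (auto simp: v_def)
qed

section \<open>Polynomials that are powers of one variable modulo \<open>X_0\<close>\<close>

lemma indet_power: "indet j ^ M = (Poly_Mapping.single (Poly_Mapping.single j M) 1 :: 'k::field mpoly)"
proof (induction M)
  case (Suc M)
  then show ?case by (simp add: indet_def mult_single single_add[symmetric])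
qed simp

lemma mdeg_single: "mdeg (Poly_Mapping.single j a) = a"
  by (cases "a = 0") (simp_all add: mdeg_def)

lemma single_factor:
  assumes "a \<le> Poly_Mapping.lookup t j"
  obtains t' where "t = Poly_Mapping.single j a + t'" "Poly_Mapping.keys t' \<subseteq> Poly_Mapping.keys t"
    "mdeg t = a + mdeg t'"
    "\<And>c. Poly_Mapping.single t c = indet j ^ a * Poly_Mapping.single t' (c::'k::field)"
proof -
  define t' where "t' = t - Poly_Mapping.single j a"
  have t: "t = Poly_Mapping.single j a + t'"
    by (rule poly_mapping_eqI)
      (use assms in \<open>auto simp: t'_def lookup_add lookup_minus lookup_single when_def\<close>)
  moreover have "Poly_Mapping.keys t' \<subseteq> Poly_Mapping.keys t"
    using t by (auto simp: in_keys_iff lookup_add)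
  moreover have "mdeg t = a + mdeg t'"
    by (subst t) (simp add: mdeg_add mdeg_single)
  moreover have "Poly_Mapping.single t c = indet j ^ a * Poly_Mapping.single t' c" for c :: 'k
    by (subst t) (simp add: indet_power mult_single)
  ultimately show thesis by (rule that)
qed

text \<open>The polynomials of degree \<open>M\<close> that agree with \<open>X\<^sub>j\<^sup>M\<close> modulo \<open>X\<^sub>0\<close>.\<close>

definition lead_pow :: "nat \<Rightarrow> nat \<Rightarrow> nat \<Rightarrow> 'k::field mpoly \<Rightarrow> bool" where
  "lead_pow n j M p \<longleftrightarrow> (\<exists>h\<in>S n. (\<forall>t\<in>Poly_Mapping.keys h. Suc (mdeg t) = M) \<and>
      p = indet j ^ M + indet 0 * h)"

text \<open>Stating the degree condition as \<open>Suc (mdeg t) = M\<close> forces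
  \<open>h = 0\<close> for \<open>M = 0\<close>, without truncated subtraction.\<close>

lemma lead_pow_one: "lead_pow n j 0 1"
  unfolding lead_pow_def by (rule bexI[of _ 0]) (auto simp: S_zero)

lemma lead_pow_linear: "lead_pow n j 1 (indet j - const c * indet 0)"
  unfolding lead_pow_def
proof (intro bexI conjI ballI)
  show "indet j - const c * indet 0 = indet j ^ 1 + indet 0 * (- const c)"
    by (simp add: mult.commute)
  show "- const c \<in> S n" by (intro S_uminus S_const)
  show "Suc (mdeg t) = 1" if "t \<in> Poly_Mapping.keys (- const c)" for t
    using homogeneous_uminus[OF homogeneous_const[of c]] that unfolding homogeneous_iff by simp
qed

text \<open>In the expansion of \<open>(X_j^a + X_0 h) (X_j^b + X_0 g)\<close> all terms except
  \<open>X_j^(a+b)\<close> contain \<open>X_0\<close>; the three cofactors treated in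
  \<open>k1\<close>, \<open>k2\<close> and \<open>k3\<close> have degree
  \<open>a + b - 1\<close>.\<close>

lemma lead_pow_mult:
  assumes j: "j \<le> n" and p: "lead_pow n j a p" and q: "lead_pow n j b q"
  shows "lead_pow n j (a + b) (p * q)"
proof -
  obtain h where h: "h \<in> S n" "\<And>t. t \<in> Poly_Mapping.keys h \<Longrightarrow> Suc (mdeg t) = a"
      "p = indet j ^ a + indet 0 * h"
    using p unfolding lead_pow_def by blast
  obtain g where g: "g \<in> S n" "\<And>t. t \<in> Poly_Mapping.keys g \<Longrightarrow> Suc (mdeg t) = b"
      "q = indet j ^ b + indet 0 * g"
    using q unfolding lead_pow_def by blast
  have hom: "homogeneous a (indet j ^ a :: 'a mpoly)" for a
    using homogeneous_power[OF homogeneous_indet[of j], of a] by simp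
  have k1: "Suc (mdeg t) = a + b" if "t \<in> Poly_Mapping.keys (indet j ^ a * g)" for t
  proof -
    obtain x y where "x \<in> Poly_Mapping.keys (indet j ^ a :: 'a mpoly)" "y \<in> Poly_Mapping.keys g" "t = x + y"
      using keys_mult[of "indet j ^ a" g] \<open>t \<in> _\<close> by blast
    then show ?thesis using hom[of a] g(2)[of y] by (auto simp: homogeneous_iff mdeg_add)
  qed
  have k2: "Suc (mdeg t) = a + b" if "t \<in> Poly_Mapping.keys (h * indet j ^ b)" for t
  proof -
    obtain x y where "x \<in> Poly_Mapping.keys h" "y \<in> Poly_Mapping.keys (indet j ^ b :: 'a mpoly)" "t = x + y"
      using keys_mult[of h "indet j ^ b"] \<open>t \<in> _\<close> by blast
    then show ?thesis using hom[of b] h(2)[of x] by (auto simp: homogeneous_iff mdeg_add)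
  qed
  have k3: "Suc (mdeg t) = a + b" if "t \<in> Poly_Mapping.keys (indet 0 * h * g)" for t
  proof -
    obtain x y where xy: "x \<in> Poly_Mapping.keys (indet 0 * h)" "y \<in> Poly_Mapping.keys g" "t = x + y"
      using keys_mult[of "indet 0 * h" g] \<open>t \<in> _\<close> by blast
    obtain x1 x2 where "x1 \<in> Poly_Mapping.keys (indet 0 :: 'a mpoly)" "x2 \<in> Poly_Mapping.keys h" "x = x1 + x2"
      using keys_mult[of "indet 0" h] xy(1) by blast
    then show ?thesis using xy homogeneous_indet[of 0] h(2)[of x2] g(2)[of y]
      by (auto simp: homogeneous_iff mdeg_add)
  qed
  let ?H = "indet j ^ a * g + h * indet j ^ b + indet 0 * h * g"
  have "Suc (mdeg t) = a + b" if "t \<in> Poly_Mapping.keys ?H" for t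
    using that k1 k2 k3 keys_add[of "indet j ^ a * g + h * indet j ^ b" "indet 0 * h * g"]
      keys_add[of "indet j ^ a * g" "h * indet j ^ b"] by blast
  moreover have "?H \<in> S n" using j h(1) g(1) by (intro S_add S_mult S_power S_indet) auto
  moreover have "p * q = indet j ^ (a + b) + indet 0 * ?H"
    unfolding h(3) g(3) by (simp add: algebra_simps power_add)
  ultimately show ?thesis unfolding lead_pow_def by blast
qed

lemma lead_pow_power:
  assumes "j \<le> n" "lead_pow n j a p" shows "lead_pow n j (e * a) (p ^ e)"
  by (induction e) (auto simp: lead_pow_one intro: lead_pow_mult[OF assms(1)] assms(2))

lemma lead_pow_prod:
  assumes "j \<le> n" "finite A" "\<And>i. i \<in> A \<Longrightarrow> lead_pow n j (a i) (p i)"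
  shows "lead_pow n j (sum a A) (prod p A)"
  using assms(2,3)
  by (induction A rule: finite_induct) (auto simp: lead_pow_one intro: lead_pow_mult[OF assms(1)])

text \<open>Each point is accompanied by its coordinate vector with entry 1 at index 0, so that
  \<open>X_0\<close> has value 1 at all points and differing coordinates already separate
  them.\<close>

locale fat_points =
  fixes n s :: nat and P :: "nat \<Rightarrow> (nat \<Rightarrow> 'k::field) set" and m :: "nat \<Rightarrow> nat"
    and v :: "nat \<Rightarrow> nat \<Rightarrow> 'k"
  assumes s: "s \<ge> 1"
    and coord: "i \<in> {1..s} \<Longrightarrow> v i \<in> coord_vectors n"
    and v0: "i \<in> {1..s} \<Longrightarrow> v i 0 = 1"
    and P: "i \<in> {1..s} \<Longrightarrow> P i = proj_rel n `` {v i}"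
    and inj: "inj_on v {1..s}"
begin

abbreviation "I \<equiv> fat_ideal n s P m"
abbreviation "p i \<equiv> vanishing_ideal n (P i)"
abbreviation "lin i j \<equiv> indet j - const (v i j) * indet 0"

sublocale pr: cring "poly_ring n" by (rule cring_poly_ring)

sublocale ideal_I: ideal I "poly_ring n"
proof -
  have "ideal (\<Inter>((\<lambda>i. p i [^]\<^bsub>ideals_set (poly_ring n)\<^esub> m i) ` {1..s})) (poly_ring n)"
    using s by (intro pr.i_Intersect) (auto intro: pr.ideal_ideals_set_pow ideal_vanishing_ideal)
  then show "ideal I (poly_ring n)" unfolding fat_ideal_def .
qed

lemma I_add: "f \<in> I \<Longrightarrow> g \<in> I \<Longrightarrow> f + g \<in> I"
  using ideal_I.a_closed[of f g] by simp

lemma I_zero: "0 \<in> I"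
  using ideal_I.zero_closed by simp

lemma I_mult: "f \<in> I \<Longrightarrow> g \<in> S n \<Longrightarrow> f * g \<in> I"
  using ideal_I.I_r_closed[of f g] by simp

lemma I_sum: "(\<And>x. x \<in> A \<Longrightarrow> f x \<in> I) \<Longrightarrow> sum f A \<in> I"
  by (induction A rule: infinite_finite_induct) (auto simp: I_zero I_add)

lemma point_in: "i \<in> {1..s} \<Longrightarrow> v i \<in> P i"
  using coord[of i] by (auto simp: P proj_rel_def intro!: exI[of _ 1])

text \<open>All coordinate vectors of the point are multiples of \<open>v i\<close>, and a
  homogeneous polynomial only changes by a factor along them.\<close>

lemma in_p:
  assumes i: "i \<in> {1..s}" and f: "f \<in> S n" "homogeneous d f" "mpoly_eval (v i) f = 0"
  shows "f \<in> p i"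
proof (rule vanishing_idealI[OF f(1,2)])
  fix w assume "w \<in> P i"
  then obtain c where "\<forall>j. w j = c * v i j" unfolding P[OF i] proj_rel_def by blast
  then have "w = (\<lambda>j. c * v i j)" by auto
  then show "mpoly_eval w f = 0" using mpoly_eval_scale[OF f(2)] f(3) by simp
qed

lemma S_lin: "j \<le> n \<Longrightarrow> lin i j \<in> S n"
  by (intro S_diff S_mult S_indet S_const) auto

lemma homogeneous_lin: "homogeneous 1 (lin i j)"
  using homogeneous_mult[OF homogeneous_const homogeneous_indet]
  by (intro homogeneous_diff homogeneous_indet) simp

lemma eval_lin: "mpoly_eval w (lin i j) = w j - v i j * w 0"
  by (simp add: mpoly_eval_diff mpoly_eval_mult mpoly_eval_const mpoly_eval_indet)

text \<open>The linear form \<open>X_j - v_ij X_0\<close> vanishes at point \<open>i\<close>, so its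
  power \<open>m i\<close> lies in the required power of that ideal, and the factors of the other
  points merely multiply it. As all these forms have leading variable \<open>X_j\<close>, the
  product makes \<open>X_j^M\<close>, with \<open>M\<close> the sum of the multiplicities, a
  multiple of \<open>X_0\<close> modulo \<open>I\<close>.\<close>

lemma prod_lin_in_I:
  assumes j: "j \<le> n" shows "(\<Prod>i\<in>{1..s}. lin i j ^ m i) \<in> I"
  unfolding fat_ideal_def
proof
  fix i assume i: "i \<in> {1..s}"
  have "lin i j \<in> p i"
    using S_lin[OF j] homogeneous_lin by (rule in_p[OF i]) (simp add: eval_lin v0[OF i])
  then have "lin i j ^ m i \<in> p i [^]\<^bsub>ideals_set (poly_ring n)\<^esub> m i"
    by (rule pow_in_ideals_set_pow)
  then have "lin i j ^ m i * (\<Prod>i\<in>{1..s} - {i}. lin i j ^ m i)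
      \<in> p i [^]\<^bsub>ideals_set (poly_ring n)\<^esub> m i"
    using ideal.I_r_closed[OF pr.ideal_ideals_set_pow[OF ideal_vanishing_ideal], of _ "P i" "m i"
       "\<Prod>i\<in>{1..s} - {i}. lin i j ^ m i"] S_lin[OF j] by (simp add: S_prod S_power)
  then show "(\<Prod>i\<in>{1..s}. lin i j ^ m i) \<in> p i [^]\<^bsub>ideals_set (poly_ring n)\<^esub> m i"
    using i by (simp add: prod.remove)
qed

text \<open>A monomial of large degree is either divisible by \<open>X_0\<close>, or divisible by
  \<open>X_j^M\<close> for some other variable, where \<open>M\<close> is the sum of the
  multiplicities; in the latter case an element of \<open>I\<close> rewrites
  \<open>X_j^M\<close>.\<close>

lemma reduce_mod_I_single:
  assumes e: "n * (\<Sum>i\<in>{1..s}. m i) \<le> e" and t: "Poly_Mapping.keys t \<subseteq> {..n}" "mdeg t = Suc e"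
  shows "\<exists>g\<in>S n. homogeneous e g \<and> Poly_Mapping.single t c - indet 0 * g \<in> I"
proof (cases "Poly_Mapping.lookup t 0 = 0")
  case False
  then have "1 \<le> Poly_Mapping.lookup t 0" by simp
  from single_factor[OF this, where 'k='k]
  obtain t' where t': "Poly_Mapping.keys t' \<subseteq> Poly_Mapping.keys t" "mdeg t = 1 + mdeg t'"
    "Poly_Mapping.single t c = indet 0 ^ 1 * Poly_Mapping.single t' c"
    by metis
  then show ?thesis
    using t I_zero by (intro bexI[of _ "Poly_Mapping.single t' c"]) (auto intro: homogeneous_single S_single)
next
  case True
  let ?M = "\<Sum>i\<in>{1..s}. m i"
  \<comment> \<open>Pigeonhole: only \<open>n\<close> variables remain, and exponents bounded by
    \<open>?M\<close> add up to at most \<open>n * ?M\<close>, which is less than the degree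
    \<open>Suc e\<close>.\<close>
  have "\<exists>j\<in>{1..n}. ?M \<le> Poly_Mapping.lookup t j"
  proof (rule ccontr)
    assume "\<not> ?thesis"
    then have le: "Poly_Mapping.lookup t j \<le> ?M" if "j \<in> {1..n}" for j using that by force
    have "mdeg t = (\<Sum>j\<in>{1..n}. Poly_Mapping.lookup t j)"
    proof (rule mdeg_superset)
      show "Poly_Mapping.keys t \<subseteq> {1..n}"
      proof
        fix j assume j: "j \<in> Poly_Mapping.keys t"
        moreover have "0 \<notin> Poly_Mapping.keys t" using True by (simp add: in_keys_iff)
        ultimately have "j \<noteq> 0" "j \<in> {..n}" using j subsetD[OF t(1) j] by metis+
        then show "j \<in> {1..n}" by simp
      qed
    qed simp
    also have "\<dots> \<le> n * ?M" using sum_bounded_above[of "{1..n}", OF le] by simp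
    finally show False using e t(2) by simp
  qed
  then obtain j where j: "j \<in> {1..n}" "?M \<le> Poly_Mapping.lookup t j" by blast
  from single_factor[OF j(2), where 'k='k]
  obtain t' where t': "Poly_Mapping.keys t' \<subseteq> Poly_Mapping.keys t" "mdeg t = ?M + mdeg t'"
    "Poly_Mapping.single t c = indet j ^ ?M * Poly_Mapping.single t' c"
    by metis
  let ?q = "\<Prod>i\<in>{1..s}. lin i j ^ m i"
  have "lead_pow n j (\<Sum>i\<in>{1..s}. m i * 1) ?q"
    using j(1) by (intro lead_pow_prod lead_pow_power lead_pow_linear) auto
  then obtain h where h: "h \<in> S n" "\<And>u. u \<in> Poly_Mapping.keys h \<Longrightarrow> Suc (mdeg u) = ?M"
      "?q = indet j ^ ?M + indet 0 * h"
    unfolding lead_pow_def by auto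
  let ?t = "Poly_Mapping.single t' c"
  have St: "?t \<in> S n" using t'(1) t(1) by (intro S_single) blast
  \<comment> \<open>The element \<open>?q\<close> of \<open>I\<close> has the form
    \<open>X_j^M + X_0 h\<close>, so \<open>X_j^M\<close> is congruent to \<open>- X_0 h\<close>;
    this gives the witness.\<close>
  show ?thesis
  proof (intro bexI[of _ "- (h * ?t)"] conjI)
    have "homogeneous e (h * ?t)"
      unfolding homogeneous_iff
    proof
      fix u assume "u \<in> Poly_Mapping.keys (h * ?t)"
      then obtain a b where "a \<in> Poly_Mapping.keys h" "b \<in> Poly_Mapping.keys ?t" "u = a + b"
        using keys_mult[of h ?t] by blast
      then show "mdeg u = e" using h(2)[of a] t'(2) t(2) by (auto simp: mdeg_add split: if_splits)
    qed
    then show "homogeneous e (- (h * ?t))" by (rule homogeneous_uminus)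
    have "Poly_Mapping.single t c - indet 0 * - (h * ?t) = ?q * ?t"
      unfolding t'(3) h(3) by (simp add: algebra_simps)
    then show "Poly_Mapping.single t c - indet 0 * - (h * ?t) \<in> I"
      using I_mult[OF prod_lin_in_I St] j(1) by simp
    show "- (h * ?t) \<in> S n" by (intro S_uminus S_mult h(1) St)
  qed
qed

text \<open>Since no point lies on \<open>X\<^sub>0 = 0\<close>, a power of each variable is a multiple of \<open>X\<^sub>0\<close> modulo
  \<open>I\<close>, and so are all polynomials of large degree.\<close>

lemma reduce_mod_I:
  assumes e: "n * (\<Sum>i\<in>{1..s}. m i) \<le> e" and f: "f \<in> S n" "homogeneous (Suc e) f"
  shows "\<exists>g\<in>S n. homogeneous e g \<and> f - indet 0 * g \<in> I"
proof -
  let ?K = "Poly_Mapping.keys f" and ?m = "\<lambda>t. Poly_Mapping.single t (Poly_Mapping.lookup f t)"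
  have "\<forall>t\<in>?K. \<exists>g. g \<in> S n \<and> homogeneous e g \<and> ?m t - indet 0 * g \<in> I"
  proof
    fix t assume t: "t \<in> ?K"
    show "\<exists>g. g \<in> S n \<and> homogeneous e g \<and> ?m t - indet 0 * g \<in> I"
    proof -
      have "Poly_Mapping.keys t \<subseteq> {..n}" "mdeg t = Suc e"
        using f t unfolding S_iff homogeneous_iff by auto
      from reduce_mod_I_single[OF e this] show ?thesis by blast
    qed
  qed
  from bchoice[OF this]
  obtain g where g': "\<forall>t\<in>?K. g t \<in> S n \<and> homogeneous e (g t) \<and> ?m t - indet 0 * g t \<in> I"
    by blast
  then have g: "\<And>t. t \<in> ?K \<Longrightarrow> g t \<in> S n" "\<And>t. t \<in> ?K \<Longrightarrow> homogeneous e (g t)"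
    "\<And>t. t \<in> ?K \<Longrightarrow> ?m t - indet 0 * g t \<in> I"
    by blast+
  have "f - indet 0 * sum g ?K = (\<Sum>t\<in>?K. ?m t - indet 0 * g t)"
    using poly_mapping_sum_single[of f] by (simp add: sum_subtractf sum_distrib_left)
  also have "\<dots> \<in> I" using g(3) by (rule I_sum)
  finally show ?thesis using g(1,2) by (intro bexI[of _ "sum g ?K"] conjI homogeneous_sum S_sum) auto
qed

lemma singular_at_fat_point:
  assumes "i \<in> {1..s}" "m i \<ge> 2" "f \<in> I"
  shows "mpoly_eval (v i) f = 0" "mpoly_grad (v i) j f = 0"
proof -
  have "f \<in> p i [^]\<^bsub>ideals_set (poly_ring n)\<^esub> m i"
    using assms(1,3) unfolding fat_ideal_def by blast
  moreover have "mpoly_eval (v i) g = 0" if "g \<in> p i" for g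
    using vanishing_ideal_eval[OF point_in[OF assms(1)] that] .
  ultimately have "mpoly_eval (v i) f = 0 \<and> mpoly_grad (v i) j f = 0"
    by (intro ideals_set_pow_singular[OF ideal_vanishing_ideal assms(2)])
  then show "mpoly_eval (v i) f = 0" "mpoly_grad (v i) j f = 0" by blast+
qed

text \<open>With all multiplicities equal to 1, membership in \<open>I\<close> is tested by values
  at the chosen vectors; homogeneity of \<open>f\<close> lets one vector per point decide.\<close>

lemma reduced_in_I:
  assumes m: "\<And>i. i \<in> {1..s} \<Longrightarrow> m i = 1"
    and f: "f \<in> S n" "homogeneous d f" "\<And>i. i \<in> {1..s} \<Longrightarrow> mpoly_eval (v i) f = 0"
  shows "f \<in> I"
  unfolding fat_ideal_def
proof
  fix i assume i: "i \<in> {1..s}"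
  then have "f ^ 1 \<in> p i [^]\<^bsub>ideals_set (poly_ring n)\<^esub> (1::nat)"
    by (intro pow_in_ideals_set_pow in_p[OF i f(1,2)] f(3))
  then show "f \<in> p i [^]\<^bsub>ideals_set (poly_ring n)\<^esub> m i" using m[OF i] by simp
qed

text \<open>For every other point \<open>j\<close> there is a coordinate \<open>a j\<close> in which
  it differs from point \<open>i\<close>, and the linear form of \<open>j\<close> in that coordinate
  vanishes at \<open>j\<close> but not at \<open>i\<close>. The product over all other points has
  degree \<open>s - 1\<close> regardless of \<open>i\<close>.\<close>

lemma separators:
  assumes i: "i \<in> {1..s}"
  obtains f where "f \<in> S n" "homogeneous (s - 1) f" "mpoly_eval (v i) f = 1"
    "\<And>j. j \<in> {1..s} \<Longrightarrow> j \<noteq> i \<Longrightarrow> mpoly_eval (v j) f = 0"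
proof -
  have "\<exists>a\<le>n. v i a \<noteq> v j a" if j: "j \<in> {1..s} - {i}" for j
  proof (rule ccontr)
    assume "\<not> ?thesis"
    \<comment> \<open>Entries beyond index \<open>n\<close> are 0 by convention, so distinct vectors
      differ at some index up to \<open>n\<close>.\<close>
    moreover have "v i a = v j a" if "a > n" for a
      using coord[OF i] coord[of j] j that by (simp add: coord_vectors_def)
    ultimately have "v i = v j" by (auto simp: fun_eq_iff not_le)
    then show False using inj_onD[OF inj, of i j] i j by blast
  qed
  then have "\<forall>j\<in>{1..s} - {i}. \<exists>a. a \<le> n \<and> v i a \<noteq> v j a" by blast
  from bchoice[OF this] obtain a where a: "\<And>j. j \<in> {1..s} - {i} \<Longrightarrow> a j \<le> n"
    "\<And>j. j \<in> {1..s} - {i} \<Longrightarrow> v i (a j) \<noteq> v j (a j)"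
    by blast
  define g where "g = (\<Prod>j\<in>{1..s} - {i}. lin j (a j))"
  have ev: "mpoly_eval w g = (\<Prod>j\<in>{1..s} - {i}. w (a j) - v j (a j) * w 0)" for w
    by (simp add: g_def mpoly_eval_prod eval_lin)
  have g1: "mpoly_eval (v i) g \<noteq> 0" using a(2) i by (simp add: ev v0)
  have g0: "mpoly_eval (v j) g = 0" if "j \<in> {1..s}" "j \<noteq> i" for j
    unfolding ev using that by (intro prod_zero) (auto intro!: bexI[of _ j] simp: v0)
  have gS: "g \<in> S n" unfolding g_def by (intro S_prod S_lin a(1))
  have gh: "homogeneous (s - 1) g"
    using homogeneous_prod[of "{1..s} - {i}" "\<lambda>j. lin j (a j)"] homogeneous_lin i
    by (simp add: g_def)
  \<comment> \<open>Dividing by the value at point \<open>i\<close> normalizes it to 1 and leaves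
    the degree unchanged.\<close>
  show thesis
  proof (rule that[of "const (inverse (mpoly_eval (v i) g)) * g"])
    show "homogeneous (s - 1) (const (inverse (mpoly_eval (v i) g)) * g)"
      using homogeneous_mult[OF homogeneous_const gh] by simp
  qed (use gS g1 g0 in \<open>auto simp: mpoly_eval_mult mpoly_eval_const S_mult S_const\<close>)
qed

end

section \<open>Restriction of scalars and dimension\<close>

locale scalar_restriction = M: Module.module R M
  for R :: "('r, 'x) ring_scheme" (structure) and M :: "('r, 'a, 'y) module_scheme" (structure) +
  fixes \<phi> :: "'k::field \<Rightarrow> 'r"
  assumes \<phi>_closed: "\<phi> c \<in> carrier R"
    and \<phi>_add: "\<phi> (c + c') = \<phi> c \<oplus> \<phi> c'"
    and \<phi>_mult: "\<phi> (c * c') = \<phi> c \<otimes> \<phi> c'"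
    and \<phi>_one: "\<phi> 1 = \<one>"
begin

text \<open>Graded pieces are in general only subspaces over the field, not submodules over the
  ring. Treating them as plain subsets of \<open>M\<close> lets different pieces be related by
  multiplication inside one module.\<close>

definition ksubspace :: "'a set \<Rightarrow> bool" where
  "ksubspace C \<longleftrightarrow> C \<subseteq> carrier M \<and> \<zero>\<^bsub>M\<^esub> \<in> C \<and> (\<forall>x\<in>C. \<forall>y\<in>C. x \<oplus>\<^bsub>M\<^esub> y \<in> C) \<and>
    (\<forall>c. \<forall>x\<in>C. \<phi> c \<odot>\<^bsub>M\<^esub> x \<in> C)"

abbreviation "V C \<equiv> restrict_scalars \<phi> M C"
abbreviation "kspan \<equiv> LinearCombinations.module.span class_ring (V (carrier M))"

lemma V_sel [simp]: "carrier (V C) = C" "zero (V C) = \<zero>\<^bsub>M\<^esub>" "add (V C) = add M"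
  "smult (V C) = (\<lambda>c. smult M (\<phi> c))"
  by (simp_all add: restrict_scalars_def)

lemma ksubspaceD:
  assumes "ksubspace C"
  shows "x \<in> C \<Longrightarrow> x \<in> carrier M" "\<zero>\<^bsub>M\<^esub> \<in> C" "x \<in> C \<Longrightarrow> y \<in> C \<Longrightarrow> x \<oplus>\<^bsub>M\<^esub> y \<in> C"
    "x \<in> C \<Longrightarrow> \<phi> c \<odot>\<^bsub>M\<^esub> x \<in> C"
  using assms unfolding ksubspace_def by blast+

lemma ksubspaceI:
  assumes "\<And>x. x \<in> C \<Longrightarrow> x \<in> carrier M" "\<zero>\<^bsub>M\<^esub> \<in> C" "\<And>x y. x \<in> C \<Longrightarrow> y \<in> C \<Longrightarrow> x \<oplus>\<^bsub>M\<^esub> y \<in> C"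
    "\<And>c x. x \<in> C \<Longrightarrow> \<phi> c \<odot>\<^bsub>M\<^esub> x \<in> C"
  shows "ksubspace C"
  using assms unfolding ksubspace_def by blast

lemma ksubspace_carrier: "ksubspace (carrier M)"
  by (rule ksubspaceI) (simp_all add: \<phi>_closed)

lemma ksubspace_zero: "ksubspace {\<zero>\<^bsub>M\<^esub>}"
  by (rule ksubspaceI) (simp_all add: \<phi>_closed)

lemma vectorspace_V:
  assumes C: "ksubspace C" shows "vectorspace class_ring (V C)"
proof -
  note Cc = ksubspaceD(1)[OF C]
  have "Module.module class_ring (V C)"
  proof (rule module_criteria)
    show "cring (class_ring :: 'k ring)" by (rule class_cring.is_cring)
    show "\<forall>x\<in>carrier (V C). \<exists>y\<in>carrier (V C). x \<oplus>\<^bsub>V C\<^esub> y = \<zero>\<^bsub>V C\<^esub>"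
    proof
      fix x assume x: "x \<in> carrier (V C)"
      then have xM: "x \<in> carrier M" using Cc by simp
      have "\<phi> (-1) \<odot>\<^bsub>M\<^esub> x \<in> C" using x ksubspaceD(4)[OF C] by simp
      moreover have "x \<oplus>\<^bsub>M\<^esub> \<phi> (-1) \<odot>\<^bsub>M\<^esub> x = \<phi> (1 + (-1)) \<odot>\<^bsub>M\<^esub> x"
        unfolding \<phi>_add using xM by (simp add: M.smult_l_distr \<phi>_closed \<phi>_one)
      moreover have "\<phi> 0 = \<zero>"
        using \<phi>_add[of 0 0] \<phi>_closed[of 0] M.R.add.l_cancel_one by simp
      ultimately show "\<exists>y\<in>carrier (V C). x \<oplus>\<^bsub>V C\<^esub> y = \<zero>\<^bsub>V C\<^esub>"
        using xM by (intro bexI[of _ "\<phi> (-1) \<odot>\<^bsub>M\<^esub> x"]) simp_all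
    qed
  qed (use C Cc in \<open>simp_all add: ksubspaceD \<phi>_closed \<phi>_add \<phi>_mult \<phi>_one M.smult_l_distr
        M.smult_r_distr M.smult_assoc1 M.M.a_ac\<close>)
  then show ?thesis by (intro vectorspace.intro class_field)
qed

lemma submodule_V_iff:
  assumes C: "ksubspace C"
  shows "LinearCombinations.submodule class_ring D (V C) \<longleftrightarrow> ksubspace D \<and> D \<subseteq> C"
proof -
  have "Module.module class_ring (V C)" using vectorspace_V[OF C] by (rule vectorspace.axioms)
  then show ?thesis
    using ksubspaceD(1)[OF C]
    unfolding LinearCombinations.submodule_def ksubspace_def by auto
qed

text \<open>In the last clause \<open>D\<close> may reach outside \<open>C\<close>; minimality of
  the span is then applied to \<open>D \<inter> C\<close>.\<close>

lemma span_V: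
  assumes C: "ksubspace C" and A: "A \<subseteq> C"
  shows "ksubspace (LinearCombinations.module.span class_ring (V C) A)"
    "LinearCombinations.module.span class_ring (V C) A \<subseteq> C"
    "A \<subseteq> LinearCombinations.module.span class_ring (V C) A"
    "ksubspace D \<Longrightarrow> A \<subseteq> D \<Longrightarrow> LinearCombinations.module.span class_ring (V C) A \<subseteq> D"
proof -
  interpret VC: vectorspace class_ring "V C" by (rule vectorspace_V[OF C])
  have A': "A \<subseteq> carrier (V C)" using A by simp
  show *: "ksubspace (LinearCombinations.module.span class_ring (V C) A)"
    "LinearCombinations.module.span class_ring (V C) A \<subseteq> C"
    using VC.span_is_submodule[OF A'] unfolding submodule_V_iff[OF C] by blast+
  show "A \<subseteq> LinearCombinations.module.span class_ring (V C) A"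
    by (rule VC.in_own_span[OF A'])
  assume D: "ksubspace D" "A \<subseteq> D"
  have "ksubspace (D \<inter> C)" using D(1) C unfolding ksubspace_def by blast
  then have "LinearCombinations.submodule class_ring (D \<inter> C) (V C)"
    unfolding submodule_V_iff[OF C] by blast
  then have "LinearCombinations.module.span class_ring (V C) A \<subseteq> D \<inter> C"
    using A D(2) by (intro VC.span_is_subset) blast+
  then show "LinearCombinations.module.span class_ring (V C) A \<subseteq> D" by blast
qed

lemmas kspan = span_V[OF ksubspace_carrier]

text \<open>Spanning is phrased through subspaces rather than linear combinations, so that it passes
  to images under multiplication by taking preimages of subspaces.\<close>

definition generates :: "'a set \<Rightarrow> 'a set \<Rightarrow> bool" where
  "generates A C \<longleftrightarrow> A \<subseteq> C \<and> (\<forall>D. ksubspace D \<longrightarrow> A \<subseteq> D \<longrightarrow> C \<subseteq> D)"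

lemma generatesD: "generates A C \<Longrightarrow> A \<subseteq> C"
  "generates A C \<Longrightarrow> ksubspace D \<Longrightarrow> A \<subseteq> D \<Longrightarrow> C \<subseteq> D"
  unfolding generates_def by blast+

lemma gen_set_iff:
  assumes C: "ksubspace C" and A: "A \<subseteq> C"
  shows "LinearCombinations.module.span class_ring (V C) A = C \<longleftrightarrow> generates A C"
proof
  assume "LinearCombinations.module.span class_ring (V C) A = C"
  then show "generates A C" using span_V(4)[OF C A] A unfolding generates_def by simp
next
  assume "generates A C"
  then show "LinearCombinations.module.span class_ring (V C) A = C"
    using span_V(1-3)[OF C A] generatesD(2) by (metis subset_antisym)
qed

lemma dim_V:
  assumes C: "ksubspace C"
  shows "vectorspace.dim class_ring (V C) = (LEAST n. \<exists>A. finite A \<and> card A = n \<and> generates A C)"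
proof -
  interpret VC: vectorspace class_ring "V C" by (rule vectorspace_V[OF C])
  have "(finite A \<and> card A = n \<and> A \<subseteq> carrier (V C) \<and>
      LinearCombinations.module.span class_ring (V C) A = carrier (V C)) \<longleftrightarrow>
    (finite A \<and> card A = n \<and> generates A C)" for A n
    using gen_set_iff[OF C, of A] generatesD(1)[of A C] by auto
  then show ?thesis unfolding VC.dim_def by simp
qed

lemma dim_le:
  assumes "ksubspace C" "finite A" "generates A C"
  shows "vectorspace.dim class_ring (V C) \<le> card A"
  unfolding dim_V[OF assms(1)] using assms(2,3) by (intro Least_le) blast

text \<open>The finite generating set \<open>A\<close> guarantees that the least cardinality
  defining the dimension ranges over a nonempty set and is therefore attained.\<close>

lemma dim_attained:
  assumes "ksubspace C" "finite A" "generates A C"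
  obtains B where "finite B" "generates B C" "card B = vectorspace.dim class_ring (V C)"
proof -
  have "\<exists>B. finite B \<and> card B = (LEAST n. \<exists>A. finite A \<and> card A = n \<and> generates A C) \<and> generates B C"
    by (rule LeastI[where k = "card A"]) (use assms in blast)
  then show thesis using that unfolding dim_V[OF assms(1)] by blast
qed

lemma dim_zero:
  assumes "C = {\<zero>\<^bsub>M\<^esub>}" shows "vectorspace.dim class_ring (V C) = 0"
proof -
  have "generates {} C" unfolding generates_def assms using ksubspaceD(2) by blast
  then show ?thesis using dim_le[of C "{}"] ksubspace_zero assms by simp
qed

lemma dim_pos:
  assumes "ksubspace C" "finite A" "generates A C" and x: "x \<in> C" "x \<noteq> \<zero>\<^bsub>M\<^esub>"
  shows "vectorspace.dim class_ring (V C) > 0"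
proof (rule ccontr)
  assume *: "\<not> ?thesis"
  obtain B where B: "finite B" "generates B C" "card B = vectorspace.dim class_ring (V C)"
    using dim_attained[OF assms(1-3)] .
  then have "generates {} C" using * by simp
  then have "C \<subseteq> {\<zero>\<^bsub>M\<^esub>}" using ksubspace_zero generatesD(2) by blast
  then show False using x by blast
qed

lemma ksubspace_preimage:
  assumes D: "ksubspace D" and r: "r \<in> carrier R"
  shows "ksubspace {z \<in> carrier M. r \<odot>\<^bsub>M\<^esub> z \<in> D}"
proof (rule ksubspaceI)
  fix c x assume x: "x \<in> {z \<in> carrier M. r \<odot>\<^bsub>M\<^esub> z \<in> D}"
  then have "\<phi> c \<odot>\<^bsub>M\<^esub> (r \<odot>\<^bsub>M\<^esub> x) \<in> D" using ksubspaceD(4)[OF D] by simp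
  also have "\<phi> c \<odot>\<^bsub>M\<^esub> (r \<odot>\<^bsub>M\<^esub> x) = (r \<otimes> \<phi> c) \<odot>\<^bsub>M\<^esub> x"
    using x r \<phi>_closed[of c] by (simp add: M.smult_assoc1[symmetric] M.R.m_comm)
  also have "\<dots> = r \<odot>\<^bsub>M\<^esub> (\<phi> c \<odot>\<^bsub>M\<^esub> x)" using x r by (simp add: M.smult_assoc1 \<phi>_closed)
  finally show "\<phi> c \<odot>\<^bsub>M\<^esub> x \<in> {z \<in> carrier M. r \<odot>\<^bsub>M\<^esub> z \<in> D}" using x \<phi>_closed by simp
qed (use D r in \<open>simp_all add: ksubspaceD M.smult_r_distr\<close>)

lemma ksubspace_image:
  assumes D: "ksubspace D" and r: "r \<in> carrier R"
  shows "ksubspace ((\<lambda>z. r \<odot>\<^bsub>M\<^esub> z) ` D)"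
proof (rule ksubspaceI)
  note Dc = ksubspaceD(1)[OF D]
  fix x assume "x \<in> (\<lambda>z. r \<odot>\<^bsub>M\<^esub> z) ` D"
  then obtain z where z: "z \<in> D" "x = r \<odot>\<^bsub>M\<^esub> z" by blast
  then show "x \<in> carrier M" using r Dc by simp
  have "\<phi> c \<odot>\<^bsub>M\<^esub> x = r \<odot>\<^bsub>M\<^esub> (\<phi> c \<odot>\<^bsub>M\<^esub> z)" for c
    unfolding z(2) using Dc[OF z(1)] r \<phi>_closed[of c] by (simp add: M.smult_assoc1[symmetric] M.R.m_comm)
  then show "\<phi> c \<odot>\<^bsub>M\<^esub> x \<in> (\<lambda>z. r \<odot>\<^bsub>M\<^esub> z) ` D" for c
    using ksubspaceD(4)[OF D z(1)] by blast
  fix y assume "y \<in> (\<lambda>z. r \<odot>\<^bsub>M\<^esub> z) ` D"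
  then obtain z' where z': "z' \<in> D" "y = r \<odot>\<^bsub>M\<^esub> z'" by blast
  have "x \<oplus>\<^bsub>M\<^esub> y = r \<odot>\<^bsub>M\<^esub> (z \<oplus>\<^bsub>M\<^esub> z')"
    using z z' Dc r by (simp add: M.smult_r_distr)
  then show "x \<oplus>\<^bsub>M\<^esub> y \<in> (\<lambda>z. r \<odot>\<^bsub>M\<^esub> z) ` D" using ksubspaceD(3)[OF D z(1) z'(1)] by blast
next
  show "\<zero>\<^bsub>M\<^esub> \<in> (\<lambda>z. r \<odot>\<^bsub>M\<^esub> z) ` D"
    using M.rmult_0[OF r] ksubspaceD(2)[OF D] by (metis image_eqI)
qed

text \<open>The image of a smallest generating set of \<open>C\<close> generates \<open>C'\<close>:
  the preimage of a subspace containing this image contains the generators, hence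
  \<open>C\<close>.\<close>

lemma dim_image_le:
  assumes C: "ksubspace C" and C': "ksubspace C'" and A: "finite A" "generates A C"
    and r: "r \<in> carrier R" and eq: "C' = (\<lambda>z. r \<odot>\<^bsub>M\<^esub> z) ` C"
  shows "vectorspace.dim class_ring (V C') \<le> vectorspace.dim class_ring (V C)"
proof -
  obtain B where B: "finite B" "generates B C" "card B = vectorspace.dim class_ring (V C)"
    using dim_attained[OF C A] .
  have "generates ((\<lambda>z. r \<odot>\<^bsub>M\<^esub> z) ` B) C'"
    unfolding generates_def
  proof (intro conjI allI impI)
    show "(\<lambda>z. r \<odot>\<^bsub>M\<^esub> z) ` B \<subseteq> C'" using generatesD(1)[OF B(2)] eq by blast
    fix D assume D: "ksubspace D" "(\<lambda>z. r \<odot>\<^bsub>M\<^esub> z) ` B \<subseteq> D"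
    have "B \<subseteq> {z \<in> carrier M. r \<odot>\<^bsub>M\<^esub> z \<in> D}"
      using D(2) generatesD(1)[OF B(2)] ksubspaceD(1)[OF C] by blast
    from generatesD(2)[OF B(2) ksubspace_preimage[OF D(1) r] this]
    show "C' \<subseteq> D" unfolding eq by blast
  qed
  from dim_le[OF C' _ this] B(1,3) card_image_le[OF B(1), of "\<lambda>z. r \<odot>\<^bsub>M\<^esub> z"]
  show ?thesis by simp
qed

end

section \<open>Differential forms of a quotient of the polynomial ring\<close>

definition monoms :: "nat \<Rightarrow> nat \<Rightarrow> (nat \<Rightarrow>\<^sub>0 nat) set" where
  "monoms n e = {t. Poly_Mapping.keys t \<subseteq> {..n} \<and> mdeg t = e}"

text \<open>A monomial is determined by the list of its \<open>n + 1\<close> exponents, each of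
  which is at most the degree.\<close>

lemma finite_monoms: "finite (monoms n e)"
proof (rule finite_imageD)
  let ?f = "\<lambda>t. map (Poly_Mapping.lookup t) [0..<Suc n]"
  have "?f ` monoms n e \<subseteq> {xs. set xs \<subseteq> {..e} \<and> length xs = Suc n}"
  proof (clarsimp simp del: upt_Suc simp: monoms_def)
    fix t :: "nat \<Rightarrow>\<^sub>0 nat" and i assume t: "Poly_Mapping.keys t \<subseteq> {..n}" and i: "i < Suc n"
    show "Poly_Mapping.lookup t i \<le> mdeg t"
      using mdeg_superset[OF _ t] i member_le_sum[of i "{..n}" "Poly_Mapping.lookup t"] by simp
  qed
  then show "finite (?f ` monoms n e)"
    by (rule finite_subset) (rule finite_lists_length_eq, simp)
  show "inj_on ?f (monoms n e)"
  proof (rule inj_onI, rule poly_mapping_eqI)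
    fix s t i assume st: "s \<in> monoms n e" "t \<in> monoms n e" and eq: "?f s = ?f t"
    show "Poly_Mapping.lookup s i = Poly_Mapping.lookup t i"
    proof (cases "i < Suc n")
      case True
      then have "?f s ! i = ?f t ! i" by (simp only: eq)
      then show ?thesis using True by (simp del: upt_Suc)
    next
      case False
      then have "i \<notin> Poly_Mapping.keys s" "i \<notin> Poly_Mapping.keys t"
        using st by (auto simp: monoms_def)
      then show ?thesis by (simp add: in_keys_iff)
    qed
  qed
qed

locale graded_quotient =
  fixes n :: nat and I :: "'k::field mpoly set"
  assumes ideal_I: "ideal I (poly_ring n)"
begin

abbreviation "A \<equiv> coord_ring n I"
abbreviation "\<pi> f \<equiv> I +>\<^bsub>poly_ring n\<^esub> f"
abbreviation "\<phi> \<equiv> coord_ring_const n I"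
abbreviation "\<Omega>1 \<equiv> Omega1 n I"
abbreviation "d \<equiv> kaehler_d class_ring \<phi> A"
abbreviation "x i \<equiv> \<pi> (indet i)"
abbreviation "hcomp \<equiv> coord_ring_comp n I"

lemma carrier_A: "carrier A = \<pi> ` S n"
  by (auto simp: coord_ring_def FactRing_def A_RCOSETS_def')

lemma \<pi>_closed: "f \<in> S n \<Longrightarrow> \<pi> f \<in> carrier A"
  unfolding carrier_A by blast

lemma \<pi>_hom: "\<pi> \<in> Ring.ring_hom (poly_ring n) A"
  unfolding coord_ring_def by (rule ideal.rcos_ring_hom[OF ideal_I])

lemma \<pi>_add: "f \<in> S n \<Longrightarrow> g \<in> S n \<Longrightarrow> \<pi> (f + g) = \<pi> f \<oplus>\<^bsub>A\<^esub> \<pi> g"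
  using ring_hom_add[OF \<pi>_hom, of f g] by simp

lemma \<pi>_mult: "f \<in> S n \<Longrightarrow> g \<in> S n \<Longrightarrow> \<pi> (f * g) = \<pi> f \<otimes>\<^bsub>A\<^esub> \<pi> g"
  using ring_hom_mult[OF \<pi>_hom, of f g] by simp

lemma \<pi>_one: "\<pi> 1 = \<one>\<^bsub>A\<^esub>"
  using ring_hom_one[OF \<pi>_hom] by simp

lemma \<pi>_eq_iff: "f \<in> S n \<Longrightarrow> g \<in> S n \<Longrightarrow> \<pi> f = \<pi> g \<longleftrightarrow> f - g \<in> I"
  using ring.quotient_eq_iff_same_a_r_cos[OF cring.axioms(1)[OF cring_poly_ring] ideal_I, of f g]
  by (simp add: a_minus_poly_ring)

lemma \<phi>_eq: "\<phi> c = \<pi> (const c)"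
  by (simp add: coord_ring_const_def)

lemma const_simps: "const (a + b) = const a + const b" "const (a * b) = const a * const b"
  "const 1 = 1" "const 0 = 0"
  by (simp_all add: const_def single_add mult_single)

sublocale A: cring A
  unfolding coord_ring_def by (rule ideal.quotient_is_cring[OF ideal_I cring_poly_ring])

lemma \<pi>_zero: "\<pi> 0 = \<zero>\<^bsub>A\<^esub>"
  using \<pi>_add[OF S_zero S_zero] A.add.l_cancel_one[OF \<pi>_closed[OF S_zero] \<pi>_closed[OF S_zero]] by simp

sublocale Kae: kaehler A class_ring \<phi>
  by unfold_locales (simp add: \<phi>_eq \<pi>_closed S_const)

lemma \<Omega>1_eq: "kaehler_module class_ring \<phi> A = \<Omega>1"
  by (simp add: Omega1_def)

lemmas d_closed = Kae.d_closed[unfolded \<Omega>1_eq]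
  and d_add = Kae.d_add[unfolded \<Omega>1_eq]
  and d_mult = Kae.d_mult[unfolded \<Omega>1_eq]

lemma d_const: "d (\<phi> c) = \<zero>\<^bsub>\<Omega>1\<^esub>"
  using Kae.d_const[of c, unfolded \<Omega>1_eq] by simp

sublocale O1: scalar_restriction A \<Omega>1 \<phi>
proof (intro scalar_restriction.intro scalar_restriction_axioms.intro)
  show "Module.module A \<Omega>1" using Kae.module_K unfolding \<Omega>1_eq .
qed (simp_all add: \<phi>_eq \<pi>_closed S_const const_simps \<pi>_add \<pi>_mult \<pi>_one)

lemma x_closed: "i \<le> n \<Longrightarrow> x i \<in> carrier A"
  by (intro \<pi>_closed S_indet)

lemma dx_closed: "i \<le> n \<Longrightarrow> d (x i) \<in> carrier \<Omega>1"
  by (intro d_closed x_closed)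

lemma hcomp_iff: "a \<in> hcomp e \<longleftrightarrow> (\<exists>f\<in>S n. homogeneous e f \<and> a = \<pi> f)"
  unfolding coord_ring_comp_def by blast

lemma hcomp_closed: "a \<in> hcomp e \<Longrightarrow> a \<in> carrier A"
  unfolding hcomp_iff using \<pi>_closed by blast

section \<open>Graded pieces of the module of differentials\<close>

definition gens :: "nat \<Rightarrow> _ set" where
  "gens e = {a \<odot>\<^bsub>\<Omega>1\<^esub> d (x i) |a i e'. i \<le> n \<and> e' + 1 = e \<and> a \<in> hcomp e'}"

lemma Omega1_comp_eq: "Omega1_comp n I e = O1.kspan (gens e)"
  by (simp add: Omega1_comp_def gens_def)

lemma gens_closed: "gens e \<subseteq> carrier \<Omega>1"
proof
  fix w assume "w \<in> gens e"
  then obtain a i e' where "i \<le> n" "a \<in> hcomp e'" "w = a \<odot>\<^bsub>\<Omega>1\<^esub> d (x i)"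
    unfolding gens_def by blast
  then show "w \<in> carrier \<Omega>1" using O1.M.smult_closed[OF hcomp_closed dx_closed] by simp
qed

lemma ksubspace_Omega1_comp: "O1.ksubspace (Omega1_comp n I e)"
  unfolding Omega1_comp_eq by (rule O1.kspan(1)[OF gens_closed])

lemma Omega1_comp_closed: "w \<in> Omega1_comp n I e \<Longrightarrow> w \<in> carrier \<Omega>1"
  by (rule O1.ksubspaceD(1)[OF ksubspace_Omega1_comp])

lemma Omega1_comp_induct:
  assumes "O1.ksubspace D"
    and "\<And>f i e'. f \<in> S n \<Longrightarrow> homogeneous e' f \<Longrightarrow> i \<le> n \<Longrightarrow> e = Suc e' \<Longrightarrow> \<pi> f \<odot>\<^bsub>\<Omega>1\<^esub> d (x i) \<in> D"
  shows "Omega1_comp n I e \<subseteq> D"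
  unfolding Omega1_comp_eq
proof (rule O1.kspan(4)[OF gens_closed assms(1)])
  show "gens e \<subseteq> D"
  proof
    fix w assume "w \<in> gens e"
    then obtain a i e' where w: "i \<le> n" "e' + 1 = e" "a \<in> hcomp e'" "w = a \<odot>\<^bsub>\<Omega>1\<^esub> d (x i)"
      unfolding gens_def by blast
    obtain f where "f \<in> S n" "homogeneous e' f" "a = \<pi> f" using w(3) unfolding hcomp_iff by blast
    then show "w \<in> D" using assms(2)[of f e' i] w by simp
  qed
qed

lemma Omega1_comp_gen:
  assumes "f \<in> S n" "homogeneous e f" "i \<le> n"
  shows "\<pi> f \<odot>\<^bsub>\<Omega>1\<^esub> d (x i) \<in> Omega1_comp n I (Suc e)"
proof -
  have "\<pi> f \<odot>\<^bsub>\<Omega>1\<^esub> d (x i) \<in> gens (Suc e)" using assms unfolding gens_def hcomp_iff by auto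
  then show ?thesis unfolding Omega1_comp_eq using O1.kspan(3)[OF gens_closed] by blast
qed

text \<open>For \<open>e = 0\<close> there are no generators, since \<open>dx_i\<close> already has
  degree 1; the case split keeps the truncated \<open>e - 1\<close> from admitting coefficients of
  degree 0 there.\<close>

definition mono_gens :: "nat \<Rightarrow> _ set" where
  "mono_gens e = (\<lambda>(t, i). \<pi> (Poly_Mapping.single t 1) \<odot>\<^bsub>\<Omega>1\<^esub> d (x i)) `
     ((if e = 0 then {} else monoms n (e - 1)) \<times> {..n})"

lemma finite_mono_gens: "finite (mono_gens e)"
  unfolding mono_gens_def by (simp add: finite_monoms)

lemma mono_gens_subset: "mono_gens e \<subseteq> Omega1_comp n I e"
proof
  fix w assume "w \<in> mono_gens e"
  then obtain t i e' where t: "t \<in> monoms n e'" "e = Suc e'" "i \<le> n"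
      "w = \<pi> (Poly_Mapping.single t 1) \<odot>\<^bsub>\<Omega>1\<^esub> d (x i)"
    unfolding mono_gens_def by (cases e) auto
  have "Poly_Mapping.single t 1 \<in> S n" "homogeneous e' (Poly_Mapping.single t (1::'k))"
    using t(1) by (auto simp: monoms_def intro: S_single homogeneous_single)
  then show "w \<in> Omega1_comp n I e" unfolding t(2,4) by (intro Omega1_comp_gen t(3))
qed

text \<open>A homogeneous coefficient is a combination of monomials of the same degree, and its
  constants act through \<open>\<phi>\<close>, under which a subspace is closed.\<close>

lemma generates_mono_gens: "O1.generates (mono_gens e) (Omega1_comp n I e)"
  unfolding O1.generates_def
proof (intro conjI mono_gens_subset allI impI)
  fix D assume D: "O1.ksubspace D" "mono_gens e \<subseteq> D"
  show "Omega1_comp n I e \<subseteq> D"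
  proof (rule Omega1_comp_induct[OF D(1)])
    fix f :: "'k mpoly" and i e' assume f: "f \<in> S n" "homogeneous e' f" and i: "i \<le> n" and e: "e = Suc e'"
    let ?m = "\<lambda>t. Poly_Mapping.single t (Poly_Mapping.lookup f t)"
    have mon: "\<pi> (?m t) \<odot>\<^bsub>\<Omega>1\<^esub> d (x i) \<in> D \<and> ?m t \<in> S n" if t: "t \<in> Poly_Mapping.keys f" for t
    proof -
      have tm: "t \<in> monoms n e'" using f t by (auto simp: monoms_def S_iff homogeneous_iff)
      then have S1: "Poly_Mapping.single t 1 \<in> S n" by (simp add: monoms_def S_single)
      have "\<pi> (Poly_Mapping.single t 1) \<odot>\<^bsub>\<Omega>1\<^esub> d (x i) \<in> D"
        using D(2) tm i e unfolding mono_gens_def by auto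
      from O1.ksubspaceD(4)[OF D(1) this]
      have "\<phi> (Poly_Mapping.lookup f t) \<odot>\<^bsub>\<Omega>1\<^esub> (\<pi> (Poly_Mapping.single t 1) \<odot>\<^bsub>\<Omega>1\<^esub> d (x i)) \<in> D" .
      moreover have "?m t = const (Poly_Mapping.lookup f t) * Poly_Mapping.single t 1"
        by (simp add: const_def mult_single)
      ultimately show ?thesis
        using O1.M.smult_assoc1[OF \<pi>_closed[OF S_const] \<pi>_closed[OF S1] dx_closed[OF i]]
          \<pi>_mult[OF S_const S1] S_mult[OF S_const S1] by (simp add: \<phi>_eq)
    qed
    have "\<pi> (sum ?m B) \<odot>\<^bsub>\<Omega>1\<^esub> d (x i) \<in> D \<and> sum ?m B \<in> S n" if "finite B" "B \<subseteq> Poly_Mapping.keys f" for B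
      using that
    proof (induction B rule: finite_induct)
      case empty
      then show ?case
        using O1.M.lmult_0[OF dx_closed[OF i]] O1.ksubspaceD(2)[OF D(1)] by (simp add: \<pi>_zero S_zero)
    next
      case (insert t B)
      then have h: "\<pi> (sum ?m B) \<odot>\<^bsub>\<Omega>1\<^esub> d (x i) \<in> D" "sum ?m B \<in> S n"
        "\<pi> (?m t) \<odot>\<^bsub>\<Omega>1\<^esub> d (x i) \<in> D" "?m t \<in> S n"
        using mon[of t] by auto
      have "\<pi> (?m t + sum ?m B) \<odot>\<^bsub>\<Omega>1\<^esub> d (x i) =
        \<pi> (?m t) \<odot>\<^bsub>\<Omega>1\<^esub> d (x i) \<oplus>\<^bsub>\<Omega>1\<^esub> \<pi> (sum ?m B) \<odot>\<^bsub>\<Omega>1\<^esub> d (x i)"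
        unfolding \<pi>_add[OF h(4,2)]
        by (rule O1.M.smult_l_distr[OF \<pi>_closed[OF h(4)] \<pi>_closed[OF h(2)] dx_closed[OF i]])
      then show ?case
        using O1.ksubspaceD(3)[OF D(1) h(3,1)] S_add[OF h(4,2)] insert.hyps by simp
    qed
    from this[of "Poly_Mapping.keys f"] show "\<pi> f \<odot>\<^bsub>\<Omega>1\<^esub> d (x i) \<in> D"
      using poly_mapping_sum_single[of f] by simp
  qed
qed

lemma Omega1_comp_mult:
  assumes b: "b \<in> hcomp e'" and w: "w \<in> Omega1_comp n I e"
  shows "b \<odot>\<^bsub>\<Omega>1\<^esub> w \<in> Omega1_comp n I (e' + e)"
proof -
  obtain g where g: "g \<in> S n" "homogeneous e' g" "b = \<pi> g" using b unfolding hcomp_iff by blast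
  have "Omega1_comp n I e \<subseteq> {w \<in> carrier \<Omega>1. b \<odot>\<^bsub>\<Omega>1\<^esub> w \<in> Omega1_comp n I (e' + e)}"
  proof (rule Omega1_comp_induct[OF O1.ksubspace_preimage[OF ksubspace_Omega1_comp hcomp_closed[OF b]]])
    fix f :: "'k mpoly" and i e'' assume f: "f \<in> S n" "homogeneous e'' f" and i: "i \<le> n" and e: "e = Suc e''"
    have "b \<odot>\<^bsub>\<Omega>1\<^esub> (\<pi> f \<odot>\<^bsub>\<Omega>1\<^esub> d (x i)) = \<pi> (g * f) \<odot>\<^bsub>\<Omega>1\<^esub> d (x i)"
      unfolding g(3) \<pi>_mult[OF g(1) f(1)]
      by (rule O1.M.smult_assoc1[OF \<pi>_closed[OF g(1)] \<pi>_closed[OF f(1)] dx_closed[OF i], symmetric])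
    also have "\<dots> \<in> Omega1_comp n I (e' + e)"
      using Omega1_comp_gen[OF S_mult[OF g(1) f(1)] homogeneous_mult[OF g(2) f(2)] i] e by simp
    finally show "\<pi> f \<odot>\<^bsub>\<Omega>1\<^esub> d (x i) \<in> {w \<in> carrier \<Omega>1. b \<odot>\<^bsub>\<Omega>1\<^esub> w \<in> Omega1_comp n I (e' + e)}"
      using O1.M.smult_closed[OF \<pi>_closed[OF f(1)] dx_closed[OF i]] by blast
  qed
  then show ?thesis using w by blast
qed

text \<open>The bound exceeds \<open>e0\<close> by one because a form of degree \<open>Suc e\<close>
  has coefficients of degree \<open>e\<close>, and these must be of the form \<open>Suc e''\<close>
  with \<open>e0 \<le> e''\<close> for \<open>red\<close> to apply.\<close>

lemma Omega1_comp_reduce: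
  assumes red: "\<And>e f. e0 \<le> e \<Longrightarrow> f \<in> S n \<Longrightarrow> homogeneous (Suc e) f \<Longrightarrow>
      \<exists>g\<in>S n. homogeneous e g \<and> f - indet 0 * g \<in> I"
    and e: "Suc e0 \<le> e" and w: "w \<in> Omega1_comp n I (Suc e)"
  obtains w' where "w' \<in> Omega1_comp n I e" "w = x 0 \<odot>\<^bsub>\<Omega>1\<^esub> w'"
proof -
  have "Omega1_comp n I (Suc e) \<subseteq> (\<lambda>w. x 0 \<odot>\<^bsub>\<Omega>1\<^esub> w) ` Omega1_comp n I e"
  proof (rule Omega1_comp_induct[OF O1.ksubspace_image[OF ksubspace_Omega1_comp x_closed]])
    fix f :: "'k mpoly" and i e' assume f: "f \<in> S n" "homogeneous e' f" and i: "i \<le> n" and e': "Suc e = Suc e'"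
    obtain e'' where e'': "e = Suc e''" using e by (cases e) auto
    then obtain g where g: "g \<in> S n" "homogeneous e'' g" "f - indet 0 * g \<in> I"
      using red[of e'' f] e e' f by auto
    have S0: "indet 0 \<in> S n" by (simp add: S_indet)
    have "\<pi> f = \<pi> (indet 0 * g)" using g(3) \<pi>_eq_iff[OF f(1) S_mult[OF S0 g(1)]] by simp
    then have "\<pi> f \<odot>\<^bsub>\<Omega>1\<^esub> d (x i) = x 0 \<odot>\<^bsub>\<Omega>1\<^esub> (\<pi> g \<odot>\<^bsub>\<Omega>1\<^esub> d (x i))"
      using O1.M.smult_assoc1[OF \<pi>_closed[OF S0] \<pi>_closed[OF g(1)] dx_closed[OF i]]
        \<pi>_mult[OF S0 g(1)] by simp
    then show "\<pi> f \<odot>\<^bsub>\<Omega>1\<^esub> d (x i) \<in> (\<lambda>w. x 0 \<odot>\<^bsub>\<Omega>1\<^esub> w) ` Omega1_comp n I e"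
      using Omega1_comp_gen[OF g(1,2) i] unfolding e'' by blast
  qed simp
  then show thesis using w that by blast
qed

text \<open>If \<open>f\<close> kills \<open>x\<^sub>j - c x\<^sub>0\<close>, then \<open>0 = f d(f (x\<^sub>j - c x\<^sub>0)) = f\<^sup>2 d(x\<^sub>j - c x\<^sub>0)\<close>.\<close>

lemma square_kills_differential:
  assumes f: "f \<in> S n" and j: "j \<le> n" and fl: "f * (indet j - const c * indet 0) \<in> I"
  shows "\<pi> (f ^ 2) \<odot>\<^bsub>\<Omega>1\<^esub> d (x j) = \<pi> (f ^ 2 * const c) \<odot>\<^bsub>\<Omega>1\<^esub> d (x 0)"
proof -
  let ?l = "indet j - const c * indet 0"
  have S0: "indet 0 \<in> S n" and Sc: "const c \<in> S n" and Sl: "?l \<in> S n"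
    using j by (auto intro!: S_diff S_mult simp: S_indet S_const)
  note cl = \<pi>_closed[OF f] \<pi>_closed[OF Sl] \<pi>_closed[OF S0] \<pi>_closed[OF Sc] \<pi>_closed[OF S_power[OF f, of 2]]
  have fl0: "\<pi> f \<otimes>\<^bsub>A\<^esub> \<pi> ?l = \<zero>\<^bsub>A\<^esub>"
    using \<pi>_eq_iff[OF S_mult[OF f Sl] S_zero] fl \<pi>_zero \<pi>_mult[OF f Sl] by simp
  have "\<pi> f \<odot>\<^bsub>\<Omega>1\<^esub> d (\<pi> ?l) \<oplus>\<^bsub>\<Omega>1\<^esub> \<pi> ?l \<odot>\<^bsub>\<Omega>1\<^esub> d (\<pi> f) = \<zero>\<^bsub>\<Omega>1\<^esub>"
    using d_mult[OF cl(1,2)] fl0 d_const[of 0] by (simp add: \<phi>_eq const_simps \<pi>_zero)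
  \<comment> \<open>The second factor \<open>f\<close> turns the unwanted Leibniz term
    \<open>l df\<close> into \<open>(f l) df\<close>, which is zero.\<close>
  then have "\<pi> f \<odot>\<^bsub>\<Omega>1\<^esub> (\<pi> f \<odot>\<^bsub>\<Omega>1\<^esub> d (\<pi> ?l) \<oplus>\<^bsub>\<Omega>1\<^esub> \<pi> ?l \<odot>\<^bsub>\<Omega>1\<^esub> d (\<pi> f)) = \<zero>\<^bsub>\<Omega>1\<^esub>"
    using cl by simp
  then have "(\<pi> f \<otimes>\<^bsub>A\<^esub> \<pi> f) \<odot>\<^bsub>\<Omega>1\<^esub> d (\<pi> ?l) \<oplus>\<^bsub>\<Omega>1\<^esub> (\<pi> f \<otimes>\<^bsub>A\<^esub> \<pi> ?l) \<odot>\<^bsub>\<Omega>1\<^esub> d (\<pi> f) = \<zero>\<^bsub>\<Omega>1\<^esub>"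
    using cl d_closed[OF cl(1)] d_closed[OF cl(2)]
    by (simp add: O1.M.smult_r_distr O1.M.smult_assoc1)
  then have kill: "\<pi> (f ^ 2) \<odot>\<^bsub>\<Omega>1\<^esub> d (\<pi> ?l) = \<zero>\<^bsub>\<Omega>1\<^esub>"
    using fl0 cl d_closed[OF cl(1)] d_closed[OF cl(2)]
    by (simp add: power2_eq_square \<pi>_mult[OF f f])
  have "x j = \<pi> (?l + const c * indet 0)" by simp
  also have "\<dots> = \<pi> ?l \<oplus>\<^bsub>A\<^esub> \<pi> (const c) \<otimes>\<^bsub>A\<^esub> x 0"
    using \<pi>_add[OF Sl S_mult[OF Sc S0]] \<pi>_mult[OF Sc S0] by simp
  finally have "d (x j) = d (\<pi> ?l) \<oplus>\<^bsub>\<Omega>1\<^esub> d (\<pi> (const c) \<otimes>\<^bsub>A\<^esub> x 0)"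
    using d_add[OF cl(2) A.m_closed[OF cl(4,3)]] by simp
  also have "d (\<pi> (const c) \<otimes>\<^bsub>A\<^esub> x 0) = \<pi> (const c) \<odot>\<^bsub>\<Omega>1\<^esub> d (x 0)"
    using d_mult[OF cl(4,3)] d_const[of c] cl d_closed[OF cl(3)] by (simp add: \<phi>_eq)
  finally have "\<pi> (f ^ 2) \<odot>\<^bsub>\<Omega>1\<^esub> d (x j) =
      \<pi> (f ^ 2) \<odot>\<^bsub>\<Omega>1\<^esub> d (\<pi> ?l) \<oplus>\<^bsub>\<Omega>1\<^esub> \<pi> (f ^ 2) \<odot>\<^bsub>\<Omega>1\<^esub> (\<pi> (const c) \<odot>\<^bsub>\<Omega>1\<^esub> d (x 0))"
    using cl d_closed[OF cl(2)] d_closed[OF cl(3)] by (simp add: O1.M.smult_r_distr)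
  also have "\<dots> = \<pi> (f ^ 2 * const c) \<odot>\<^bsub>\<Omega>1\<^esub> d (x 0)"
    using cl d_closed[OF cl(3)] unfolding kill
    by (simp add: O1.M.smult_assoc1 \<pi>_mult[OF S_power[OF f] Sc])
  finally show ?thesis .
qed

text \<open>The multiples of \<open>dx_0\<close> form a subspace, and so do the forms that
  multiplication by the square sends there; hence it suffices to treat the generators
  \<open>g dx_i\<close>.\<close>

lemma square_times_Omega1_comp:
  assumes f: "f \<in> S n" and fl: "\<And>j. j \<le> n \<Longrightarrow> f * (indet j - const (c j) * indet 0) \<in> I"
    and w: "w \<in> Omega1_comp n I e"
  obtains a where "a \<in> carrier A" "\<pi> (f ^ 2) \<odot>\<^bsub>\<Omega>1\<^esub> w = a \<odot>\<^bsub>\<Omega>1\<^esub> d (x 0)"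
proof -
  let ?D = "(\<lambda>a. a \<odot>\<^bsub>\<Omega>1\<^esub> d (x 0)) ` carrier A"
  have dx0: "d (x 0) \<in> carrier \<Omega>1" by (simp add: dx_closed)
  have F: "\<pi> (f ^ 2) \<in> carrier A" by (intro \<pi>_closed S_power f)
  have D: "O1.ksubspace ?D"
  proof (rule O1.ksubspaceI)
    show "\<zero>\<^bsub>\<Omega>1\<^esub> \<in> ?D" by (rule image_eqI[where x = "\<zero>\<^bsub>A\<^esub>"]) (simp_all add: dx0)
    fix z assume "z \<in> ?D"
    then obtain a where a: "a \<in> carrier A" "z = a \<odot>\<^bsub>\<Omega>1\<^esub> d (x 0)" by blast
    show "z \<in> carrier \<Omega>1" unfolding a(2) using a(1) dx0 by (rule O1.M.smult_closed)
    show "\<phi> c \<odot>\<^bsub>\<Omega>1\<^esub> z \<in> ?D" for c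
      unfolding a(2) O1.M.smult_assoc1[OF O1.\<phi>_closed a(1) dx0, symmetric]
      using A.m_closed[OF O1.\<phi>_closed a(1)] by blast
    fix z' assume "z' \<in> ?D"
    then obtain b where b: "b \<in> carrier A" "z' = b \<odot>\<^bsub>\<Omega>1\<^esub> d (x 0)" by blast
    show "z \<oplus>\<^bsub>\<Omega>1\<^esub> z' \<in> ?D"
      unfolding a(2) b(2) O1.M.smult_l_distr[OF a(1) b(1) dx0, symmetric]
      using A.a_closed[OF a(1) b(1)] by blast
  qed
  have "Omega1_comp n I e \<subseteq> {w \<in> carrier \<Omega>1. \<pi> (f ^ 2) \<odot>\<^bsub>\<Omega>1\<^esub> w \<in> ?D}"
  proof (rule Omega1_comp_induct[OF O1.ksubspace_preimage[OF D F]])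
    fix g :: "'k mpoly" and i e' assume g: "g \<in> S n" and i: "i \<le> n"
    have G: "\<pi> g \<in> carrier A" by (rule \<pi>_closed[OF g])
    have C: "\<pi> (f ^ 2 * const (c i)) \<in> carrier A" by (intro \<pi>_closed S_mult S_power f S_const)
    have "\<pi> (f ^ 2) \<odot>\<^bsub>\<Omega>1\<^esub> (\<pi> g \<odot>\<^bsub>\<Omega>1\<^esub> d (x i)) = \<pi> g \<odot>\<^bsub>\<Omega>1\<^esub> (\<pi> (f ^ 2) \<odot>\<^bsub>\<Omega>1\<^esub> d (x i))"
      using F G dx_closed[OF i] by (simp add: O1.M.smult_assoc1[symmetric] A.m_comm)
    also have "\<dots> = \<pi> g \<odot>\<^bsub>\<Omega>1\<^esub> (\<pi> (f ^ 2 * const (c i)) \<odot>\<^bsub>\<Omega>1\<^esub> d (x 0))"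
      unfolding square_kills_differential[OF f i fl[OF i]] ..
    also have "\<dots> = (\<pi> g \<otimes>\<^bsub>A\<^esub> \<pi> (f ^ 2 * const (c i))) \<odot>\<^bsub>\<Omega>1\<^esub> d (x 0)"
      using O1.M.smult_assoc1[OF G C dx0] ..
    finally have "\<pi> (f ^ 2) \<odot>\<^bsub>\<Omega>1\<^esub> (\<pi> g \<odot>\<^bsub>\<Omega>1\<^esub> d (x i)) \<in> ?D" using A.m_closed[OF G C] by blast
    then show "\<pi> g \<odot>\<^bsub>\<Omega>1\<^esub> d (x i) \<in> {w \<in> carrier \<Omega>1. \<pi> (f ^ 2) \<odot>\<^bsub>\<Omega>1\<^esub> w \<in> ?D}"
      using O1.M.smult_closed[OF G dx_closed[OF i]] by blast
  qed
  then show thesis using w that by blast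
qed

end

locale graded_forms = graded_quotient n I for n :: nat and I :: "'k::field mpoly set" +
  fixes k :: nat
begin

abbreviation "\<Omega> \<equiv> Omega n I k"
abbreviation "w \<equiv> wedge A \<Omega>1"
abbreviation "T \<equiv> tuples \<Omega>1 k"

sublocale E: exterior A \<Omega>1 k
  by (rule exterior.intro) (rule O1.M.module_axioms)

lemma \<Omega>_eq: "ext_power A \<Omega>1 k = \<Omega>"
  by (simp add: Omega_def)

lemmas wedge_closed = E.wedge_closed[unfolded \<Omega>_eq]
  and wedge_add = E.wedge_add[unfolded \<Omega>_eq]
  and wedge_smult = E.wedge_smult[unfolded \<Omega>_eq]
  and wedge_alternating = E.wedge_alternating[unfolded \<Omega>_eq]

sublocale W: scalar_restriction A \<Omega> \<phi>
proof (intro scalar_restriction.intro scalar_restriction_axioms.intro)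
  show "Module.module A \<Omega>" using E.module_E unfolding \<Omega>_eq .
qed (rule O1.\<phi>_closed O1.\<phi>_add O1.\<phi>_mult O1.\<phi>_one)+

abbreviation "homogeneous_tuple ws es e \<equiv>
  length ws = k \<and> length es = k \<and> sum_list es = e \<and> (\<forall>i<k. ws ! i \<in> Omega1_comp n I (es ! i))"

lemma homogeneous_tuple_closed: 
  assumes "homogeneous_tuple ws es e" shows "ws \<in> T"
proof -
  have "v \<in> carrier \<Omega>1" if v: "v \<in> set ws" for v
  proof -
    obtain i where "i < k" "v = ws ! i" using v assms by (auto simp: in_set_conv_nth)
    then show ?thesis using assms Omega1_comp_closed by blast
  qed
  then show ?thesis using assms unfolding tuples_def by blast
qed

section \<open>Graded pieces of the exterior powers\<close>

definition wgens :: "nat \<Rightarrow> _ set" where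
  "wgens e = {w ws |ws es. homogeneous_tuple ws es e}"

lemma Omega_comp_eq: "Omega_comp n I k e = W.kspan (wgens e)"
  unfolding Omega_comp_def wgens_def ..

lemma wgens_closed: "wgens e \<subseteq> carrier \<Omega>"
  unfolding wgens_def using wedge_closed[OF homogeneous_tuple_closed] by blast

lemma ksubspace_Omega_comp: "W.ksubspace (Omega_comp n I k e)"
  unfolding Omega_comp_eq by (rule W.kspan(1)[OF wgens_closed])

lemma Omega_comp_closed: "z \<in> Omega_comp n I k e \<Longrightarrow> z \<in> carrier \<Omega>"
  by (rule W.ksubspaceD(1)[OF ksubspace_Omega_comp])

lemma Omega_comp_gen: "homogeneous_tuple ws es e \<Longrightarrow> w ws \<in> Omega_comp n I k e"
  unfolding Omega_comp_eq using W.kspan(3)[OF wgens_closed] unfolding wgens_def by blast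

lemma Omega_comp_induct:
  assumes D: "W.ksubspace D" and gen: "\<And>ws es. homogeneous_tuple ws es e \<Longrightarrow> w ws \<in> D"
  shows "Omega_comp n I k e \<subseteq> D"
  unfolding Omega_comp_eq
proof (rule W.kspan(4)[OF wgens_closed D])
  show "wgens e \<subseteq> D" unfolding wgens_def using gen by blast
qed

text \<open>The wedge is linear in slot \<open>j\<close>. This allows one entry at a time to be
  replaced by generators of its graded piece.\<close>

lemma ksubspace_wedge_slot:
  assumes us: "us \<in> T" and j: "j < k" and D: "W.ksubspace D"
  shows "O1.ksubspace {v \<in> carrier \<Omega>1. w (us[j := v]) \<in> D}"
proof (rule O1.ksubspaceI)
  have z: "\<zero>\<^bsub>\<Omega>1\<^esub> \<in> carrier \<Omega>1" by simp
  \<comment> \<open>The zero entry is written as a scalar multiple so that linearity in the slot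
    extracts the factor 0.\<close>
  have "w (us[j := \<zero>\<^bsub>A\<^esub> \<odot>\<^bsub>\<Omega>1\<^esub> \<zero>\<^bsub>\<Omega>1\<^esub>]) = \<zero>\<^bsub>\<Omega>\<^esub>"
    unfolding wedge_smult[OF us j A.zero_closed z]
    by (rule W.M.lmult_0[OF wedge_closed[OF tuples_update[OF us z]]])
  then show "\<zero>\<^bsub>\<Omega>1\<^esub> \<in> {v \<in> carrier \<Omega>1. w (us[j := v]) \<in> D}"
    using z W.ksubspaceD(2)[OF D] O1.M.lmult_0[OF z] by simp
  fix u assume u: "u \<in> {v \<in> carrier \<Omega>1. w (us[j := v]) \<in> D}"
  then show "u \<in> carrier \<Omega>1" by simp
  show "\<phi> c \<odot>\<^bsub>\<Omega>1\<^esub> u \<in> {v \<in> carrier \<Omega>1. w (us[j := v]) \<in> D}" for c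
    using u wedge_smult[OF us j O1.\<phi>_closed, of u c] W.ksubspaceD(4)[OF D, of "w (us[j := u])" c]
      O1.M.smult_closed[OF O1.\<phi>_closed, of u c] by simp
  fix u' assume u': "u' \<in> {v \<in> carrier \<Omega>1. w (us[j := v]) \<in> D}"
  show "u \<oplus>\<^bsub>\<Omega>1\<^esub> u' \<in> {v \<in> carrier \<Omega>1. w (us[j := v]) \<in> D}"
    using u u' wedge_add[OF us j, of u u'] W.ksubspaceD(3)[OF D, of "w (us[j := u])" "w (us[j := u'])"]
    by simp
qed

text \<open>The first part confines the entries to a finite set, from which finiteness is immediate;
  the second part records the degrees.\<close>

definition mono_tuples :: "nat \<Rightarrow> _ set" where
  "mono_tuples e = {us. (set us \<subseteq> (\<Union>e'\<in>{..e}. mono_gens e') \<and> length us = k) \<and>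
     (\<exists>es. length es = k \<and> sum_list es = e \<and> (\<forall>i<k. us ! i \<in> mono_gens (es ! i)))}"

lemma finite_mono_tuples: "finite (mono_tuples e)"
proof (rule finite_subset)
  show "mono_tuples e \<subseteq> {us. set us \<subseteq> (\<Union>e'\<in>{..e}. mono_gens e') \<and> length us = k}"
    unfolding mono_tuples_def by blast
  show "finite {us. set us \<subseteq> (\<Union>e'\<in>{..e}. mono_gens e') \<and> length us = k}"
    by (rule finite_lists_length_eq) (simp add: finite_mono_gens)
qed

text \<open>Arbitrary homogeneous entries are traded for monomial generators slot by slot, by
  linearity of the wedge in that slot.\<close>

lemma generates_mono_tuples: "W.generates (w ` mono_tuples e) (Omega_comp n I k e)"
  unfolding W.generates_def
proof (intro conjI allI impI)
  show "w ` mono_tuples e \<subseteq> Omega_comp n I k e"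
  proof
    fix z assume "z \<in> w ` mono_tuples e"
    then obtain us es where us: "z = w us" "length us = k" "length es = k" "sum_list es = e"
      "\<forall>i<k. us ! i \<in> mono_gens (es ! i)"
      unfolding mono_tuples_def by blast
    then have "homogeneous_tuple us es e" using mono_gens_subset by blast
    then show "z \<in> Omega_comp n I k e" unfolding us(1) by (rule Omega_comp_gen)
  qed
  fix D assume D: "W.ksubspace D" "w ` mono_tuples e \<subseteq> D"
  show "Omega_comp n I k e \<subseteq> D"
  proof (rule Omega_comp_induct[OF D(1)])
    fix ws es assume ws: "homogeneous_tuple ws es e"
    \<comment> \<open>The induction is on the number \<open>j\<close> of leading slots that may hold
      arbitrary homogeneous forms; all later slots hold monomial generators.\<close>
    have "w us \<in> D" if "j \<le> k" "length us = k" "\<forall>i<j. us ! i \<in> Omega1_comp n I (es ! i)"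
        "\<forall>i<k. j \<le> i \<longrightarrow> us ! i \<in> mono_gens (es ! i)" for j us
      using that
    proof (induction j arbitrary: us)
      case 0
      have "set us \<subseteq> (\<Union>e'\<in>{..e}. mono_gens e')"
      proof
        fix u assume "u \<in> set us"
        then obtain i where i: "i < k" "u = us ! i" using 0 by (auto simp: in_set_conv_nth)
        then have "u \<in> mono_gens (es ! i)" "es ! i \<le> e"
          using 0 ws elem_le_sum_list[of i es] by auto
        then show "u \<in> (\<Union>e'\<in>{..e}. mono_gens e')" by blast
      qed
      then have "us \<in> mono_tuples e" using 0 ws unfolding mono_tuples_def by blast
      then show ?case using D(2) by blast
    next
      case (Suc j)
      have j: "j < k" using Suc.prems by simp
      have all: "us ! i \<in> Omega1_comp n I (es ! i)" if "i < k" for i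
        using Suc.prems that mono_gens_subset by (cases "i < Suc j") (auto simp: not_less)
      then have usT: "us \<in> T"
        using ws Suc.prems(2) homogeneous_tuple_closed[of us es e] by blast
      let ?Z = "{v \<in> carrier \<Omega>1. w (us[j := v]) \<in> D}"
      have "mono_gens (es ! j) \<subseteq> ?Z"
      proof
        fix u assume u: "u \<in> mono_gens (es ! j)"
        then have "u \<in> Omega1_comp n I (es ! j)" using mono_gens_subset by blast
        moreover have "w (us[j := u]) \<in> D"
        proof (rule Suc.IH)
          show "\<forall>i<k. j \<le> i \<longrightarrow> us[j := u] ! i \<in> mono_gens (es ! i)"
          proof (intro allI impI)
            fix i assume "i < k" "j \<le> i"
            then show "us[j := u] ! i \<in> mono_gens (es ! i)"
              using u Suc.prems by (cases "i = j") auto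
          qed
        qed (use Suc.prems in auto)
        ultimately show "u \<in> ?Z" using Omega1_comp_closed by blast
      qed
      then have "Omega1_comp n I (es ! j) \<subseteq> ?Z"
        by (rule O1.generatesD(2)[OF generates_mono_gens ksubspace_wedge_slot[OF usT j D(1)]])
      then have "w (us[j := us ! j]) \<in> D" using all[OF j] by blast
      then show ?case by simp
    qed
    from this[of k ws] show "w ws \<in> D" using ws by auto
  qed
qed

text \<open>The factor \<open>b\<close> is absorbed into slot 0, which exists because
  \<open>k \<ge> 1\<close>; only the degree of that entry increases.\<close>

lemma Omega_comp_mult:
  assumes k: "k \<ge> 1" and b: "b \<in> hcomp e'" and z: "z \<in> Omega_comp n I k e"
  shows "b \<odot>\<^bsub>\<Omega>\<^esub> z \<in> Omega_comp n I k (e' + e)"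
proof -
  have "Omega_comp n I k e \<subseteq> {z \<in> carrier \<Omega>. b \<odot>\<^bsub>\<Omega>\<^esub> z \<in> Omega_comp n I k (e' + e)}"
  proof (rule Omega_comp_induct[OF W.ksubspace_preimage[OF ksubspace_Omega_comp hcomp_closed[OF b]]])
    fix ws es assume ws: "homogeneous_tuple ws es e"
    note wsT = homogeneous_tuple_closed[OF ws]
    have k0: "0 < k" using k by simp
    have "homogeneous_tuple (ws[0 := b \<odot>\<^bsub>\<Omega>1\<^esub> ws ! 0]) (es[0 := e' + es ! 0]) (e' + e)"
    proof (intro conjI allI impI)
      show "sum_list (es[0 := e' + es ! 0]) = e' + e"
        using ws k0 elem_le_sum_list[of 0 es] by (simp add: sum_list_update)
      fix i assume "i < k"
      then show "ws[0 := b \<odot>\<^bsub>\<Omega>1\<^esub> ws ! 0] ! i \<in> Omega1_comp n I (es[0 := e' + es ! 0] ! i)"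
        using ws k0 Omega1_comp_mult[OF b, of "ws ! 0" "es ! 0"] by (cases "i = 0") auto
    qed (use ws in auto)
    from Omega_comp_gen[OF this]
    have "b \<odot>\<^bsub>\<Omega>\<^esub> w ws \<in> Omega_comp n I k (e' + e)"
      using wedge_smult[OF wsT k0 hcomp_closed[OF b] tuples_nth[OF wsT k0]] by simp
    then show "w ws \<in> {z \<in> carrier \<Omega>. b \<odot>\<^bsub>\<Omega>\<^esub> z \<in> Omega_comp n I k (e' + e)}"
      using wedge_closed[OF wsT] by blast
  qed
  then show ?thesis using z by blast
qed

text \<open>If all \<open>k\<close> entries had degree at most \<open>Suc e0\<close>, the total
  degree would be at most \<open>k * Suc e0\<close>, hence less than \<open>Suc e\<close>. So some
  entry has larger degree, and \<open>x 0\<close> is pulled out of that slot.\<close>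

lemma Omega_comp_reduce:
  assumes red: "\<And>e f. e0 \<le> e \<Longrightarrow> f \<in> S n \<Longrightarrow> homogeneous (Suc e) f \<Longrightarrow>
      \<exists>g\<in>S n. homogeneous e g \<and> f - indet 0 * g \<in> I"
    and e: "k * Suc e0 \<le> e"
  shows "Omega_comp n I k (Suc e) \<subseteq> (\<lambda>z. x 0 \<odot>\<^bsub>\<Omega>\<^esub> z) ` Omega_comp n I k e"
proof (rule Omega_comp_induct[OF W.ksubspace_image[OF ksubspace_Omega_comp x_closed]])
  fix ws es assume ws: "homogeneous_tuple ws es (Suc e)"
  note wsT = homogeneous_tuple_closed[OF ws]
  have "\<exists>i<k. Suc e0 < es ! i"
  proof (rule ccontr)
    assume "\<not> ?thesis"
    then have le: "es ! i \<le> Suc e0" if "i \<in> {0..<k}" for i using that by force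
    have "sum_list es = (\<Sum>i\<in>{0..<k}. es ! i)" using ws by (simp add: sum_list_sum_nth)
    also have "\<dots> \<le> k * Suc e0" using sum_bounded_above[of "{0..<k}", OF le] by simp
    finally show False using ws e by simp
  qed
  then obtain i e' where i: "i < k" "es ! i = Suc e'" "Suc e0 \<le> e'"
    by (metis Suc_le_D Suc_le_mono less_imp_le_nat less_Suc_eq_le Suc_lessE)
  have "ws ! i \<in> Omega1_comp n I (Suc e')" using ws i(1,2) by metis
  from Omega1_comp_reduce[OF red i(3) this]
  obtain v where v: "v \<in> Omega1_comp n I e'" "ws ! i = x 0 \<odot>\<^bsub>\<Omega>1\<^esub> v" by blast
  have "homogeneous_tuple (ws[i := v]) (es[i := e']) e"
  proof (intro conjI allI impI)
    show "sum_list (es[i := e']) = e"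
      using ws i by (simp add: sum_list_update)
    fix l assume "l < k"
    then show "ws[i := v] ! l \<in> Omega1_comp n I (es[i := e'] ! l)"
      using ws i v(1) by (cases "l = i") auto
  qed (use ws in auto)
  from Omega_comp_gen[OF this]
  have "w (ws[i := v]) \<in> Omega_comp n I k e" .
  moreover have "w ws = x 0 \<odot>\<^bsub>\<Omega>\<^esub> w (ws[i := v])"
    using wedge_smult[OF wsT i(1) x_closed[of 0] Omega1_comp_closed[OF v(1)]]
    unfolding v(2)[symmetric] by simp
  ultimately show "w ws \<in> (\<lambda>z. x 0 \<odot>\<^bsub>\<Omega>\<^esub> z) ` Omega_comp n I k e" by blast
qed simp

lemma x0_hcomp: "\<pi> (indet 0 ^ e) \<in> hcomp e"
  unfolding hcomp_iff
  by (intro bexI[of _ "indet 0 ^ e"] conjI S_power S_indet refl)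
    (use homogeneous_power[OF homogeneous_indet[of 0], of e] in simp_all)

section \<open>Hilbert functions of the exterior powers\<close>

lemma HF_Omega_eq: "HF_Omega n I k e = vectorspace.dim class_ring (W.V (Omega_comp n I k e))"
  by (simp add: HF_Omega_def)

lemma HF_Omega_Suc_le:
  assumes k: "k \<ge> 1"
    and red: "\<And>e f. e0 \<le> e \<Longrightarrow> f \<in> S n \<Longrightarrow> homogeneous (Suc e) f \<Longrightarrow>
      \<exists>g\<in>S n. homogeneous e g \<and> f - indet 0 * g \<in> I"
    and e: "k * Suc e0 \<le> e"
  shows "HF_Omega n I k (Suc e) \<le> HF_Omega n I k e"
  unfolding HF_Omega_eq
proof (rule W.dim_image_le[OF ksubspace_Omega_comp ksubspace_Omega_comp _ generates_mono_tuples x_closed])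
  have "x 0 \<odot>\<^bsub>\<Omega>\<^esub> z \<in> Omega_comp n I k (Suc e)" if "z \<in> Omega_comp n I k e" for z
    using Omega_comp_mult[OF k x0_hcomp[of 1] that] by simp
  then show "Omega_comp n I k (Suc e) = (\<lambda>z. x 0 \<odot>\<^bsub>\<Omega>\<^esub> z) ` Omega_comp n I k e"
    using Omega_comp_reduce[OF red e] by blast
qed (simp_all add: finite_mono_tuples)

lemma HF_Omega_pos:
  assumes "z \<in> Omega_comp n I k e" "z \<noteq> \<zero>\<^bsub>\<Omega>\<^esub>"
  shows "HF_Omega n I k e > 0"
  unfolding HF_Omega_eq
  by (rule W.dim_pos[OF ksubspace_Omega_comp _ generates_mono_tuples assms])
    (simp add: finite_mono_tuples)

lemma Omega_comp_reduce_power: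
  assumes red: "\<And>e f. e0 \<le> e \<Longrightarrow> f \<in> S n \<Longrightarrow> homogeneous (Suc e) f \<Longrightarrow>
      \<exists>g\<in>S n. homogeneous e g \<and> f - indet 0 * g \<in> I"
    and e: "k * Suc e0 \<le> e"
  shows "Omega_comp n I k (l + e) \<subseteq> (\<lambda>z. \<pi> (indet 0 ^ l) \<odot>\<^bsub>\<Omega>\<^esub> z) ` Omega_comp n I k e"
proof (induction l)
  case 0
  have "z = \<pi> (indet 0 ^ 0) \<odot>\<^bsub>\<Omega>\<^esub> z" if "z \<in> Omega_comp n I k e" for z
    using Omega_comp_closed[OF that] by (simp add: \<pi>_one)
  then show ?case by auto
next
  case (Suc l)
  show ?case
  proof
    fix z assume "z \<in> Omega_comp n I k (Suc l + e)"
    moreover have "k * Suc e0 \<le> l + e" using e by simp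
    note Omega_comp_reduce[OF red this]
    ultimately obtain z' where z': "z' \<in> Omega_comp n I k (l + e)" "z = x 0 \<odot>\<^bsub>\<Omega>\<^esub> z'"
      unfolding add_Suc by blast
    then obtain y where y: "y \<in> Omega_comp n I k e" "z' = \<pi> (indet 0 ^ l) \<odot>\<^bsub>\<Omega>\<^esub> y"
      using Suc by blast
    have S0: "indet 0 \<in> S n" by (simp add: S_indet)
    have "z = \<pi> (indet 0 ^ Suc l) \<odot>\<^bsub>\<Omega>\<^esub> y"
      unfolding z'(2) y(2) power_Suc \<pi>_mult[OF S0 S_power[OF S0]]
      by (rule W.M.smult_assoc1[OF \<pi>_closed[OF S0] \<pi>_closed[OF S_power[OF S0]]
          Omega_comp_closed[OF y(1)], symmetric])
    then show "z \<in> (\<lambda>z. \<pi> (indet 0 ^ Suc l) \<odot>\<^bsub>\<Omega>\<^esub> z) ` Omega_comp n I k e"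
      using y(1) by blast
  qed
qed

text \<open>Since \<open>f\<^sup>2\<close> turns every \<open>1\<close>-form into a multiple of \<open>dx\<^sub>0\<close>,
  \<open>f\<^sup>4\<close> kills all wedge products with at least two factors.\<close>

lemma fourth_power_kills:
  assumes k: "k \<ge> 2" and f: "f \<in> S n"
    and fl: "\<And>j. j \<le> n \<Longrightarrow> f * (indet j - const (c j) * indet 0) \<in> I"
    and z: "z \<in> Omega_comp n I k e"
  shows "\<pi> (f ^ 4) \<odot>\<^bsub>\<Omega>\<^esub> z = \<zero>\<^bsub>\<Omega>\<^esub>"
proof -
  let ?F = "\<pi> (f ^ 2)"
  have F: "?F \<in> carrier A" by (intro \<pi>_closed S_power f)
  have F4: "\<pi> (f ^ 4) = ?F \<otimes>\<^bsub>A\<^esub> ?F"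
    using \<pi>_mult[OF S_power[OF f, of 2] S_power[OF f, of 2]] by (simp flip: power_add)
  have F4c: "\<pi> (f ^ 4) \<in> carrier A" by (intro \<pi>_closed S_power f)
  have dx0: "d (x 0) \<in> carrier \<Omega>1" by (simp add: dx_closed)
  have "Omega_comp n I k e \<subseteq> {z \<in> carrier \<Omega>. \<pi> (f ^ 4) \<odot>\<^bsub>\<Omega>\<^esub> z \<in> {\<zero>\<^bsub>\<Omega>\<^esub>}}"
  proof (rule Omega_comp_induct[OF W.ksubspace_preimage[OF W.ksubspace_zero F4c]])
    fix ws es assume ws: "homogeneous_tuple ws es e"
    note wsT = homogeneous_tuple_closed[OF ws]
    have k01: "0 < k" "1 < k" using k by auto
    obtain a where a: "a \<in> carrier A" "?F \<odot>\<^bsub>\<Omega>1\<^esub> ws ! 0 = a \<odot>\<^bsub>\<Omega>1\<^esub> d (x 0)"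
      using square_times_Omega1_comp[OF f fl, of "ws ! 0" "es ! 0"] ws k01 by blast
    obtain b where b: "b \<in> carrier A" "?F \<odot>\<^bsub>\<Omega>1\<^esub> ws ! 1 = b \<odot>\<^bsub>\<Omega>1\<^esub> d (x 0)"
      using square_times_Omega1_comp[OF f fl, of "ws ! 1" "es ! 1"] ws k01 by blast
    let ?us = "ws[0 := d (x 0)]"
    have usT: "?us \<in> T" by (rule tuples_update[OF wsT dx0])
    have len: "length ws = k" using ws by blast
    have "?F \<odot>\<^bsub>\<Omega>\<^esub> w ws = w (ws[0 := ?F \<odot>\<^bsub>\<Omega>1\<^esub> ws ! 0])"
      using wedge_smult[OF wsT k01(1) F tuples_nth[OF wsT k01(1)]] by simp
    also have "\<dots> = a \<odot>\<^bsub>\<Omega>\<^esub> w ?us"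
      unfolding a(2) by (rule wedge_smult[OF wsT k01(1) a(1) dx0])
    finally have 1: "?F \<odot>\<^bsub>\<Omega>\<^esub> w ws = a \<odot>\<^bsub>\<Omega>\<^esub> w ?us" .
    \<comment> \<open>With \<open>dx_0\<close> in slot 0, the second square produces
      \<open>dx_0\<close> in slot 1 as well, and the wedge has a repeated entry.\<close>
    have "?F \<odot>\<^bsub>\<Omega>\<^esub> w ?us = w (?us[1 := ?F \<odot>\<^bsub>\<Omega>1\<^esub> ?us ! 1])"
      using wedge_smult[OF usT k01(2) F tuples_nth[OF usT k01(2)]] by (simp only: list_update_id)
    also have "\<dots> = b \<odot>\<^bsub>\<Omega>\<^esub> w (?us[1 := d (x 0)])"
      using wedge_smult[OF usT k01(2) b(1) dx0] b(2) by simp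
    also have "w (?us[1 := d (x 0)]) = \<zero>\<^bsub>\<Omega>\<^esub>"
      using len k01 by (intro wedge_alternating[OF tuples_update[OF usT dx0], of 0 1]) auto
    finally have 2: "?F \<odot>\<^bsub>\<Omega>\<^esub> w ?us = \<zero>\<^bsub>\<Omega>\<^esub>" using b(1) by simp
    have "\<pi> (f ^ 4) \<odot>\<^bsub>\<Omega>\<^esub> w ws = ?F \<odot>\<^bsub>\<Omega>\<^esub> (a \<odot>\<^bsub>\<Omega>\<^esub> w ?us)"
      unfolding F4 W.M.smult_assoc1[OF F F wedge_closed[OF wsT]] 1 ..
    also have "\<dots> = (?F \<otimes>\<^bsub>A\<^esub> a) \<odot>\<^bsub>\<Omega>\<^esub> w ?us"
      by (rule W.M.smult_assoc1[OF F a(1) wedge_closed[OF usT], symmetric])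
    also have "\<dots> = a \<odot>\<^bsub>\<Omega>\<^esub> (?F \<odot>\<^bsub>\<Omega>\<^esub> w ?us)"
      unfolding A.m_comm[OF F a(1)] by (rule W.M.smult_assoc1[OF a(1) F wedge_closed[OF usT]])
    also have "\<dots> = \<zero>\<^bsub>\<Omega>\<^esub>" unfolding 2 using a(1) by simp
    finally show "w ws \<in> {z \<in> carrier \<Omega>. \<pi> (f ^ 4) \<odot>\<^bsub>\<Omega>\<^esub> z \<in> {\<zero>\<^bsub>\<Omega>\<^esub>}}"
      using wedge_closed[OF wsT] by blast
  qed
  then show ?thesis using z by blast
qed

text \<open>Every element of degree \<open>l + e\<close> is \<open>x 0 ^ l\<close> times one of
  degree \<open>e\<close>. This factor equals a sum of fourth powers, each of which annihilates the
  piece of degree \<open>e\<close>.\<close>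

lemma HF_Omega_zero:
  assumes k: "k \<ge> 2"
    and red: "\<And>e f. e0 \<le> e \<Longrightarrow> f \<in> S n \<Longrightarrow> homogeneous (Suc e) f \<Longrightarrow>
      \<exists>g\<in>S n. homogeneous e g \<and> f - indet 0 * g \<in> I"
    and B: "finite B" "\<And>b. b \<in> B \<Longrightarrow> f b \<in> S n"
    and fl: "\<And>b j. b \<in> B \<Longrightarrow> j \<le> n \<Longrightarrow> f b * (indet j - const (c b j) * indet 0) \<in> I"
    and x0: "indet 0 ^ l - (\<Sum>b\<in>B. f b ^ 4) \<in> I"
    and e: "k * Suc e0 \<le> e"
  shows "HF_Omega n I k (l + e) = 0"
proof -
  have kill: "\<pi> (\<Sum>b\<in>C. f b ^ 4) \<odot>\<^bsub>\<Omega>\<^esub> z = \<zero>\<^bsub>\<Omega>\<^esub>"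
    if "C \<subseteq> B" "z \<in> Omega_comp n I k e" for C z
    using finite_subset[OF that(1) B(1)] that(1)
  proof (induction C rule: finite_induct)
    case empty
    show ?case using W.M.lmult_0[OF Omega_comp_closed[OF that(2)]] by (simp add: \<pi>_zero)
  next
    case (insert b C)
    have S: "f b ^ 4 \<in> S n" "(\<Sum>b\<in>C. f b ^ 4) \<in> S n"
      using insert.prems B(2) by (auto intro!: S_power S_sum)
    have "\<pi> (\<Sum>b\<in>insert b C. f b ^ 4) = \<pi> (f b ^ 4) \<oplus>\<^bsub>A\<^esub> \<pi> (\<Sum>b\<in>C. f b ^ 4)"
      using insert.hyps \<pi>_add[OF S] by simp
    moreover have "\<pi> (f b ^ 4) \<odot>\<^bsub>\<Omega>\<^esub> z = \<zero>\<^bsub>\<Omega>\<^esub>"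
      using insert.prems by (intro fourth_power_kills[OF k B(2) fl that(2)]) auto
    moreover have "\<pi> (\<Sum>b\<in>C. f b ^ 4) \<odot>\<^bsub>\<Omega>\<^esub> z = \<zero>\<^bsub>\<Omega>\<^esub>"
      using insert by blast
    ultimately show ?case
      using W.M.smult_l_distr[OF \<pi>_closed[OF S(1)] \<pi>_closed[OF S(2)] Omega_comp_closed[OF that(2)]]
      by simp
  qed
  have S0: "indet 0 \<in> S n" by (simp add: S_indet)
  have eq: "\<pi> (indet 0 ^ l) = \<pi> (\<Sum>b\<in>B. f b ^ 4)"
  proof -
    have "(\<Sum>b\<in>B. f b ^ 4) \<in> S n" by (intro S_sum S_power B(2))
    from \<pi>_eq_iff[OF S_power[OF S0] this] show ?thesis using x0 by simp
  qed
  have "Omega_comp n I k (l + e) \<subseteq> {\<zero>\<^bsub>\<Omega>\<^esub>}"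
    using Omega_comp_reduce_power[OF red e, of l] kill[OF subset_refl] unfolding eq by blast
  then have "Omega_comp n I k (l + e) = {\<zero>\<^bsub>\<Omega>\<^esub>}"
    using W.ksubspaceD(2)[OF ksubspace_Omega_comp] by blast
  then show ?thesis unfolding HF_Omega_eq by (rule W.dim_zero)
qed

end

section \<open>Hilbert polynomials of eventually constant functions\<close>

text \<open>Any other candidate agrees with the constant at all large natural numbers, so the
  difference has infinitely many rational roots and is zero.\<close>

lemma hilbert_polynomial_const:
  assumes "\<And>d. d \<ge> N \<Longrightarrow> H d = c"
  shows "hilbert_polynomial H = [:of_nat c:]"
  unfolding hilbert_polynomial_def
proof (rule the_equality)
  show "is_hilbert_polynomial H [:of_nat c:]"
    unfolding is_hilbert_polynomial_def eventually_sequentially using assms by auto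
  fix p assume "is_hilbert_polynomial H p"
  then obtain N' where N': "\<And>d. d \<ge> N' \<Longrightarrow> of_nat (H d) = poly p (of_nat d)"
    unfolding is_hilbert_polynomial_def eventually_sequentially by blast
  let ?q = "p - [:of_nat c:]"
  have "of_nat ` {max N N'..} \<subseteq> {z. poly ?q z = 0}"
    using assms N' by (auto simp flip: N')
  moreover have "infinite ((of_nat :: nat \<Rightarrow> rat) ` {max N N'..})"
    by (simp add: finite_image_iff infinite_Ici)
  ultimately have "?q = 0" using poly_roots_finite[of ?q] finite_subset by blast
  then show "p = [:of_nat c:]" by simp
qed

text \<open>Take a place \<open>N'\<close> where the minimum over the tail is attained: from there
  on the values cannot rise by monotonicity nor fall by minimality.\<close>

lemma eventually_const_if_decreasing:
  fixes f :: "nat \<Rightarrow> nat"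
  assumes "\<And>d. d \<ge> N \<Longrightarrow> f (Suc d) \<le> f d"
  shows "\<exists>N'\<ge>N. \<forall>d\<ge>N'. f d = f N'"
proof -
  obtain N' where N': "N' \<ge> N" "\<And>d. d \<ge> N \<Longrightarrow> f N' \<le> f d"
    using ex_has_least_nat[of "\<lambda>d. d \<ge> N" N f] by blast
  have "f d \<le> f N'" if "d \<ge> N'" for d
    using that
  proof (induction d rule: dec_induct)
    case (step d)
    then show ?case using assms[of d] N'(1) by linarith
  qed simp
  then have "\<forall>d\<ge>N'. f d = f N'" using N' by (meson antisym order_trans)
  then show ?thesis using N'(1) by blast
qed

section \<open>Determinants of gradients\<close>

context graded_quotient
begin

text \<open>An additive map that vanishes on \<open>I\<close> takes the same value on all
  representatives of a class, so any choice of representative defines the induced map.\<close>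

lemma \<pi>_functional:
  assumes "\<And>f g. T (f + g) = T f + (T g :: 'k)" "\<And>f. f \<in> I \<Longrightarrow> T f = 0"
  shows "\<exists>t. \<forall>f\<in>S n. t (\<pi> f) = T f"
proof (intro exI ballI)
  fix f :: "'k mpoly" assume f: "f \<in> S n"
  let ?P = "\<lambda>g. g \<in> S n \<and> \<pi> f = \<pi> g"
  have "?P (Eps ?P)" by (rule someI[of ?P f]) (use f in blast)
  then have "f - Eps ?P \<in> I" using \<pi>_eq_iff[OF f] by blast
  then have "T (f - Eps ?P) = 0" by (rule assms(2))
  then have "T f = T (Eps ?P)" using assms(1)[of "f - Eps ?P" "Eps ?P"] by simp
  then show "(\<lambda>C. T (SOME g. g \<in> S n \<and> C = \<pi> g)) (\<pi> f) = T f" by simp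
qed

end

text \<open>If all elements of \<open>I\<close> are singular at \<open>u\<close>, then the gradient at \<open>u\<close> is a derivation of
  the coordinate ring, so the top wedge product maps to \<open>K\<close> by the determinant of gradients.\<close>

lemma top_form_nonzero:
  fixes u :: "nat \<Rightarrow> 'k::field"
  assumes "graded_quotient n I" and u0: "u 0 \<noteq> 0"
    and sing: "\<And>f. f \<in> I \<Longrightarrow> mpoly_eval u f = 0" "\<And>f j. f \<in> I \<Longrightarrow> mpoly_grad u j f = 0"
  shows "\<exists>z\<in>Omega_comp n I (n + 1) (e + (n + 1)). z \<noteq> \<zero>\<^bsub>Omega n I (n + 1)\<^esub>"
proof -
  interpret graded_quotient n I by fact
  interpret graded_forms n I "n + 1" ..
  obtain \<psi> where \<psi>: "\<And>f. f \<in> S n \<Longrightarrow> \<psi> (\<pi> f) = mpoly_eval u f"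
    using \<pi>_functional[of "mpoly_eval u", OF mpoly_eval_add sing(1)] by blast
  have "\<exists>t. \<forall>f\<in>S n. t (\<pi> f) = mpoly_grad u j f" for j
    by (rule \<pi>_functional[OF mpoly_grad_add sing(2)])
  then have "\<forall>j. \<exists>t. \<forall>f\<in>S n. t (\<pi> f) = mpoly_grad u j f" by blast
  from choice[OF this] obtain \<delta> where
    \<delta>: "\<And>j f. f \<in> S n \<Longrightarrow> \<delta> j (\<pi> f) = mpoly_grad u j f"
    by blast
  have rf: "ring_to_field A \<psi>"
  proof (intro ring_to_field.intro ring_to_field_axioms.intro A.is_cring)
    fix a b assume "a \<in> carrier A" "b \<in> carrier A"
    then obtain f g where fg: "f \<in> S n" "a = \<pi> f" "g \<in> S n" "b = \<pi> g"
      unfolding carrier_A by blast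
    show "\<psi> (a \<oplus>\<^bsub>A\<^esub> b) = \<psi> a + \<psi> b"
      using \<psi>[OF S_add[OF fg(1,3)]] \<psi>[OF fg(1)] \<psi>[OF fg(3)]
      by (simp add: fg(2,4) \<pi>_add[OF fg(1,3)] mpoly_eval_add)
    show "\<psi> (a \<otimes>\<^bsub>A\<^esub> b) = \<psi> a * \<psi> b"
      using \<psi>[OF S_mult[OF fg(1,3)]] \<psi>[OF fg(1)] \<psi>[OF fg(3)]
      by (simp add: fg(2,4) \<pi>_mult[OF fg(1,3)] mpoly_eval_mult)
  next
    show "\<psi> \<one>\<^bsub>A\<^esub> = 1" using \<psi>[OF S_one] by (simp add: \<pi>_one mpoly_eval_one)
  qed
  \<comment> \<open>For each \<open>j\<close> the partial derivative at \<open>u\<close> is a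
    derivation over \<open>\<psi>\<close> and so induces a linear form on the differentials.\<close>
  have "\<exists>L. (\<forall>y\<in>carrier \<Omega>1. \<forall>z\<in>carrier \<Omega>1. L (y \<oplus>\<^bsub>\<Omega>1\<^esub> z) = L y + L z) \<and>
      (\<forall>r\<in>carrier A. \<forall>y\<in>carrier \<Omega>1. L (r \<odot>\<^bsub>\<Omega>1\<^esub> y) = \<psi> r * L y) \<and>
      (\<forall>r\<in>carrier A. L (d r) = \<delta> j r)" for j
  proof (rule Kae.functional[OF rf, of "\<delta> j", unfolded \<Omega>1_eq])
    fix a b assume "a \<in> carrier A" "b \<in> carrier A"
    then obtain f g where fg: "f \<in> S n" "a = \<pi> f" "g \<in> S n" "b = \<pi> g"
      unfolding carrier_A by blast
    show "\<delta> j (a \<oplus>\<^bsub>A\<^esub> b) = \<delta> j a + \<delta> j b"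
      using \<delta>[OF S_add[OF fg(1,3)], of j] \<delta>[OF fg(1), of j] \<delta>[OF fg(3), of j]
      by (simp add: fg(2,4) \<pi>_add[OF fg(1,3)] mpoly_grad_add)
    show "\<delta> j (a \<otimes>\<^bsub>A\<^esub> b) = \<psi> a * \<delta> j b + \<psi> b * \<delta> j a"
      using \<delta>[OF S_mult[OF fg(1,3)], of j] \<delta>[OF fg(1), of j] \<delta>[OF fg(3), of j]
        \<psi>[OF fg(1)] \<psi>[OF fg(3)]
      by (simp add: fg(2,4) \<pi>_mult[OF fg(1,3)] mpoly_grad_mult)
  next
    fix c :: 'k
    show "\<delta> j (\<phi> c) = 0" using \<delta>[OF S_const, of j c] by (simp add: \<phi>_eq mpoly_grad_const)
  next
    fix L assume "\<And>y z. y \<in> carrier \<Omega>1 \<Longrightarrow> z \<in> carrier \<Omega>1 \<Longrightarrow> L (y \<oplus>\<^bsub>\<Omega>1\<^esub> z) = L y + L z"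
      "\<And>r y. r \<in> carrier A \<Longrightarrow> y \<in> carrier \<Omega>1 \<Longrightarrow> L (r \<odot>\<^bsub>\<Omega>1\<^esub> y) = \<psi> r * L y"
      "\<And>r. r \<in> carrier A \<Longrightarrow> L (d r) = \<delta> j r"
    then show ?thesis by (intro exI[of _ L]) simp
  qed
  then have "\<forall>j. \<exists>L. (\<forall>y\<in>carrier \<Omega>1. \<forall>z\<in>carrier \<Omega>1. L (y \<oplus>\<^bsub>\<Omega>1\<^esub> z) = L y + L z) \<and>
      (\<forall>r\<in>carrier A. \<forall>y\<in>carrier \<Omega>1. L (r \<odot>\<^bsub>\<Omega>1\<^esub> y) = \<psi> r * L y) \<and>
      (\<forall>r\<in>carrier A. L (d r) = \<delta> j r)"
    by blast
  from choice[OF this] obtain L where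
    L_add: "\<And>j y z. y \<in> carrier \<Omega>1 \<Longrightarrow> z \<in> carrier \<Omega>1 \<Longrightarrow> L j (y \<oplus>\<^bsub>\<Omega>1\<^esub> z) = L j y + L j z" and
    L_smult: "\<And>j r y. r \<in> carrier A \<Longrightarrow> y \<in> carrier \<Omega>1 \<Longrightarrow> L j (r \<odot>\<^bsub>\<Omega>1\<^esub> y) = \<psi> r * L j y" and
    L_d: "\<And>j r. r \<in> carrier A \<Longrightarrow> L j (d r) = \<delta> j r"
    by blast
  define N where "N = n + 1"
  \<comment> \<open>Rows are encoded as functions so that replacing a tuple entry becomes a function
    update of one row.\<close>
  define M where "M r = mat N N (\<lambda>(i, j). r i j)" for r :: "nat \<Rightarrow> nat \<Rightarrow> 'k"
  have M_carrier: "M r \<in> carrier_mat N N" for r by (simp add: M_def)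
  have det_add: "det (M (r(i := \<lambda>j. a j + b j))) = det (M (r(i := a))) + det (M (r(i := b)))"
    if "i < N" for r i a b
  proof -
    have *: "M (r(i := c)) = mat\<^sub>r N N (\<lambda>l. if l = i then vec N c else vec N (r l))" for c
      unfolding M_def by (rule eq_matI) auto
    have e: "vec N (\<lambda>j. a j + b j) = vec N a + vec N b" by (rule eq_vecI) auto
    then show ?thesis
      unfolding * e using det_row_add[of "\<lambda>_. vec N a" i N "\<lambda>_. vec N b" "\<lambda>l. vec N (r l)"] that by simp
  qed
  have det_smult: "det (M (r(i := \<lambda>j. c * a j))) = c * det (M (r(i := a)))" if "i < N" for r i c a
  proof -
    have "M (r(i := \<lambda>j. c * a j)) = multrow i c (M (r(i := a)))"
      unfolding M_def by (rule eq_matI) auto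
    then show ?thesis using det_multrow[OF that M_carrier] by simp
  qed
  \<comment> \<open>Row \<open>i\<close> is the gradient vector of the \<open>i\<close>-th form;
    multilinearity and alternation in the forms are those of the determinant in its rows.\<close>
  define D where "D ys = det (M (\<lambda>i j. L j (ys ! i)))" for ys
  have upd: "D (ys[i := y]) = det (M ((\<lambda>i j. L j (ys ! i))(i := \<lambda>j. L j y)))"
    if "ys \<in> T" "i < n + 1" for ys i y
  proof -
    have "(\<lambda>l j. L j (ys[i := y] ! l)) = (\<lambda>i j. L j (ys ! i))(i := \<lambda>j. L j y)"
      using that by (auto simp: fun_eq_iff tuples_def nth_list_update)
    then show ?thesis unfolding D_def by simp
  qed
  obtain Q where Q_smult: "\<And>r y. r \<in> carrier A \<Longrightarrow> y \<in> carrier \<Omega> \<Longrightarrow> Q (r \<odot>\<^bsub>\<Omega>\<^esub> y) = \<psi> r * Q y"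
    and Q_wedge: "\<And>ys. ys \<in> T \<Longrightarrow> Q (w ys) = D ys"
    and Q_add: "\<And>y z. y \<in> carrier \<Omega> \<Longrightarrow> z \<in> carrier \<Omega> \<Longrightarrow> Q (y \<oplus>\<^bsub>\<Omega>\<^esub> z) = Q y + Q z"
  proof (rule E.functional[OF rf, of D, unfolded \<Omega>_eq])
    fix ys i y z assume a: "ys \<in> T" "i < n + 1" "y \<in> carrier \<Omega>1" "z \<in> carrier \<Omega>1"
    show "D (ys[i := y \<oplus>\<^bsub>\<Omega>1\<^esub> z]) = D (ys[i := y]) + D (ys[i := z])"
      unfolding upd[OF a(1,2)] L_add[OF a(3,4)] by (rule det_add) (use a(2) in \<open>simp add: N_def\<close>)
  next
    fix ys i r y assume a: "ys \<in> T" "i < n + 1" "r \<in> carrier A" "y \<in> carrier \<Omega>1"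
    show "D (ys[i := r \<odot>\<^bsub>\<Omega>1\<^esub> y]) = \<psi> r * D (ys[i := y])"
      unfolding upd[OF a(1,2)] L_smult[OF a(3,4)] by (rule det_smult) (use a(2) in \<open>simp add: N_def\<close>)
  next
    fix ys i j assume a: "ys \<in> T" "i < j" "j < n + 1" "ys ! i = ys ! j"
    show "D ys = 0"
      unfolding D_def
    proof (rule det_identical_rows[OF M_carrier])
      show "row (M (\<lambda>i j. L j (ys ! i))) i = row (M (\<lambda>i j. L j (ys ! i))) j"
        using a(2-4) unfolding M_def by (intro eq_vecI) (auto simp: N_def)
    qed (use a(2,3) in \<open>auto simp: N_def\<close>)
  next
    fix Q assume "\<And>y z. y \<in> carrier \<Omega> \<Longrightarrow> z \<in> carrier \<Omega> \<Longrightarrow> Q (y \<oplus>\<^bsub>\<Omega>\<^esub> z) = Q y + Q z"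
      "\<And>r y. r \<in> carrier A \<Longrightarrow> y \<in> carrier \<Omega> \<Longrightarrow> Q (r \<odot>\<^bsub>\<Omega>\<^esub> y) = \<psi> r * Q y"
      "\<And>ys. ys \<in> T \<Longrightarrow> Q (w ys) = D ys"
    then show thesis using that by blast
  qed
  define ds where "ds = map (\<lambda>i. d (x i)) [0..<n + 1]"
  have ds_nth: "ds ! i = d (x i)" if "i < n + 1" for i using that unfolding ds_def by (simp del: upt_Suc)
  \<comment> \<open>Each \<open>dx_i\<close> is the generator with coefficient 1 of degree 0, so it
    has degree 1.\<close>
  have hom: "homogeneous_tuple ds (replicate (n + 1) 1) (n + 1)"
  proof (intro conjI allI impI)
    fix i assume i: "i < n + 1"
    have "\<pi> 1 \<odot>\<^bsub>\<Omega>1\<^esub> d (x i) \<in> Omega1_comp n I (Suc 0)"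
      using i by (intro Omega1_comp_gen S_one homogeneous_one) simp
    then show "ds ! i \<in> Omega1_comp n I (replicate (n + 1) 1 ! i)"
      using i dx_closed[of i] ds_nth[OF i] by (simp add: \<pi>_one del: replicate_Suc)
  qed (simp_all add: ds_def sum_list_replicate)
  note dsT = homogeneous_tuple_closed[OF hom]
  \<comment> \<open>The power of \<open>x 0\<close> raises the degree to \<open>e + (n + 1)\<close>,
    and under \<open>Q\<close> it contributes \<open>u 0 ^ e\<close>, which is nonzero.\<close>
  let ?z = "\<pi> (indet 0 ^ e) \<odot>\<^bsub>\<Omega>\<^esub> w ds"
  have z: "?z \<in> Omega_comp n I (n + 1) (e + (n + 1))"
    by (rule Omega_comp_mult[OF _ x0_hcomp Omega_comp_gen[OF hom]]) simp
  have S0: "indet 0 ^ e \<in> S n" by (intro S_power S_indet) simp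
  \<comment> \<open>The gradients of the variables are the unit vectors, so the determinant is that
    of the identity matrix.\<close>
  have "L j (ds ! i) = (if i = j then 1 else 0)" if "i < N" "j < N" for i j
    using that ds_nth[of i] L_d[OF x_closed[of i], of j] \<delta>[OF S_indet[of i n], of j]
    by (simp add: N_def mpoly_grad_indet)
  then have "M (\<lambda>i j. L j (ds ! i)) = 1\<^sub>m N"
    unfolding M_def by (intro eq_matI) auto
  then have "Q (w ds) = 1" using Q_wedge[OF dsT] by (simp add: D_def)
  then have "Q ?z = u 0 ^ e"
    using Q_smult[OF \<pi>_closed[OF S0] wedge_closed[OF dsT]] \<psi>[OF S0]
    by (simp add: mpoly_eval_power mpoly_eval_indet)
  moreover have "Q \<zero>\<^bsub>\<Omega>\<^esub> = 0"
    using Q_add[OF W.M.zero_closed W.M.zero_closed] unfolding W.M.l_zero[OF W.M.zero_closed]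
    by (metis add_cancel_right_right)
  ultimately have "?z \<noteq> \<zero>\<^bsub>\<Omega>\<^esub>" using u0 by auto
  then show ?thesis using z by blast
qed

section \<open>Hilbert polynomials for fat point schemes\<close>

context fat_points
begin

sublocale graded_quotient n I
  by unfold_locales

lemma HP_Omega_const:
  assumes "k \<ge> 1"
  shows "\<exists>N. (\<forall>e\<ge>N. HF_Omega n I k e = HF_Omega n I k N) \<and>
    HP_Omega n I k = [:of_nat (HF_Omega n I k N):]"
proof -
  interpret graded_forms n I k ..
  \<comment> \<open>The threshold allows each of the \<open>k\<close> entries the degree bound for
    reduction modulo \<open>I\<close>, plus one for its differential.\<close>
  have "HF_Omega n I k (Suc e) \<le> HF_Omega n I k e"
    if "k * Suc (n * (\<Sum>i\<in>{1..s}. m i)) \<le> e" for e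
    by (rule HF_Omega_Suc_le[OF assms _ that]) (rule reduce_mod_I)
  from eventually_const_if_decreasing[where f = "HF_Omega n I k", OF this]
  obtain N where N: "\<And>e. e \<ge> N \<Longrightarrow> HF_Omega n I k e = HF_Omega n I k N"
    by blast
  from hilbert_polynomial_const[where H = "HF_Omega n I k", OF N]
  have "HP_Omega n I k = [:of_nat (HF_Omega n I k N):]" unfolding HP_Omega_def .
  with N show ?thesis by (intro exI[of _ N] conjI allI impI)
qed

lemma HP_Omega_pos:
  assumes i: "i \<in> {1..s}" and m: "m i \<ge> 2"
  shows "poly (HP_Omega n I (n + 1)) z > 0"
proof -
  interpret graded_forms n I "n + 1" ..
  obtain N where N: "\<And>e. e \<ge> N \<Longrightarrow> HF_Omega n I (n + 1) e = HF_Omega n I (n + 1) N"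
    "HP_Omega n I (n + 1) = [:of_nat (HF_Omega n I (n + 1) N):]"
    using HP_Omega_const[OF le_add2[of 1 n]] by blast
  \<comment> \<open>The degree is chosen beyond \<open>N\<close>, where the Hilbert function already
    equals the constant Hilbert polynomial.\<close>
  have "\<exists>z\<in>Omega_comp n I (n + 1) (N + (n + 1)). z \<noteq> \<zero>\<^bsub>Omega n I (n + 1)\<^esub>"
    using singular_at_fat_point[OF i m] v0[OF i]
    by (intro top_form_nonzero[where u = "v i"] graded_quotient_axioms) auto
  then have "HF_Omega n I (n + 1) (N + (n + 1)) > 0" using HF_Omega_pos by blast
  then show ?thesis using N(1)[of "N + (n + 1)"] N(2) by simp
qed

lemma HP_Omega_reduced:
  assumes m: "\<And>i. i \<in> {1..s} \<Longrightarrow> m i = 1" and k: "k \<ge> 2"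
  shows "HP_Omega n I k = 0"
proof -
  interpret graded_forms n I k ..
  have "\<forall>i\<in>{1..s}. \<exists>f. f \<in> S n \<and> homogeneous (s - 1) f \<and> mpoly_eval (v i) f = 1 \<and>
      (\<forall>j\<in>{1..s}. j \<noteq> i \<longrightarrow> mpoly_eval (v j) f = 0)"
    using separators by metis
  from bchoice[OF this] obtain f where f: "\<And>i. i \<in> {1..s} \<Longrightarrow> f i \<in> S n"
    "\<And>i. i \<in> {1..s} \<Longrightarrow> homogeneous (s - 1) (f i)"
    "\<And>i. i \<in> {1..s} \<Longrightarrow> mpoly_eval (v i) (f i) = 1"
    "\<And>i j. i \<in> {1..s} \<Longrightarrow> j \<in> {1..s} \<Longrightarrow> j \<noteq> i \<Longrightarrow> mpoly_eval (v j) (f i) = 0"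
    by blast
  \<comment> \<open>The linear form vanishes at point \<open>i\<close>, and \<open>f i\<close>
    vanishes at all other points.\<close>
  have fl: "f i * lin i j \<in> I" if i: "i \<in> {1..s}" and j: "j \<le> n" for i j
  proof (rule reduced_in_I[OF m])
    show "f i * lin i j \<in> S n" by (intro S_mult f(1) S_lin i j)
    show "homogeneous (s - 1 + 1) (f i * lin i j)" by (intro homogeneous_mult f(2) homogeneous_lin i)
    show "mpoly_eval (v l) (f i * lin i j) = 0" if l: "l \<in> {1..s}" for l
      using f(4)[OF i l] v0[OF l] by (cases "l = i") (simp_all add: mpoly_eval_mult eval_lin)
  qed
  \<comment> \<open>At each chosen vector the power of \<open>X_0\<close> has value 1, and in the
    sum exactly one term is 1 while the others are 0. Both sides have degree
    \<open>4 * (s - 1)\<close>.\<close>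
  have x0: "indet 0 ^ (4 * (s - 1)) - (\<Sum>i\<in>{1..s}. f i ^ 4) \<in> I"
  proof (rule reduced_in_I[OF m])
    show "indet 0 ^ (4 * (s - 1)) - (\<Sum>i\<in>{1..s}. f i ^ 4) \<in> S n"
      by (intro S_diff S_power S_sum S_indet f(1)) simp_all
    show "homogeneous (4 * (s - 1)) (indet 0 ^ (4 * (s - 1)) - (\<Sum>i\<in>{1..s}. f i ^ 4))"
      using homogeneous_power[OF homogeneous_indet[of 0], of "4 * (s - 1)"] homogeneous_power[OF f(2), of _ 4]
      by (intro homogeneous_diff homogeneous_sum) simp_all
    fix l assume l: "l \<in> {1..s}"
    have "(\<Sum>i\<in>{1..s}. mpoly_eval (v l) (f i) ^ 4) = (\<Sum>i\<in>{1..s}. if i = l then 1 else 0)"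
      using f(3,4) l by (intro sum.cong) auto
    also have "\<dots> = 1" using l by simp
    finally show "mpoly_eval (v l) (indet 0 ^ (4 * (s - 1)) - (\<Sum>i\<in>{1..s}. f i ^ 4)) = 0"
      using v0[OF l]
      by (simp add: mpoly_eval_diff mpoly_eval_power mpoly_eval_indet mpoly_eval_sum)
  qed
  let ?N = "k * Suc (n * (\<Sum>i\<in>{1..s}. m i))"
  have "HF_Omega n I k e = 0" if e: "e \<ge> 4 * (s - 1) + ?N" for e
  proof -
    have "HF_Omega n I k (4 * (s - 1) + (e - 4 * (s - 1))) = 0"
      using e by (intro HF_Omega_zero[OF k reduce_mod_I _ f(1) fl x0]) auto
    then show ?thesis using e by simp
  qed
  from hilbert_polynomial_const[OF this] show ?thesis unfolding HP_Omega_def by simp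
qed

end

theorem corollary7p5:
  fixes n s :: nat
    and P :: "nat \<Rightarrow> (nat \<Rightarrow> 'k::field_char_0) set"
    and m :: "nat \<Rightarrow> nat"
  assumes "n \<ge> 1" and "s \<ge> 1"
    and "\<And>i. i \<in> {1..s} \<Longrightarrow> P i \<in> proj_space n"
    and "inj_on P {1..s}"
    and "\<And>i v. i \<in> {1..s} \<Longrightarrow> v \<in> P i \<Longrightarrow> v 0 \<noteq> 0"
    and "\<And>i. i \<in> {1..s} \<Longrightarrow> m i \<ge> 1"
  shows "(Max (m ` {1..s}) > 1 \<longleftrightarrow>
           (\<exists>k\<in>{2..n + 1}. \<forall>z. poly (HP_Omega n (fat_ideal n s P m) k) z > 0)) \<and>
         ((\<exists>k\<in>{2..n + 1}. \<forall>z. poly (HP_Omega n (fat_ideal n s P m) k) z > 0) \<longleftrightarrow>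
           (\<forall>z. poly (HP_Omega n (fat_ideal n s P m) (n + 1)) z > 0))"
proof -
  have "\<forall>i\<in>{1..s}. \<exists>v. v \<in> coord_vectors n \<and> v 0 = 1 \<and> P i = proj_rel n `` {v}"
  proof
    fix i assume i: "i \<in> {1..s}"
    show "\<exists>v. v \<in> coord_vectors n \<and> v 0 = 1 \<and> P i = proj_rel n `` {v}"
    proof (rule proj_space_normalize[OF assms(3)[OF i]])
      show "v 0 \<noteq> 0" if "v \<in> P i" for v using assms(5)[OF i that] .
    qed blast
  qed
  from bchoice[OF this] obtain v where v: "\<And>i. i \<in> {1..s} \<Longrightarrow> v i \<in> coord_vectors n"
    "\<And>i. i \<in> {1..s} \<Longrightarrow> v i 0 = 1" "\<And>i. i \<in> {1..s} \<Longrightarrow> P i = proj_rel n `` {v i}"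
    by blast
  \<comment> \<open>A normalized vector determines its point, so distinct points have distinct
    vectors.\<close>
  have inj: "inj_on v {1..s}"
  proof (rule inj_onI)
    fix i j assume "i \<in> {1..s}" "j \<in> {1..s}" "v i = v j"
    then show "i = j" using v(3)[of i] v(3)[of j] inj_onD[OF assms(4), of i j] by simp
  qed
  interpret fat_points n s P m v
    by (rule fat_points.intro[OF assms(2) v inj])
  have fin: "finite (m ` {1..s})" "m ` {1..s} \<noteq> {}" using assms(2) by auto
  have ac: "\<forall>z. poly (HP_Omega n I (n + 1)) z > 0" if max: "Max (m ` {1..s}) > 1"
  proof -
    obtain i where "i \<in> {1..s}" "m i \<ge> 2"
      using max unfolding Max_gr_iff[OF fin] by fastforce
    then show ?thesis using HP_Omega_pos by blast
  qed
  have ba: "Max (m ` {1..s}) > 1" if "k \<in> {2..n + 1}" "\<forall>z. poly (HP_Omega n I k) z > 0" for k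
  proof (rule ccontr)
    assume "\<not> ?thesis"
    \<comment> \<open>A maximum of at most 1, together with positivity of the multiplicities, leaves
      only the value 1.\<close>
    then have "m i = 1" if "i \<in> {1..s}" for i
      using that assms(6)[OF that] unfolding Max_gr_iff[OF fin] by force
    then have "HP_Omega n I k = 0" using \<open>k \<in> {2..n + 1}\<close> by (intro HP_Omega_reduced) auto
    then show False using \<open>\<forall>z. poly (HP_Omega n I k) z > 0\<close> by simp
  qed
  \<comment> \<open>Since \<open>n \<ge> 1\<close>, condition (c) is an instance of (b). Together
    with \<open>ac\<close>, from (a) to (c), and \<open>ba\<close>, from (b) to (a), this closes the
    circle.\<close>
  have "n + 1 \<in> {2..n + 1}" using assms(1) by simp
  then show ?thesis using ac ba by blast
qed

end
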